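(* Using the definition that accumulates $\mathcal{D}(nat)$, $\mathcal{D}_{list}(atm)$, $\mathcal{D}(intuit)$, $\mathcal{D}(lambda)$ and the clause $X\equiv X\triangleq\top$ (for $\equiv\,: i\to i\to o$), the following formulas are derivable in $FO\lambda^{\Delta\mathbb{N}}$ ($\supset$ associating to the right): Determinacy: $\forall m\forall m_1\forall m_2(\vdash\langle m\Downarrow m_1\rangle\supset\ \vdash\langle m\Downarrow m_2\rangle\supset m_1\equiv m_2)$; $\forall m\forall m_1\forall m_2(\vdash\langle m\leadsto m_1\rangle\supset\ \vdash\langle m\leadsto m_2\rangle\supset m_1\equiv m_2)$; $\forall m\forall r_1\forall r_2(\vdash\langle m\leadsto^*(abs\,r_1)\rangle\supset\ \vdash\langle m\leadsto^*(abs\,r_2)\rangle\supset(abs\,r_1)\equiv(abs\,r_2))$. Equivalence: $\forall m\forall r(\vdash\langle m\Downarrow(abs\,r)\rangle\supset\ \vdash\langle m\leadsto^*(abs\,r)\rangle)$; $\forall m\forall r(\vdash\langle m\leadsto^*(abs\,r)\rangle\supset\ \vdash\langle m\Downarrow(abs\,r)\rangle)$. Subject reduction: for each $R\in\{\Downarrow,\leadsto,\leadsto^*\}$, $\forall m\forall n(\vdash\langle m\,R\,n\rangle\supset\forall t(\vdash\langle typeof\,m\,t\rangle\supset\ \vdash\langle typeof\,n\,t\rangle))$.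
   Context: $FO\lambda^{\Delta\mathbb{N}}$ is the following intuitionistic sequent calculus. Terms are simply typed $\lambda$-terms (up to $\alpha\beta\eta$-conversion) over a signature of typed constants; $o$ is the type of formulas, and quantifiers range only over types not containing $o$. Formulas are built from atomic formulas with $\bot,\top,\land,\lor,\supset,\forall,\exists$. There is a type $nt$ with constants $z:nt$, $s:nt\to nt$ and a predicate $nat: nt\to o$. Sequents are $\Gamma\longrightarrow B$, $\Gamma$ a finite multiset. Rules: $\bot,\Gamma\longrightarrow B$ and $\Gamma\longrightarrow\top$ are axioms; the usual intuitionistic left and right rules for $\land,\lor,\supset,\forall,\exists$ (with the usual eigenvariable conditions); initial sequents $A,\Gamma\longrightarrow A$ for atomic $A$; left contraction; cut. For $nat$: $\Gamma\longrightarrow nat\,z$; from $\Gamma\longrightarrow nat\,I$ infer $\Gamma\longrightarrow nat\,(s\,I)$; induction: for $B:nt\to o$ and eigenvariable $j$ not free in $B$, from $\longrightarrow B\,z$, $B\,j\longrightarrow B\,(s\,j)$, $B\,I,\Gamma\longrightarrow C$ infer $nat\,I,\Gamma\longrightarrow C$. Relative to a definition (set of clauses $\forall\bar x[p\,\bar t\triangleq B]$, free variables of $B$ occurring in $\bar t$, satisfying a level condition): right rule: from $\Gamma\longrightarrow B\theta$ infer $\Gamma\longrightarrow p\,\bar u$ when $p\,\bar u=(p\,\bar t)\theta$; left rule: infer $p\,\bar u,\Gamma\longrightarrow C$ from the premises $B\theta,\Gamma\theta\longrightarrow C\theta$ for every clause (renamed apart) and every $\theta$ in a complete set of unifiers of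 $p\,\bar u$ and $p\,\bar t$. A formula is derivable using a definition if $\longrightarrow F$ has a derivation. $\mathcal{D}(nat)$: predicates $=,<,\le: nt\to nt\to o$, $sum: nt\to nt\to nt\to o$; clauses $I=I\triangleq\top$; $sum\,z\,J\,J\triangleq nat\,J$; $sum\,(s\,I)\,J\,(s\,K)\triangleq sum\,I\,J\,K$; $z<(s\,J)\triangleq nat\,J$; $(s\,I)<(s\,J)\triangleq I<J$; $I\le I\triangleq\top$; $I\le J\triangleq I<J$. Object logic: types $i$, $atm$, $prp$, constants $\langle\cdot\rangle: atm\to prp$, $tt: prp$, $\&: prp\to prp\to prp$, $\Rightarrow: atm\to prp\to prp$, $\bigwedge: (i\to prp)\to prp$. $atmlst$ is the list type over $atm$ with $nil$ and infix $::$. $\mathcal{D}_{list}(atm)$ has clauses $length\,nil\,z\triangleq\top$; $length\,(X::L)\,(s\,I)\triangleq length\,L\,I$; $list\,L\triangleq\exists i(nat\,i\land length\,L\,i)$; $element\,X\,(X::L)\triangleq\top$; $element\,X\,(Y::L)\triangleq element\,X\,L$; $split\,nil\,nil\,nil\triangleq\top$; $split\,(X::L_1)\,(X::L_2)\,L_3\triangleq split\,L_1\,L_2\,L_3$; $split\,(X::L_1)\,L_2\,(X::L_3)\triangleq split\,L_1\,L_2\,L_3$; $permute\,nil\,nil\triangleq\top$; $permute\,(X::L_1)\,L_2\triangleq\exists l_{22}(split\,L_2\,(X::nil)\,l_{22}\land permute\,L_1\,l_{22})$. With $prog: atm\to prp\to o$ and $seq: nt\to atmlst\to prp\to o$ (first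 argument as subscript), $\mathcal{D}(intuit)$ is: $seq_I\,(A'::L)\,\langle A\rangle\triangleq element\,A\,(A'::L)$; $seq_I\,L\,tt\triangleq\top$; $seq_{(s I)}\,L\,(B\,\&\,C)\triangleq seq_I\,L\,B\land seq_I\,L\,C$; $seq_{(s I)}\,L\,(A\Rightarrow B)\triangleq seq_I\,(A::L)\,B$; $seq_{(s I)}\,L\,(\bigwedge B)\triangleq\forall x\,seq_I\,L\,(B\,x)$; $seq_{(s I)}\,L\,\langle A\rangle\triangleq\exists b(prog\,A\,b\land seq_I\,L\,b)$. $\vdash B$ abbreviates $\exists i(nat\,i\land seq_i\,nil\,B)$. Untyped $\lambda$-calculus: constants $abs:(i\to i)\to i$, $app: i\to i\to i$, $gnd: i$, $arr: i\to i\to i$, object predicates $typeof: i\to i\to atm$ and infix $\Downarrow,\leadsto,\leadsto^*: i\to i\to atm$. $\mathcal{D}(lambda)$ consists of the clauses $prog\,A\,G\triangleq\top$ for the following pairs $(A,G)$: $(typeof\,(abs\,R)\,(arr\,T\,U),\ \bigwedge n(typeof\,n\,T\Rightarrow\langle typeof\,(R\,n)\,U\rangle))$; $(typeof\,(app\,M\,N)\,T,\ \langle typeof\,M\,(arr\,U\,T)\rangle\,\&\,\langle typeof\,N\,U\rangle)$; $((abs\,R)\Downarrow(abs\,R),\ tt)$; $((app\,M\,N)\Downarrow V,\ \langle M\Downarrow(abs\,R)\rangle\,\&\,\langle(R\,N)\Downarrow V\rangle)$; $((app\,(abs\,R)\,M)\leadsto(R\,M),\ tt)$; $((app\,M\,N)\leadsto(app\,M'\,N),\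 \langle M\leadsto M'\rangle)$; $(M\leadsto^* M,\ tt)$; $(M\leadsto^* N,\ \langle M\leadsto M'\rangle\,\&\,\langle M'\leadsto^* N\rangle)$ (all variables universally quantified). *)

theory Defs
  imports "HOL-Library.Multiset"
begin

section \<open>Simply typed terms over the signature\<close>

datatype ty = To | Tnt | Ti | Tatm | Tprp | Tlst | Fun ty ty  (infixr "\<rightarrow>\<^sub>t" 65)

primrec o_free :: "ty \<Rightarrow> bool" where
  "o_free To = False"
| "o_free Tnt = True"
| "o_free Ti = True"
| "o_free Tatm = True"
| "o_free Tprp = True"
| "o_free Tlst = True"
| "o_free (T \<rightarrow>\<^sub>t U) = (o_free T \<and> o_free U)"

datatype pred =
    P_nat | P_eq | P_less | P_le | P_sum
  | P_length | P_list | P_element | P_split | P_permute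
  | P_prog | P_seq | P_equiv

datatype fsym =
    F_z | F_s
  | F_nil | F_cons
  | F_atom | F_tt | F_amp | F_imp | F_forall
  | F_abs | F_app | F_gnd | F_arr
  | F_typeof | F_eval | F_red | F_reds

datatype cst =
    C_bot | C_top | C_and | C_or | C_imp | C_all ty | C_ex ty
  | Pred pred | Fn fsym

primrec pred_type :: "pred \<Rightarrow> ty" where
  "pred_type P_nat = Tnt \<rightarrow>\<^sub>t To"
| "pred_type P_eq = Tnt \<rightarrow>\<^sub>t Tnt \<rightarrow>\<^sub>t To"
| "pred_type P_less = Tnt \<rightarrow>\<^sub>t Tnt \<rightarrow>\<^sub>t To"
| "pred_type P_le = Tnt \<rightarrow>\<^sub>t Tnt \<rightarrow>\<^sub>t To"
| "pred_type P_sum = Tnt \<rightarrow>\<^sub>t Tnt \<rightarrow>\<^sub>t Tnt \<rightarrow>\<^sub>t To"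
| "pred_type P_length = Tlst \<rightarrow>\<^sub>t Tnt \<rightarrow>\<^sub>t To"
| "pred_type P_list = Tlst \<rightarrow>\<^sub>t To"
| "pred_type P_element = Tatm \<rightarrow>\<^sub>t Tlst \<rightarrow>\<^sub>t To"
| "pred_type P_split = Tlst \<rightarrow>\<^sub>t Tlst \<rightarrow>\<^sub>t Tlst \<rightarrow>\<^sub>t To"
| "pred_type P_permute = Tlst \<rightarrow>\<^sub>t Tlst \<rightarrow>\<^sub>t To"
| "pred_type P_prog = Tatm \<rightarrow>\<^sub>t Tprp \<rightarrow>\<^sub>t To"
| "pred_type P_seq = Tnt \<rightarrow>\<^sub>t Tlst \<rightarrow>\<^sub>t Tprp \<rightarrow>\<^sub>t To"
| "pred_type P_equiv = Ti \<rightarrow>\<^sub>t Ti \<rightarrow>\<^sub>t To"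

primrec fsym_type :: "fsym \<Rightarrow> ty" where
  "fsym_type F_z = Tnt"
| "fsym_type F_s = Tnt \<rightarrow>\<^sub>t Tnt"
| "fsym_type F_nil = Tlst"
| "fsym_type F_cons = Tatm \<rightarrow>\<^sub>t Tlst \<rightarrow>\<^sub>t Tlst"
| "fsym_type F_atom = Tatm \<rightarrow>\<^sub>t Tprp"
| "fsym_type F_tt = Tprp"
| "fsym_type F_amp = Tprp \<rightarrow>\<^sub>t Tprp \<rightarrow>\<^sub>t Tprp"
| "fsym_type F_imp = Tatm \<rightarrow>\<^sub>t Tprp \<rightarrow>\<^sub>t Tprp"
| "fsym_type F_forall = (Ti \<rightarrow>\<^sub>t Tprp) \<rightarrow>\<^sub>t Tprp"
| "fsym_type F_abs = (Ti \<rightarrow>\<^sub>t Ti) \<rightarrow>\<^sub>t Ti"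
| "fsym_type F_app = Ti \<rightarrow>\<^sub>t Ti \<rightarrow>\<^sub>t Ti"
| "fsym_type F_gnd = Ti"
| "fsym_type F_arr = Ti \<rightarrow>\<^sub>t Ti \<rightarrow>\<^sub>t Ti"
| "fsym_type F_typeof = Ti \<rightarrow>\<^sub>t Ti \<rightarrow>\<^sub>t Tatm"
| "fsym_type F_eval = Ti \<rightarrow>\<^sub>t Ti \<rightarrow>\<^sub>t Tatm"
| "fsym_type F_red = Ti \<rightarrow>\<^sub>t Ti \<rightarrow>\<^sub>t Tatm"
| "fsym_type F_reds = Ti \<rightarrow>\<^sub>t Ti \<rightarrow>\<^sub>t Tatm"

primrec cst_type :: "cst \<Rightarrow> ty" where
  "cst_type C_bot = To"
| "cst_type C_top = To"
| "cst_type C_and = To \<rightarrow>\<^sub>t To \<rightarrow>\<^sub>t To"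
| "cst_type C_or = To \<rightarrow>\<^sub>t To \<rightarrow>\<^sub>t To"
| "cst_type C_imp = To \<rightarrow>\<^sub>t To \<rightarrow>\<^sub>t To"
| "cst_type (C_all T) = (T \<rightarrow>\<^sub>t To) \<rightarrow>\<^sub>t To"
| "cst_type (C_ex T) = (T \<rightarrow>\<^sub>t To) \<rightarrow>\<^sub>t To"
| "cst_type (Pred p) = pred_type p"
| "cst_type (Fn f) = fsym_type f"

primrec cst_ok :: "cst \<Rightarrow> bool" where
  "cst_ok C_bot = True"
| "cst_ok C_top = True"
| "cst_ok C_and = True"
| "cst_ok C_or = True"
| "cst_ok C_imp = True"
| "cst_ok (C_all T) = o_free T"
| "cst_ok (C_ex T) = o_free T"
| "cst_ok (Pred p) = True"
| "cst_ok (Fn f) = True"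

text \<open>
  Free variables are names tagged with their type; bound variables are de Bruijn indices, so that
  terms are identified up to \<open>\<alpha>\<close>-conversion.  Formulas are the terms of type \<open>To\<close>.
\<close>

type_synonym var = "nat \<times> ty"

datatype tm =
    Cst cst
  | Free var
  | Bnd nat
  | App tm tm  (infixl "\<cdot>" 100)
  | Lam tm

primrec fv :: "tm \<Rightarrow> var set" where
  "fv (Cst c) = {}"
| "fv (Free v) = {v}"
| "fv (Bnd i) = {}"
| "fv (t \<cdot> u) = fv t \<union> fv u"
| "fv (Lam t) = fv t"

primrec lift :: "tm \<Rightarrow> nat \<Rightarrow> tm" where
  "lift (Cst c) k = Cst c"
| "lift (Free v) k = Free v"
| "lift (Bnd i) k = (if i < k then Bnd i else Bnd (Suc i))"
| "lift (t \<cdot> u) k = lift t k \<cdot> lift u k"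
| "lift (Lam t) k = Lam (lift t (Suc k))"

primrec inst :: "tm \<Rightarrow> nat \<Rightarrow> tm \<Rightarrow> tm" where
  "inst (Cst c) k s = Cst c"
| "inst (Free v) k s = Free v"
| "inst (Bnd i) k s = (if i < k then Bnd i else if i = k then s else Bnd (i - 1))"
| "inst (t \<cdot> u) k s = inst t k s \<cdot> inst u k s"
| "inst (Lam t) k s = Lam (inst t (Suc k) (lift s 0))"

primrec bind :: "var \<Rightarrow> nat \<Rightarrow> tm \<Rightarrow> tm" where
  "bind v k (Cst c) = Cst c"
| "bind v k (Free w) = (if w = v then Bnd k else Free w)"
| "bind v k (Bnd i) = (if i < k then Bnd i else Bnd (Suc i))"
| "bind v k (t \<cdot> u) = bind v k t \<cdot> bind v k u"
| "bind v k (Lam t) = Lam (bind v (Suc k) t)"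

definition lam :: "var \<Rightarrow> tm \<Rightarrow> tm" where
  "lam v t = Lam (bind v 0 t)"

inductive has_type :: "ty list \<Rightarrow> tm \<Rightarrow> ty \<Rightarrow> bool" where
  ht_cst: "cst_ok c \<Longrightarrow> has_type \<Delta> (Cst c) (cst_type c)"
| ht_free: "o_free T \<Longrightarrow> has_type \<Delta> (Free (x, T)) T"
| ht_bnd: "i < length \<Delta> \<Longrightarrow> has_type \<Delta> (Bnd i) (\<Delta> ! i)"
| ht_app: "has_type \<Delta> t (T \<rightarrow>\<^sub>t U) \<Longrightarrow> has_type \<Delta> u T \<Longrightarrow> has_type \<Delta> (t \<cdot> u) U"
| ht_lam: "has_type (T # \<Delta>) t U \<Longrightarrow> has_type \<Delta> (Lam t) (T \<rightarrow>\<^sub>t U)"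

inductive conv :: "tm \<Rightarrow> tm \<Rightarrow> bool"  (infix "\<approx>" 50) where
  conv_beta: "Lam t \<cdot> u \<approx> inst t 0 u"
| conv_eta: "Lam (lift t 0 \<cdot> Bnd 0) \<approx> t"
| conv_app: "t \<approx> t' \<Longrightarrow> u \<approx> u' \<Longrightarrow> t \<cdot> u \<approx> t' \<cdot> u'"
| conv_lam: "t \<approx> t' \<Longrightarrow> Lam t \<approx> Lam t'"
| conv_refl: "t \<approx> t"
| conv_sym: "t \<approx> u \<Longrightarrow> u \<approx> t"
| conv_trans: "t \<approx> u \<Longrightarrow> u \<approx> w \<Longrightarrow> t \<approx> w"

type_synonym subst = "var \<Rightarrow> tm"

text \<open>
  The terms substituted for variables have no loose bound variables (see \<open>is_subst\<close>), so they
  need not be lifted below \<open>Lam\<close>.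
\<close>

primrec subst :: "subst \<Rightarrow> tm \<Rightarrow> tm" where
  "subst \<theta> (Cst c) = Cst c"
| "subst \<theta> (Free v) = \<theta> v"
| "subst \<theta> (Bnd i) = Bnd i"
| "subst \<theta> (t \<cdot> u) = subst \<theta> t \<cdot> subst \<theta> u"
| "subst \<theta> (Lam t) = Lam (subst \<theta> t)"

definition is_subst :: "subst \<Rightarrow> bool" where
  "is_subst \<theta> \<longleftrightarrow> (\<forall>x T. o_free T \<longrightarrow> has_type [] (\<theta> (x, T)) T)"

definition unifier :: "subst \<Rightarrow> tm \<Rightarrow> tm \<Rightarrow> bool" where
  "unifier \<theta> t u \<longleftrightarrow> is_subst \<theta> \<and> subst \<theta> t \<approx> subst \<theta> u"

text \<open>
  A set \<open>S\<close> of unifiers is complete if each unifier is an instance of some member of \<open>S\<close>, as far as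
  the variables in \<open>V\<close> are concerned.  Members of \<open>S\<close> may thus introduce variables, but only ones
  that are fresh for \<open>V\<close>, which must contain all the variables the members are applied to.
\<close>

definition complete_unifiers :: "var set \<Rightarrow> tm \<Rightarrow> tm \<Rightarrow> subst set \<Rightarrow> bool" where
  "complete_unifiers V t u S \<longleftrightarrow>
     (\<forall>\<theta>\<in>S. unifier \<theta> t u) \<and>
     (\<forall>\<sigma>. unifier \<sigma> t u \<longrightarrow>
        (\<exists>\<theta>\<in>S. \<exists>\<rho>. is_subst \<rho> \<and> (\<forall>v\<in>V. \<sigma> v \<approx> subst \<rho> (\<theta> v))))"

definition is_renaming :: "(var \<Rightarrow> var) \<Rightarrow> bool" where
  "is_renaming \<pi> \<longleftrightarrow> inj \<pi> \<and> (\<forall>v. snd (\<pi> v) = snd v)"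

definition rename :: "(var \<Rightarrow> var) \<Rightarrow> tm \<Rightarrow> tm" where
  "rename \<pi> t = subst (\<lambda>v. Free (\<pi> v)) t"


section \<open>Formulas\<close>

abbreviation bot_fm :: tm  ("\<^bold>\<bottom>") where "\<^bold>\<bottom> \<equiv> Cst C_bot"
abbreviation top_fm :: tm  ("\<^bold>\<top>") where "\<^bold>\<top> \<equiv> Cst C_top"
abbreviation and_fm :: "tm \<Rightarrow> tm \<Rightarrow> tm"  (infixr "\<^bold>\<and>" 64) where "A \<^bold>\<and> B \<equiv> Cst C_and \<cdot> A \<cdot> B"
abbreviation or_fm :: "tm \<Rightarrow> tm \<Rightarrow> tm"  (infixr "\<^bold>\<or>" 63) where "A \<^bold>\<or> B \<equiv> Cst C_or \<cdot> A \<cdot> B"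
abbreviation imp_fm :: "tm \<Rightarrow> tm \<Rightarrow> tm"  (infixr "\<^bold>\<supset>" 62) where "A \<^bold>\<supset> B \<equiv> Cst C_imp \<cdot> A \<cdot> B"

definition all_fm :: "var \<Rightarrow> tm \<Rightarrow> tm" where
  "all_fm v B = Cst (C_all (snd v)) \<cdot> lam v B"

definition ex_fm :: "var \<Rightarrow> tm \<Rightarrow> tm" where
  "ex_fm v B = Cst (C_ex (snd v)) \<cdot> lam v B"

definition patom :: "pred \<Rightarrow> tm list \<Rightarrow> tm" where
  "patom p us = foldl (\<cdot>) (Cst (Pred p)) us"

abbreviation zero_tm :: tm where "zero_tm \<equiv> Cst (Fn F_z)"
abbreviation suc_tm :: "tm \<Rightarrow> tm" where "suc_tm t \<equiv> Cst (Fn F_s) \<cdot> t"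
abbreviation nat_fm :: "tm \<Rightarrow> tm" where "nat_fm t \<equiv> patom P_nat [t]"


section \<open>The sequent calculus\<close>

text \<open>A clause \<open>(p, ts, B)\<close> is implicitly closed over its free variables.\<close>

type_synonym clause = "pred \<times> tm list \<times> tm"

definition fvs :: "tm multiset \<Rightarrow> var set" where
  "fvs \<Gamma> = (\<Union>B\<in>set_mset \<Gamma>. fv B)"

definition wf_seq :: "tm multiset \<Rightarrow> tm \<Rightarrow> bool" where
  "wf_seq \<Gamma> C \<longleftrightarrow> (\<forall>B\<in>#\<Gamma>. has_type [] B To) \<and> has_type [] C To"

text \<open>
  The rule \<open>d_conv\<close> identifies formulas up to \<open>\<beta>\<eta>\<close>-conversion.  In \<open>d_defL\<close> each clause for \<open>p\<close>
  may be renamed apart and each complete set of unifiers be chosen freely; the predicate \<open>nat\<close> is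
  excluded, as it is not given by clauses.
\<close>

inductive derives :: "clause set \<Rightarrow> tm multiset \<Rightarrow> tm \<Rightarrow> bool" for D :: "clause set" where
  d_conv:
    "derives D \<Gamma> C \<Longrightarrow> rel_mset (\<approx>) \<Gamma> \<Gamma>' \<Longrightarrow> C \<approx> C' \<Longrightarrow> wf_seq \<Gamma>' C' \<Longrightarrow> derives D \<Gamma>' C'"
| d_init:
    "wf_seq \<Gamma> (patom p us) \<Longrightarrow> derives D (add_mset (patom p us) \<Gamma>) (patom p us)"
| d_cut:
    "derives D \<Delta> B \<Longrightarrow> derives D (add_mset B \<Gamma>) C \<Longrightarrow> derives D (\<Delta> + \<Gamma>) C"
| d_contract:
    "derives D (add_mset B (add_mset B \<Gamma>)) C \<Longrightarrow> derives D (add_mset B \<Gamma>) C"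
| d_botL:
    "wf_seq \<Gamma> C \<Longrightarrow> derives D (add_mset \<^bold>\<bottom> \<Gamma>) C"
| d_topR:
    "wf_seq \<Gamma> \<^bold>\<top> \<Longrightarrow> derives D \<Gamma> \<^bold>\<top>"
| d_andL1:
    "derives D (add_mset A \<Gamma>) C \<Longrightarrow> has_type [] B To \<Longrightarrow> derives D (add_mset (A \<^bold>\<and> B) \<Gamma>) C"
| d_andL2:
    "derives D (add_mset B \<Gamma>) C \<Longrightarrow> has_type [] A To \<Longrightarrow> derives D (add_mset (A \<^bold>\<and> B) \<Gamma>) C"
| d_andR:
    "derives D \<Gamma> A \<Longrightarrow> derives D \<Gamma> B \<Longrightarrow> derives D \<Gamma> (A \<^bold>\<and> B)"
| d_orL:
    "derives D (add_mset A \<Gamma>) C \<Longrightarrow> derives D (add_mset B \<Gamma>) C \<Longrightarrow>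
     derives D (add_mset (A \<^bold>\<or> B) \<Gamma>) C"
| d_orR1:
    "derives D \<Gamma> A \<Longrightarrow> has_type [] B To \<Longrightarrow> derives D \<Gamma> (A \<^bold>\<or> B)"
| d_orR2:
    "derives D \<Gamma> B \<Longrightarrow> has_type [] A To \<Longrightarrow> derives D \<Gamma> (A \<^bold>\<or> B)"
| d_impL:
    "derives D \<Gamma> A \<Longrightarrow> derives D (add_mset B \<Gamma>) C \<Longrightarrow> derives D (add_mset (A \<^bold>\<supset> B) \<Gamma>) C"
| d_impR:
    "derives D (add_mset A \<Gamma>) B \<Longrightarrow> derives D \<Gamma> (A \<^bold>\<supset> B)"
| d_allL:
    "derives D (add_mset (P \<cdot> t) \<Gamma>) C \<Longrightarrow> o_free T \<Longrightarrow> has_type [] P (T \<rightarrow>\<^sub>t To) \<Longrightarrow> has_type [] t T \<Longrightarrow>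
     derives D (add_mset (Cst (C_all T) \<cdot> P) \<Gamma>) C"
| d_allR:
    "derives D \<Gamma> (P \<cdot> Free (x, T)) \<Longrightarrow> o_free T \<Longrightarrow> has_type [] P (T \<rightarrow>\<^sub>t To) \<Longrightarrow>
     (x, T) \<notin> fvs \<Gamma> \<union> fv P \<Longrightarrow>
     derives D \<Gamma> (Cst (C_all T) \<cdot> P)"
| d_exL:
    "derives D (add_mset (P \<cdot> Free (x, T)) \<Gamma>) C \<Longrightarrow> o_free T \<Longrightarrow> has_type [] P (T \<rightarrow>\<^sub>t To) \<Longrightarrow>
     (x, T) \<notin> fvs \<Gamma> \<union> fv P \<union> fv C \<Longrightarrow>
     derives D (add_mset (Cst (C_ex T) \<cdot> P) \<Gamma>) C"
| d_exR:
    "derives D \<Gamma> (P \<cdot> t) \<Longrightarrow> o_free T \<Longrightarrow> has_type [] P (T \<rightarrow>\<^sub>t To) \<Longrightarrow> has_type [] t T \<Longrightarrow>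
     derives D \<Gamma> (Cst (C_ex T) \<cdot> P)"
| d_natR_z:
    "wf_seq \<Gamma> (nat_fm zero_tm) \<Longrightarrow> derives D \<Gamma> (nat_fm zero_tm)"
| d_natR_s:
    "derives D \<Gamma> (nat_fm t) \<Longrightarrow> derives D \<Gamma> (nat_fm (suc_tm t))"
| d_natL:
    "derives D {#} (B \<cdot> zero_tm) \<Longrightarrow>
     derives D {# B \<cdot> Free (j, Tnt) #} (B \<cdot> suc_tm (Free (j, Tnt))) \<Longrightarrow>
     derives D (add_mset (B \<cdot> t) \<Gamma>) C \<Longrightarrow>
     has_type [] B (Tnt \<rightarrow>\<^sub>t To) \<Longrightarrow> has_type [] t Tnt \<Longrightarrow> (j, Tnt) \<notin> fv B \<Longrightarrow>
     derives D (add_mset (nat_fm t) \<Gamma>) C"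
| d_defR:
    "derives D \<Gamma> (subst \<theta> B) \<Longrightarrow> (p, ts, B) \<in> D \<Longrightarrow> is_subst \<theta> \<Longrightarrow>
     patom p us \<approx> subst \<theta> (patom p ts) \<Longrightarrow> wf_seq \<Gamma> (patom p us) \<Longrightarrow>
     derives D \<Gamma> (patom p us)"
| d_defL:
    "(\<And>ts B. (p, ts, B) \<in> D \<Longrightarrow>
        \<exists>\<pi> S. is_renaming \<pi> \<and>
          fv (rename \<pi> (patom p ts)) \<inter> (fv (patom p us) \<union> fvs \<Gamma> \<union> fv C) = {} \<and>
          complete_unifiers
            (fv (rename \<pi> (patom p ts)) \<union> fv (patom p us) \<union> fvs \<Gamma> \<union> fv C)
            (patom p us) (rename \<pi> (patom p ts)) S \<and>
          (\<forall>\<theta>\<in>S. derives D (add_mset (subst \<theta> (rename \<pi> B)) (image_mset (subst \<theta>) \<Gamma>)) (subst \<theta> C))) \<Longrightarrow>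
     p \<noteq> P_nat \<Longrightarrow> wf_seq (add_mset (patom p us) \<Gamma>) C \<Longrightarrow>
     derives D (add_mset (patom p us) \<Gamma>) C"

definition derivable :: "clause set \<Rightarrow> tm \<Rightarrow> bool" where
  "derivable D B \<longleftrightarrow> derives D {#} B"

text \<open>
  \<open>level_le lvl B n\<close> says that the level of the formula \<open>B\<close> is at most \<open>n\<close>, where the level of an
  atom is that of its predicate, the level of \<open>A \<^bold>\<supset> B\<close> is the maximum of that of \<open>B\<close> and the
  successor of that of \<open>A\<close>, and the other connectives take the maximum.
\<close>

inductive level_le :: "(pred \<Rightarrow> nat) \<Rightarrow> tm \<Rightarrow> nat \<Rightarrow> bool" for lvl :: "pred \<Rightarrow> nat" where
  "lvl p \<le> n \<Longrightarrow> level_le lvl (patom p us) n"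
| "level_le lvl \<^bold>\<bottom> n"
| "level_le lvl \<^bold>\<top> n"
| "level_le lvl A n \<Longrightarrow> level_le lvl B n \<Longrightarrow> level_le lvl (A \<^bold>\<and> B) n"
| "level_le lvl A n \<Longrightarrow> level_le lvl B n \<Longrightarrow> level_le lvl (A \<^bold>\<or> B) n"
| "level_le lvl A n \<Longrightarrow> level_le lvl B (Suc n) \<Longrightarrow> level_le lvl (A \<^bold>\<supset> B) (Suc n)"
| "level_le lvl B n \<Longrightarrow> level_le lvl (Cst (C_all T) \<cdot> Lam B) n"
| "level_le lvl B n \<Longrightarrow> level_le lvl (Cst (C_ex T) \<cdot> Lam B) n"

definition is_definition :: "clause set \<Rightarrow> bool" where
  "is_definition D \<longleftrightarrow> (\<exists>lvl. \<forall>(p, ts, B)\<in>D.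
     p \<noteq> P_nat \<and> has_type [] (patom p ts) To \<and> has_type [] B To \<and>
     fv B \<subseteq> fv (patom p ts) \<and> level_le lvl B (lvl p))"


section \<open>The definitions of the object-level notions\<close>

abbreviation nil_tm :: tm where "nil_tm \<equiv> Cst (Fn F_nil)"
abbreviation cons_tm :: "tm \<Rightarrow> tm \<Rightarrow> tm"  (infixr "\<^bold>#" 95) where
  "X \<^bold># L \<equiv> Cst (Fn F_cons) \<cdot> X \<cdot> L"
abbreviation atom_tm :: "tm \<Rightarrow> tm"  ("\<^bold>\<langle>_\<^bold>\<rangle>") where "\<^bold>\<langle>A\<^bold>\<rangle> \<equiv> Cst (Fn F_atom) \<cdot> A"
abbreviation tt_tm :: tm where "tt_tm \<equiv> Cst (Fn F_tt)"
abbreviation amp_tm :: "tm \<Rightarrow> tm \<Rightarrow> tm"  (infixr "\<^bold>&" 91) where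
  "B \<^bold>& C \<equiv> Cst (Fn F_amp) \<cdot> B \<cdot> C"
abbreviation oimp_tm :: "tm \<Rightarrow> tm \<Rightarrow> tm"  (infixr "\<^bold>\<Rightarrow>" 90) where
  "A \<^bold>\<Rightarrow> B \<equiv> Cst (Fn F_imp) \<cdot> A \<cdot> B"
abbreviation oall_tm :: "tm \<Rightarrow> tm"  ("\<^bold>\<And>") where "\<^bold>\<And> B \<equiv> Cst (Fn F_forall) \<cdot> B"

abbreviation abs_tm :: "tm \<Rightarrow> tm" where "abs_tm R \<equiv> Cst (Fn F_abs) \<cdot> R"
abbreviation app_tm :: "tm \<Rightarrow> tm \<Rightarrow> tm" where "app_tm M N \<equiv> Cst (Fn F_app) \<cdot> M \<cdot> N"
abbreviation arr_tm :: "tm \<Rightarrow> tm \<Rightarrow> tm" where "arr_tm T U \<equiv> Cst (Fn F_arr) \<cdot> T \<cdot> U"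
abbreviation typeof_tm :: "tm \<Rightarrow> tm \<Rightarrow> tm" where "typeof_tm M T \<equiv> Cst (Fn F_typeof) \<cdot> M \<cdot> T"
abbreviation eval_tm :: "tm \<Rightarrow> tm \<Rightarrow> tm"  (infix "\<^bold>\<Down>" 96) where
  "M \<^bold>\<Down> V \<equiv> Cst (Fn F_eval) \<cdot> M \<cdot> V"
abbreviation red_tm :: "tm \<Rightarrow> tm \<Rightarrow> tm"  (infix "\<^bold>\<leadsto>" 96) where
  "M \<^bold>\<leadsto> N \<equiv> Cst (Fn F_red) \<cdot> M \<cdot> N"
abbreviation reds_tm :: "tm \<Rightarrow> tm \<Rightarrow> tm"  (infix "\<^bold>\<leadsto>\<^sup>*" 96) where
  "M \<^bold>\<leadsto>\<^sup>* N \<equiv> Cst (Fn F_reds) \<cdot> M \<cdot> N"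

abbreviation seq_fm :: "tm \<Rightarrow> tm \<Rightarrow> tm \<Rightarrow> tm" where "seq_fm I L B \<equiv> patom P_seq [I, L, B]"
abbreviation prog_fm :: "tm \<Rightarrow> tm \<Rightarrow> tm" where "prog_fm A B \<equiv> patom P_prog [A, B]"
abbreviation equiv_fm :: "tm \<Rightarrow> tm \<Rightarrow> tm"  (infix "\<^bold>\<equiv>" 65) where "X \<^bold>\<equiv> Y \<equiv> patom P_equiv [X, Y]"

definition provable :: "tm \<Rightarrow> tm"  ("\<^bold>\<turnstile> _" [66] 66) where
  "\<^bold>\<turnstile> B = Cst (C_ex Tnt) \<cdot> Lam (nat_fm (Bnd 0) \<^bold>\<and> seq_fm (Bnd 0) nil_tm (lift B 0))"

definition D_nat :: "clause set" where
  "D_nat = (let I = Free (0, Tnt); J = Free (1, Tnt); K = Free (2, Tnt) in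
    {(P_eq, [I, I], \<^bold>\<top>),
     (P_sum, [zero_tm, J, J], nat_fm J),
     (P_sum, [suc_tm I, J, suc_tm K], patom P_sum [I, J, K]),
     (P_less, [zero_tm, suc_tm J], nat_fm J),
     (P_less, [suc_tm I, suc_tm J], patom P_less [I, J]),
     (P_le, [I, I], \<^bold>\<top>),
     (P_le, [I, J], patom P_less [I, J])})"

definition D_list :: "clause set" where
  "D_list = (let i = (0, Tnt); I = Free (0, Tnt); X = Free (0, Tatm); Y = Free (1, Tatm);
      L = Free (0, Tlst); L1 = Free (1, Tlst); L2 = Free (2, Tlst); L3 = Free (3, Tlst);
      l22 = (4, Tlst) in
    {(P_length, [nil_tm, zero_tm], \<^bold>\<top>),
     (P_length, [X \<^bold># L, suc_tm I], patom P_length [L, I]),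
     (P_list, [L], ex_fm i (nat_fm (Free i) \<^bold>\<and> patom P_length [L, Free i])),
     (P_element, [X, X \<^bold># L], \<^bold>\<top>),
     (P_element, [X, Y \<^bold># L], patom P_element [X, L]),
     (P_split, [nil_tm, nil_tm, nil_tm], \<^bold>\<top>),
     (P_split, [X \<^bold># L1, X \<^bold># L2, L3], patom P_split [L1, L2, L3]),
     (P_split, [X \<^bold># L1, L2, X \<^bold># L3], patom P_split [L1, L2, L3]),
     (P_permute, [nil_tm, nil_tm], \<^bold>\<top>),
     (P_permute, [X \<^bold># L1, L2],
        ex_fm l22 (patom P_split [L2, X \<^bold># nil_tm, Free l22] \<^bold>\<and> patom P_permute [L1, Free l22]))})"

definition D_intuit :: "clause set" where
  "D_intuit = (let I = Free (0, Tnt); L = Free (0, Tlst); A = Free (0, Tatm); A' = Free (1, Tatm);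
      B = Free (0, Tprp); C = Free (1, Tprp); b = (2, Tprp); x = (0, Ti);
      F = Free (0, Ti \<rightarrow>\<^sub>t Tprp) in
    {(P_seq, [I, A' \<^bold># L, \<^bold>\<langle>A\<^bold>\<rangle>], patom P_element [A, A' \<^bold># L]),
     (P_seq, [I, L, tt_tm], \<^bold>\<top>),
     (P_seq, [suc_tm I, L, B \<^bold>& C], seq_fm I L B \<^bold>\<and> seq_fm I L C),
     (P_seq, [suc_tm I, L, A \<^bold>\<Rightarrow> B], seq_fm I (A \<^bold># L) B),
     (P_seq, [suc_tm I, L, \<^bold>\<And> F], all_fm x (seq_fm I L (F \<cdot> Free x))),
     (P_seq, [suc_tm I, L, \<^bold>\<langle>A\<^bold>\<rangle>], ex_fm b (prog_fm A (Free b) \<^bold>\<and> seq_fm I L (Free b)))})"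

definition D_lambda :: "clause set" where
  "D_lambda = (let M = Free (0, Ti); N = Free (1, Ti); M' = Free (2, Ti); T = Free (3, Ti);
      U = Free (4, Ti); V = Free (5, Ti); R = Free (0, Ti \<rightarrow>\<^sub>t Ti); n = (6, Ti) in
    (\<lambda>(A, G). (P_prog, [A, G], \<^bold>\<top>)) `
    {(typeof_tm (abs_tm R) (arr_tm T U),
        \<^bold>\<And> (lam n (typeof_tm (Free n) T \<^bold>\<Rightarrow> \<^bold>\<langle>typeof_tm (R \<cdot> Free n) U\<^bold>\<rangle>))),
     (typeof_tm (app_tm M N) T, \<^bold>\<langle>typeof_tm M (arr_tm U T)\<^bold>\<rangle> \<^bold>& \<^bold>\<langle>typeof_tm N U\<^bold>\<rangle>),
     (abs_tm R \<^bold>\<Down> abs_tm R, tt_tm),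
     (app_tm M N \<^bold>\<Down> V, \<^bold>\<langle>M \<^bold>\<Down> abs_tm R\<^bold>\<rangle> \<^bold>& \<^bold>\<langle>(R \<cdot> N) \<^bold>\<Down> V\<^bold>\<rangle>),
     (app_tm (abs_tm R) M \<^bold>\<leadsto> (R \<cdot> M), tt_tm),
     (app_tm M N \<^bold>\<leadsto> app_tm M' N, \<^bold>\<langle>M \<^bold>\<leadsto> M'\<^bold>\<rangle>),
     (M \<^bold>\<leadsto>\<^sup>* M, tt_tm),
     (M \<^bold>\<leadsto>\<^sup>* N, \<^bold>\<langle>M \<^bold>\<leadsto> M'\<^bold>\<rangle> \<^bold>& \<^bold>\<langle>M' \<^bold>\<leadsto>\<^sup>* N\<^bold>\<rangle>)})"

definition D_equiv :: "clause set" where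
  "D_equiv = {(P_equiv, [Free (0, Ti), Free (0, Ti)], \<^bold>\<top>)}"

definition D_all :: "clause set" where
  "D_all = D_nat \<union> D_list \<union> D_intuit \<union> D_lambda \<union> D_equiv"


section \<open>Well-formedness\<close>

inductive_simps has_type_simps:
  "has_type \<Delta> (Cst c) T"
  "has_type \<Delta> (Free v) T"
  "has_type \<Delta> (Bnd i) T"
  "has_type \<Delta> (t \<cdot> u) T"
  "has_type \<Delta> (Lam t) T"

lemma derives_wf_seq: "derives D \<Gamma> C \<Longrightarrow> wf_seq \<Gamma> C"
proof (induction rule: derives.induct)
  case (d_natR_s \<Gamma> t)
  then show ?case by (auto simp: wf_seq_def patom_def has_type_simps)
next
  case (d_natL B j t \<Gamma> C)
  then show ?case by (auto simp: wf_seq_def patom_def has_type_simps)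
qed (auto simp: wf_seq_def has_type_simps)

lemma is_definition_D_all: "is_definition D_all"
proof -
  note defs = D_all_def D_nat_def D_list_def D_intuit_def D_lambda_def D_equiv_def Let_def
  have bp: "bind v k (patom q us) = patom q (map (bind v k) us)" for v k q us
    by (induction us rule: rev_induct) (auto simp: patom_def)
  have "p \<noteq> P_nat \<and> has_type [] (patom p ts) To \<and> has_type [] B To \<and>
     fv B \<subseteq> fv (patom p ts) \<and> level_le (\<lambda>_. 0) B 0" if c: "(p, ts, B) \<in> D_all" for p ts B
  proof (intro conjI)
    show "p \<noteq> P_nat" using c by (auto simp: defs)
    show "has_type [] (patom p ts) To" using c
      by (auto simp: defs patom_def has_type_simps lam_def)
    show "has_type [] B To" using c
      by (auto simp: defs patom_def has_type_simps lam_def ex_fm_def all_fm_def)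
    show "fv B \<subseteq> fv (patom p ts)" using c
      by (auto simp: defs patom_def lam_def ex_fm_def all_fm_def)
    show "level_le (\<lambda>_. 0) B 0" using c
      by (auto simp: defs lam_def ex_fm_def all_fm_def bp intro!: level_le.intros)
  qed
  then show ?thesis unfolding is_definition_def by (intro exI[of _ "\<lambda>_. 0"]) blast
qed

end

theory Submission
  imports Defs
begin

text \<open>
  Derivations are never written down rule by rule.  \<open>S ||- C\<close> says that \<open>C\<close> is derivable from some of
  the hypotheses in \<open>S\<close>; it satisfies Kripke-style clauses (for \<open>\<supset>\<close>: for every larger \<open>S'\<close>, and for
  quantifiers: for every typed term), so that object-level proofs become natural deduction in HOL
  over arbitrary typed terms, without eigenvariables.  Definition left rules are used with the set of
  all unifiers, and the Church-Rosser theorem for \<open>\<beta>\<eta>\<close>-conversion decomposes the unified terms.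

  The height index of \<open>seq\<close> is eliminated early.  A single simulation lemma for
  \<open>seq (s i)\<close> yields, by induction on \<open>nat\<close>, monotonicity in the height, weakening, and the
  admissibility of cut with a bound on the height that is uniform in the formula, as the case of \<open>\<And>\<close>
  requires.  Induction on the height then gives rule induction for \<open>\<Down>\<close>, \<open>\<leadsto>\<close> and \<open>\<leadsto>\<^sup>*\<close>, from which the
  theorem follows as on paper: subject reduction for a beta step is an instance of cut, determinacy
  of \<open>\<leadsto>\<^sup>*\<close> is reduced to that of \<open>\<Down>\<close> by the equivalence of the two, and so is subject reduction
  for \<open>\<Down>\<close> to that for \<open>\<leadsto>\<^sup>*\<close>.
\<close>

section \<open>Confluence of beta-eta-conversion\<close>

text \<open>The shape of the proof is dictated by two rules that forget their surroundings. The left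
  rule for a definition instantiates the conclusion by a unifier \<theta>, and facts known only in
  HOL about the old terms are not stable under \<theta>; the base and step premises of the induction
  rule for \<open>nat\<close> admit no side formulas. Whatever has to survive either rule is
  therefore encoded as an object formula: as an antecedent of the goal before a case analysis, or
  inside the induction formula, together with all parameters that vary. It is unfolded to a HOL
  statement again once the rule is passed.

  The height produced by cut amounts to the sum of the two given heights, but \<open>sum\<close> is
  only a relation, so the bound is characterised by its use: it dominates the height of the
  derivations cut in, and it suffices for the result. A height picked separately for each instance
  would be useless below \<open>\<And>\<close>, whose premise is one universal formula at a single
  height. The same bound also gives the two premises of \<open>&\<close> a common height, without
  any ordering on numbers.\<close>

lemma lift_lift: "i \<le> k \<Longrightarrow> lift (lift t i) (Suc k) = lift (lift t k) i"
  by (induction t arbitrary: i k) auto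

lemma inst_lift_le: "i \<le> j \<Longrightarrow> inst (lift t i) (Suc j) (lift s i) = lift (inst t j s) i"
  by (induction t arbitrary: i j s) (auto simp: lift_lift[of 0, symmetric])

lemma lift_inst: "j \<le> i \<Longrightarrow> lift (inst t j s) i = inst (lift t (Suc i)) j (lift s i)"
  by (induction t arbitrary: i j s) (auto simp: lift_lift)

lemma inst_lift [simp]: "inst (lift t k) k s = t"
  by (induction t arbitrary: k s) auto

lemma inst_inst: "i \<le> j \<Longrightarrow> inst (inst t (Suc j) (lift v i)) i (inst u j v) = inst (inst t i u) j v"
  by (induction t arbitrary: i j u v) (auto simp: lift_lift[symmetric] inst_lift_le[symmetric])

lemma size_lift [simp]: "size (lift t k) = size t"
  by (induction t arbitrary: k) auto

lemma lift_inject [simp]: "lift t k = lift u k \<longleftrightarrow> t = u"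
  by (metis inst_lift)

lemma inst_lift_Suc_Bnd [simp]: "inst (lift t (Suc k)) k (Bnd k) = t"
  by (induction t arbitrary: k) auto

text \<open>A term that avoids two indices is a double lift. This recognises an eta redex below a
  lift: if \<open>lift t k\<close> has the form of an eta redex, so has \<open>t\<close>.\<close>

lemma lift_Suc_eq_lift:
  "lift a (Suc k) = lift s j \<Longrightarrow> j \<le> k \<Longrightarrow> \<exists>a'. a = lift a' j \<and> s = lift a' k"
proof (induction a arbitrary: s j k)
  case (Cst c)
  then show ?case by (cases s) (auto split: if_splits intro!: exI[of _ "Cst c"])
next
  case (Free v)
  then show ?case by (cases s) (auto split: if_splits intro!: exI[of _ "Free v"])
next
  case (Bnd i)
  show ?case
    using Bnd by (cases s; intro exI[of _ "if i < j then Bnd i else Bnd (i - 1)"])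
      (auto split: if_splits)
next
  case (App a b)
  then obtain s1 s2 where s: "s = s1 \<cdot> s2" by (cases s) (auto split: if_splits)
  with App.prems have "lift a (Suc k) = lift s1 j" "lift b (Suc k) = lift s2 j" by auto
  with App.IH(1)[of k s1 j] App.IH(2)[of k s2 j] App.prems obtain a' b'
    where "a = lift a' j" "s1 = lift a' k" "b = lift b' j" "s2 = lift b' k" by blast
  with s show ?case by (intro exI[of _ "a' \<cdot> b'"]) auto
next
  case (Lam a)
  then obtain s1 where s: "s = Lam s1" by (cases s) (auto split: if_splits)
  with Lam.prems have "lift a (Suc (Suc k)) = lift s1 (Suc j)" "Suc j \<le> Suc k" by auto
  from Lam.IH[OF this] obtain a' where "a = lift a' (Suc j)" "s1 = lift a' (Suc k)" by blast
  with s show ?case by (intro exI[of _ "Lam a'"]) auto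
qed

section \<open>Parallel reduction and its diamond property\<close>

text \<open>Parallel reduction in the style of Tait and Martin-Loef, with eta added. The side
  condition of eta, that the bound variable does not occur, is the shape
  \<open>lift t 0\<close>.\<close>

inductive par :: "tm \<Rightarrow> tm \<Rightarrow> bool" where
  par_cst: "par (Cst c) (Cst c)"
| par_free: "par (Free v) (Free v)"
| par_bnd: "par (Bnd i) (Bnd i)"
| par_app: "par t t' \<Longrightarrow> par u u' \<Longrightarrow> par (t \<cdot> u) (t' \<cdot> u')"
| par_lam: "par t t' \<Longrightarrow> par (Lam t) (Lam t')"
| par_beta: "par t t' \<Longrightarrow> par u u' \<Longrightarrow> par (Lam t \<cdot> u) (inst t' 0 u')"
| par_eta: "par t t' \<Longrightarrow> par (Lam (lift t 0 \<cdot> Bnd 0)) t'"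

inductive_cases par_cstE: "par (Cst c) s"
inductive_cases par_freeE: "par (Free v) s"
inductive_cases par_bndE: "par (Bnd i) s"
inductive_cases par_appE [consumes 1, case_names 1 2]: "par (t \<cdot> u) s"
inductive_cases par_lamE [consumes 1, case_names 1 2]: "par (Lam t) s"

lemma par_refl: "par t t"
  by (induction t) (auto intro: par.intros)

lemma par_lift: "par t t' \<Longrightarrow> par (lift t k) (lift t' k)"
proof (induction arbitrary: k rule: par.induct)
  case (par_beta t t' u u')
  then show ?case by (auto simp: lift_inst intro: par.par_beta)
next
  case (par_eta t t')
  then show ?case using par.par_eta[of "lift t k"] by (simp add: lift_lift)
qed (auto intro: par.intros)

lemma par_inst: "par t t' \<Longrightarrow> par u u' \<Longrightarrow> par (inst t k u) (inst t' k u')"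
proof (induction arbitrary: k u u' rule: par.induct)
  case (par_lam t t')
  then show ?case using par_lam.IH[OF par_lift[OF par_lam.prems]] by (auto intro: par.par_lam)
next
  case (par_beta t t' v v')
  then show ?case
    using par.par_beta[OF par_beta.IH(1)[OF par_lift[OF par_beta.prems, of 0], of "Suc k"]
        par_beta.IH(2)[OF par_beta.prems, of k]]
    by (simp add: inst_inst)
next
  case (par_eta t t')
  then show ?case using par.par_eta[of "inst t k u"] by (simp add: inst_lift_le)
qed (auto intro: par.intros par_refl)

lemma par_lift_inv: "par (lift t k) s \<Longrightarrow> \<exists>t'. s = lift t' k \<and> par t t'"
proof (induction "size t" arbitrary: t k s rule: less_induct)
  case less
  show ?case
  proof (cases t)
    case (Cst c)
    then show ?thesis using less.prems by (auto elim!: par_cstE intro!: exI[of _ t] par_refl)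
  next
    case (Free v)
    then show ?thesis using less.prems by (auto elim!: par_freeE intro!: exI[of _ t] par_refl)
  next
    case (Bnd i)
    then show ?thesis using less.prems
      by (auto elim!: par_bndE split: if_splits intro!: exI[of _ t] par_refl)
  next
    case (App a u)
    from less.prems[unfolded App, simplified] show ?thesis
    proof (cases rule: par_appE)
      case (1 t' u')
      then obtain a2 u2 where "t' = lift a2 k" "par a a2" "u' = lift u2 k" "par u u2"
        using less.hyps[of a k t'] less.hyps[of u k u'] App by auto
      then show ?thesis using 1 App by (intro exI[of _ "a2 \<cdot> u2"]) (auto intro: par_app)
    next
      case (2 q q' u')
      then obtain a1 where a1: "a = Lam a1" "q = lift a1 (Suc k)"
        by (cases a) (auto split: if_splits)
      then obtain a2 u2 where "q' = lift a2 (Suc k)" "par a1 a2" "u' = lift u2 k" "par u u2"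
        using less.hyps[of a1 "Suc k" q'] less.hyps[of u k u'] 2 App by auto
      then show ?thesis using 2 App a1
        by (intro exI[of _ "inst a2 0 u2"]) (auto simp: lift_inst intro: par_beta)
    qed
  next
    case (Lam b)
    from less.prems[unfolded Lam, simplified] show ?thesis
    proof (cases rule: par_lamE)
      case (1 t')
      then obtain b2 where "t' = lift b2 (Suc k)" "par b b2"
        using less.hyps[of b "Suc k" t'] Lam by auto
      then show ?thesis using 1 Lam by (intro exI[of _ "Lam b2"]) (auto intro: par_lam)
    next
      case (2 q)
      then obtain b1 b2 where b: "b = b1 \<cdot> b2" "lift b1 (Suc k) = lift q 0" "lift b2 (Suc k) = Bnd 0"
        by (cases b) (auto split: if_splits)
      then have b2: "b2 = Bnd 0" by (cases b2) (auto split: if_splits)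
      from lift_Suc_eq_lift[OF b(2)] obtain a where a: "b1 = lift a 0" "q = lift a k" by auto
      with less.hyps[of a k s] 2 Lam b obtain a2 where "s = lift a2 k" "par a a2" by auto
      then show ?thesis using 2 Lam a b b2 by (intro exI[of _ a2]) (auto intro: par_eta)
    qed
  qed
qed

text \<open>The overlap of an eta step at the root with a step in the body. Its critical case is
  \<open>s = Lam r\<close>: contracting the body by beta merely renames the bound variable, so
  \<open>Lam t1\<close> is again a reduct of \<open>s\<close>.\<close>

lemma par_lam_eta_join:
  assumes IH: "\<And>a b. par s a \<Longrightarrow> par s b \<Longrightarrow> \<exists>w. par a w \<and> par b w"
    and l: "par (lift s 0 \<cdot> Bnd 0) t1" and e: "par s s'"
  shows "\<exists>w. par (Lam t1) w \<and> par s' w"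
  using l
proof (cases rule: par_appE)
  case (1 a b)
  then obtain s1 where "a = lift s1 0" "par s s1" "b = Bnd 0"
    using par_lift_inv[of s 0 a] by (auto elim: par_bndE)
  moreover from IH[OF this(2) e] obtain w where "par s1 w" "par s' w" by auto
  ultimately show ?thesis using 1 by (auto intro!: exI[of _ w] par_eta)
next
  case (2 q q' b)
  then obtain r where r: "s = Lam r" "q = lift r (Suc 0)" by (cases s) (auto split: if_splits)
  with 2 obtain r' where r': "q' = lift r' (Suc 0)" "par r r'" using par_lift_inv by blast
  have "t1 = r'" using 2 r' by (auto elim: par_bndE)
  moreover have "par s (Lam r')" using r r' by (auto intro: par_lam)
  ultimately show ?thesis using IH[OF _ e] by auto
qed

text \<open>The overlap of beta at the root with a step of the function part. In the critical case
  \<open>Lam q\<close> is contracted to \<open>f\<close> by eta; then \<open>q\<close> also reduces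
  to \<open>lift f 0\<close> applied to \<open>Bnd 0\<close>, and a join of that with
  \<open>q'\<close>, once instantiated, is a join here.\<close>

lemma par_app_beta_join:
  assumes IH: "\<And>a b. par q a \<Longrightarrow> par q b \<Longrightarrow> \<exists>w. par a w \<and> par b w"
    and IHu: "\<And>a b. par u a \<Longrightarrow> par u b \<Longrightarrow> \<exists>w. par a w \<and> par b w"
    and a: "par (Lam q) f" "par u u1" and b: "par q q'" "par u u2"
  shows "\<exists>w. par (f \<cdot> u1) w \<and> par (inst q' 0 u2) w"
proof -
  from IHu[OF a(2) b(2)] obtain u3 where u3: "par u1 u3" "par u2 u3" by auto
  from a(1) show ?thesis
  proof (cases rule: par_lamE)
    case (1 q1)
    from IH[OF 1(2) b(1)] obtain w where "par q1 w" "par q' w" by auto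
    then show ?thesis using 1 u3 by (auto intro!: exI[of _ "inst w 0 u3"] par_beta par_inst)
  next
    case (2 s)
    have "par q (lift f 0 \<cdot> Bnd 0)" using 2 by (auto intro: par_app par_lift par_refl)
    from IH[OF this b(1)] obtain w where w: "par (lift f 0 \<cdot> Bnd 0) w" "par q' w" by auto
    from par_inst[OF w(1) u3(1), of 0] have "par (f \<cdot> u1) (inst w 0 u3)" by simp
    then show ?thesis using w u3 by (auto intro: par_inst)
  qed
qed

text \<open>Induction on size, since redexes expose subterms below the immediate ones; the two
  genuine overlaps of beta and eta are the preceding two lemmas.\<close>

lemma par_diamond: "par t t1 \<Longrightarrow> par t t2 \<Longrightarrow> \<exists>w. par t1 w \<and> par t2 w"
proof (induction "size t" arbitrary: t t1 t2 rule: less_induct)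
  case less
  note IH = less.hyps
  show ?case
  proof (cases t)
    case (Cst c)
    then show ?thesis using less.prems by (auto elim!: par_cstE intro: par_refl)
  next
    case (Free v)
    then show ?thesis using less.prems by (auto elim!: par_freeE intro: par_refl)
  next
    case (Bnd i)
    then show ?thesis using less.prems by (auto elim!: par_bndE intro: par_refl)
  next
    case (App a u)
    have IHa: "par a x \<Longrightarrow> par a y \<Longrightarrow> \<exists>w. par x w \<and> par y w" for x y
      using IH[of a x y] App by simp
    have IHu: "par u x \<Longrightarrow> par u y \<Longrightarrow> \<exists>w. par x w \<and> par y w" for x y
      using IH[of u x y] App by simp
    from less.prems(1)[unfolded App] show ?thesis
    proof (cases rule: par_appE)
      case (1 t' u')
      note c1 = 1
      from less.prems(2)[unfolded App] show ?thesis
      proof (cases rule: par_appE)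
        case (1 a2 u2)
        with c1 IHa[of t' a2] IHu[of u' u2] obtain w v
          where "par t' w" "par a2 w" "par u' v" "par u2 v" by blast
        then show ?thesis using c1 1 by (auto intro: par_app)
      next
        case (2 q q' u2)
        have "par q x \<Longrightarrow> par q y \<Longrightarrow> \<exists>w. par x w \<and> par y w" for x y
          using IH[of q x y] App 2 by simp
        from par_app_beta_join[OF this IHu] show ?thesis using c1 2 by blast
      qed
    next
      case (2 q q' u2)
      note c1 = 2
      have IHq: "par q x \<Longrightarrow> par q y \<Longrightarrow> \<exists>w. par x w \<and> par y w" for x y
        using IH[of q x y] App 2 by simp
      from less.prems(2)[unfolded App] show ?thesis
      proof (cases rule: par_appE)
        case (1 a3 u3)
        with par_app_beta_join[OF IHq IHu] show ?thesis using c1 by blast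
      next
        case (2 p p' u3)
        then have "par q p'" using c1 by simp
        with c1 2 IHq[of q' p'] IHu[of u2 u3] obtain w v
          where "par q' w" "par p' w" "par u2 v" "par u3 v" by blast
        then show ?thesis using c1 2 by (auto intro: par_inst)
      qed
    qed
  next
    case (Lam b)
    from less.prems(1)[unfolded Lam] show ?thesis
    proof (cases rule: par_lamE)
      case (1 b1)
      note c1 = 1
      from less.prems(2)[unfolded Lam] show ?thesis
      proof (cases rule: par_lamE)
        case (1 b2)
        with c1 IH[of b b1 b2] Lam obtain w where "par b1 w" "par b2 w" by auto
        then show ?thesis using c1 1 by (auto intro: par_lam)
      next
        case (2 s)
        have "par s x \<Longrightarrow> par s y \<Longrightarrow> \<exists>w. par x w \<and> par y w" for x y
          using IH[of s x y] Lam 2 by simp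
        from par_lam_eta_join[OF this] show ?thesis using c1 2 by blast
      qed
    next
      case (2 s)
      note c1 = 2
      have IHs: "par s x \<Longrightarrow> par s y \<Longrightarrow> \<exists>w. par x w \<and> par y w" for x y
        using IH[of s x y] Lam 2 by simp
      from less.prems(2)[unfolded Lam] show ?thesis
      proof (cases rule: par_lamE)
        case (1 b2)
        with par_lam_eta_join[OF IHs] show ?thesis using c1 by blast
      next
        case (2 s2)
        then show ?thesis using c1 IHs by auto
      qed
    qed
  qed
qed

lemma par_strip: "par\<^sup>*\<^sup>* t t1 \<Longrightarrow> par t t2 \<Longrightarrow> \<exists>w. par t1 w \<and> par\<^sup>*\<^sup>* t2 w"
proof (induction rule: rtranclp_induct)
  case (step y z)
  then obtain w where "par y w" "par\<^sup>*\<^sup>* t2 w" by auto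
  moreover from par_diamond[OF step.hyps(2) this(1)] obtain v where "par z v" "par w v" by auto
  ultimately show ?case by (meson rtranclp.rtrancl_into_rtrancl)
qed auto

lemma par_confluent: "par\<^sup>*\<^sup>* t t1 \<Longrightarrow> par\<^sup>*\<^sup>* t t2 \<Longrightarrow> \<exists>w. par\<^sup>*\<^sup>* t1 w \<and> par\<^sup>*\<^sup>* t2 w"
proof (induction arbitrary: t2 rule: converse_rtranclp_induct)
  case (step y z)
  from par_strip[OF step.prems step.hyps(1)] obtain w where "par t2 w" "par\<^sup>*\<^sup>* z w" by auto
  with step.IH[OF this(2)] show ?case by (meson converse_rtranclp_into_rtranclp)
qed auto

lemma pars_app: "par\<^sup>*\<^sup>* t t' \<Longrightarrow> par\<^sup>*\<^sup>* u u' \<Longrightarrow> par\<^sup>*\<^sup>* (t \<cdot> u) (t' \<cdot> u')"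
proof (induction rule: rtranclp_induct)
  case base
  then show ?case
    by (induction rule: rtranclp_induct) (auto intro: rtranclp.rtrancl_into_rtrancl par_app par_refl)
next
  case (step y z)
  then show ?case by (meson par_app par_refl rtranclp.rtrancl_into_rtrancl)
qed

lemma pars_lam: "par\<^sup>*\<^sup>* t t' \<Longrightarrow> par\<^sup>*\<^sup>* (Lam t) (Lam t')"
  by (induction rule: rtranclp_induct) (auto intro: rtranclp.rtrancl_into_rtrancl par_lam)

theorem Church_Rosser: "t \<approx> u \<Longrightarrow> \<exists>w. par\<^sup>*\<^sup>* t w \<and> par\<^sup>*\<^sup>* u w"
proof (induction rule: conv.induct)
  case (conv_beta t u)
  have "par (Lam t \<cdot> u) (inst t 0 u)" by (auto intro: par_beta par_refl)
  then show ?case by blast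
next
  case (conv_eta t)
  have "par (Lam (lift t 0 \<cdot> Bnd 0)) t" by (auto intro: par_eta par_refl)
  then show ?case by blast
next
  case (conv_app t t' u u')
  then show ?case by (meson pars_app)
next
  case (conv_lam t t')
  then show ?case by (meson pars_lam)
next
  case (conv_trans t u w)
  then obtain a b where "par\<^sup>*\<^sup>* t a" "par\<^sup>*\<^sup>* u a" "par\<^sup>*\<^sup>* u b" "par\<^sup>*\<^sup>* w b" by auto
  with par_confluent[of u a b] show ?case by (meson rtranclp_trans)
qed auto

section \<open>Rigid terms: injectivity and disjointness up to conversion\<close>

text \<open>An application whose head is a constant is not a redex at the root and never becomes
  one, so reduction acts on its arguments only. Abstractions get \<open>None\<close>, being subject
  to beta and eta.\<close>

primrec head :: "tm \<Rightarrow> cst option" where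
  "head (Cst c) = Some c"
| "head (Free v) = None"
| "head (Bnd i) = None"
| "head (t \<cdot> u) = head t"
| "head (Lam t) = None"

lemma par_head: "par t s \<Longrightarrow> head t = Some c \<Longrightarrow> head s = Some c"
  by (induction rule: par.induct) auto

lemma pars_cst: "par\<^sup>*\<^sup>* (Cst c) s \<Longrightarrow> s = Cst c"
  by (induction rule: rtranclp_induct) (auto elim: par_cstE)

lemma pars_rigid_app:
  "par\<^sup>*\<^sup>* (t \<cdot> u) s \<Longrightarrow> head t = Some c \<Longrightarrow>
    \<exists>t' u'. s = t' \<cdot> u' \<and> head t' = Some c \<and> par\<^sup>*\<^sup>* t t' \<and> par\<^sup>*\<^sup>* u u'"
proof (induction rule: rtranclp_induct)
  case (step y z)
  then obtain t' u' where y: "y = t' \<cdot> u'" "head t' = Some c" "par\<^sup>*\<^sup>* t t'" "par\<^sup>*\<^sup>* u u'" by auto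
  from step.hyps(2)[unfolded y] show ?case
    by (cases rule: par_appE) (use y par_head in \<open>auto intro: rtranclp.rtrancl_into_rtrancl\<close>)
qed auto

lemma par_conv: "par t u \<Longrightarrow> t \<approx> u"
proof (induction rule: par.induct)
  case (par_beta t t' u u')
  then have "Lam t \<cdot> u \<approx> Lam t' \<cdot> u'" by (intro conv_app conv_lam)
  then show ?case using conv_beta conv_trans by blast
next
  case (par_eta t t')
  then show ?case using conv_eta conv_trans by blast
qed (auto intro: conv_refl conv_app conv_lam)

lemma pars_conv: "par\<^sup>*\<^sup>* t u \<Longrightarrow> t \<approx> u"
  by (induction rule: rtranclp_induct) (auto intro: conv_refl conv_trans par_conv)

lemma conv_cst_cst [simp]: "Cst c \<approx> Cst d \<longleftrightarrow> c = d"
  using Church_Rosser pars_cst by (metis conv_refl tm.inject(1))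

lemma conv_cst_app [simp]: "head t = Some d \<Longrightarrow> \<not> Cst c \<approx> t \<cdot> u"
  using Church_Rosser pars_cst pars_rigid_app by (metis tm.distinct(5))

lemma conv_app_cst [simp]: "head t = Some d \<Longrightarrow> \<not> t \<cdot> u \<approx> Cst c"
  using conv_cst_app conv_sym by blast

text \<open>With rigid heads on both sides a common reduct splits into reducts of function and
  argument. The heads may differ: iterating the rule down to \<open>conv_cst_cst\<close> then
  refutes the equation, so these simp rules perform the first-order part of unification.\<close>

lemma conv_app_app [simp]:
  assumes "head t = Some c" "head t' = Some d"
  shows "t \<cdot> u \<approx> t' \<cdot> u' \<longleftrightarrow> t \<approx> t' \<and> u \<approx> u'"
proof
  assume "t \<cdot> u \<approx> t' \<cdot> u'"
  then obtain w where w: "par\<^sup>*\<^sup>* (t \<cdot> u) w" "par\<^sup>*\<^sup>* (t' \<cdot> u') w" using Church_Rosser by blast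
  from pars_rigid_app[OF w(1) assms(1)] pars_rigid_app[OF w(2) assms(2)]
  show "t \<approx> t' \<and> u \<approx> u'" by (metis conv_sym conv_trans pars_conv tm.inject(4))
qed (auto intro: conv_app)

section \<open>Entailment from sets of hypotheses\<close>

lemma has_type_append: "has_type \<Delta> t T \<Longrightarrow> has_type (\<Delta> @ \<Delta>') t T"
proof (induction rule: has_type.induct)
  case (ht_bnd i \<Delta>)
  then show ?case using has_type.ht_bnd[of i "\<Delta> @ \<Delta>'"] by (simp add: nth_append)
qed (auto intro: has_type.intros)

abbreviation typed :: "tm \<Rightarrow> ty \<Rightarrow> bool" where "typed \<equiv> has_type []"

lemma has_type_weaken: "typed t T \<Longrightarrow> has_type \<Delta> t T"
  using has_type_append[of "[]"] by simp

lemma lift_typed: "has_type \<Delta> t T \<Longrightarrow> length \<Delta> \<le> k \<Longrightarrow> lift t k = t"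
  by (induction arbitrary: k rule: has_type.induct) auto

lemma inst_typed: "has_type \<Delta> t T \<Longrightarrow> length \<Delta> \<le> k \<Longrightarrow> inst t k s = t"
  by (induction arbitrary: k s rule: has_type.induct) auto

lemma has_type_subst:
  assumes "is_subst \<theta>"
  shows "has_type \<Delta> t T \<Longrightarrow> has_type \<Delta> (subst \<theta> t) T"
proof (induction rule: has_type.induct)
  case (ht_free T \<Delta> x)
  then show ?case using assms has_type_weaken by (auto simp: is_subst_def)
qed (auto intro: has_type.intros)

lemma has_type_inst:
  assumes "typed s T"
  shows "has_type \<Sigma> t U \<Longrightarrow> \<Sigma> = \<Delta> @ T # \<Delta>' \<Longrightarrow> has_type (\<Delta> @ \<Delta>') (inst t (length \<Delta>) s) U"
proof (induction arbitrary: \<Delta> rule: has_type.induct)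
  case (ht_bnd i \<Sigma>)
  then show ?case
    using has_type_weaken[OF assms]
    by (auto simp: nth_append has_type_simps not_less split: if_splits)
next
  case (ht_lam V \<Sigma> t U)
  from ht_lam.IH[of "V # \<Delta>"] ht_lam.prems show ?case
    using lift_typed[OF assms] by (auto intro: has_type.ht_lam)
qed (auto intro: has_type.intros)

lemma has_type_inst0: "has_type (T # \<Delta>) b U \<Longrightarrow> typed s T \<Longrightarrow> has_type \<Delta> (inst b 0 s) U"
  using has_type_inst[of s T _ b U "[]" \<Delta>] by simp

lemma subst_Free [simp]: "subst Free t = t"
  by (induction t) auto

lemma subst_rename: "subst \<theta> (rename \<pi> t) = subst (\<lambda>v. \<theta> (\<pi> v)) t"
  unfolding rename_def by (induction t) auto

lemma is_subst_Free [simp]: "is_subst Free"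
  by (simp add: is_subst_def has_type_simps)

lemma is_subst_upd [simp]: "is_subst \<theta> \<Longrightarrow> typed t T \<Longrightarrow> is_subst (\<theta>((x, T) := t))"
  by (simp add: is_subst_def)

lemma finite_fv [simp]: "finite (fv t)"
  by (induction t) auto

lemma subst_closed: "fv t = {} \<Longrightarrow> subst \<theta> t = t"
  by (induction t) auto

lemma finite_fvs [simp]: "finite (fvs \<Gamma>)"
  by (simp add: fvs_def)

lemma ex_fresh: "finite V \<Longrightarrow> \<exists>x. (x, T) \<notin> (V :: var set)"
proof -
  assume "finite V"
  then have "finite (fst ` V)" by simp
  then obtain x where "x \<notin> fst ` V" using ex_new_if_finite infinite_UNIV_nat by blast
  then show ?thesis by force
qed

lemma head_patom [simp]: "head (patom p us) = Some (Pred p)"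
  by (induction us rule: rev_induct) (auto simp: patom_def)

lemma subst_patom [simp]: "subst \<theta> (patom p us) = patom p (map (subst \<theta>) us)"
  by (induction us rule: rev_induct) (auto simp: patom_def)

lemma inst_patom [simp]: "inst (patom p us) k s = patom p (map (\<lambda>u. inst u k s) us)"
  by (induction us rule: rev_induct) (auto simp: patom_def)

lemma bind_patom [simp]: "bind v k (patom p us) = patom p (map (bind v k) us)"
  by (induction us rule: rev_induct) (auto simp: patom_def)

lemma fv_patom [simp]: "fv (patom p us) = (\<Union>u\<in>set us. fv u)"
  by (induction us rule: rev_induct) (auto simp: patom_def)

lemma patom_conv: "list_all2 (\<approx>) us vs \<Longrightarrow> patom p us \<approx> patom p vs"
proof (induction us arbitrary: vs rule: rev_induct)
  case (snoc u us)
  then show ?case by (auto simp: patom_def list_all2_append1 list_all2_Cons1 intro!: conv_app)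
qed (auto simp: conv_refl)

lemma has_type_patom [simp]:
  "has_type \<Delta> (patom P_nat [t]) To \<longleftrightarrow> has_type \<Delta> t Tnt"
  "has_type \<Delta> (patom P_eq [i, j]) To \<longleftrightarrow> has_type \<Delta> i Tnt \<and> has_type \<Delta> j Tnt"
  "has_type \<Delta> (patom P_element [x, l]) To \<longleftrightarrow> has_type \<Delta> x Tatm \<and> has_type \<Delta> l Tlst"
  "has_type \<Delta> (patom P_prog [x, b]) To \<longleftrightarrow> has_type \<Delta> x Tatm \<and> has_type \<Delta> b Tprp"
  "has_type \<Delta> (patom P_seq [i, l, b]) To \<longleftrightarrow>
    has_type \<Delta> i Tnt \<and> has_type \<Delta> l Tlst \<and> has_type \<Delta> b Tprp"
  "has_type \<Delta> (patom P_equiv [m, n]) To \<longleftrightarrow> has_type \<Delta> m Ti \<and> has_type \<Delta> n Ti"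
  by (auto simp: patom_def has_type_simps)

text \<open>
  The initial rule covers atoms only.  \<open>fm\<close> collects formulas for which its general form follows by
  induction; the quantifier rules have one premise per instance, so that no measure invariant under
  instantiation is needed.
\<close>

inductive fm :: "tm \<Rightarrow> bool" where
  fm_atom: "typed (patom p us) To \<Longrightarrow> fm (patom p us)"
| fm_bot: "fm \<^bold>\<bottom>"
| fm_top: "fm \<^bold>\<top>"
| fm_and: "fm A \<Longrightarrow> fm B \<Longrightarrow> fm (A \<^bold>\<and> B)"
| fm_or: "fm A \<Longrightarrow> fm B \<Longrightarrow> fm (A \<^bold>\<or> B)"
| fm_imp: "fm A \<Longrightarrow> fm B \<Longrightarrow> fm (A \<^bold>\<supset> B)"
| fm_all: "o_free T \<Longrightarrow> has_type [T] b To \<Longrightarrow> (\<And>t. typed t T \<Longrightarrow> fm (inst b 0 t)) \<Longrightarrow>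
    fm (Cst (C_all T) \<cdot> Lam b)"
| fm_ex: "o_free T \<Longrightarrow> has_type [T] b To \<Longrightarrow> (\<And>t. typed t T \<Longrightarrow> fm (inst b 0 t)) \<Longrightarrow>
    fm (Cst (C_ex T) \<cdot> Lam b)"

abbreviation All :: "ty \<Rightarrow> tm \<Rightarrow> tm" where "All T b \<equiv> Cst (C_all T) \<cdot> Lam b"
abbreviation Ex :: "ty \<Rightarrow> tm \<Rightarrow> tm" where "Ex T b \<equiv> Cst (C_ex T) \<cdot> Lam b"
abbreviation Tii :: ty where "Tii \<equiv> Ti \<rightarrow>\<^sub>t Ti"

abbreviation extends :: "tm list \<Rightarrow> tm list \<Rightarrow> bool"  (infix "\<sqsubseteq>" 50) where
  "S \<sqsubseteq> S' \<equiv> set S \<subseteq> set S'"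

lemma fm_typed: "fm A \<Longrightarrow> typed A To"
  by (induction rule: fm.induct) (auto simp: has_type_simps)

text \<open>Separates atoms from compound formulas by their head constants when \<open>fm\<close> is
  inverted.\<close>

lemma eq_patom_head: "t = patom p us \<Longrightarrow> head t = Some (Pred p)"
  by simp

lemma fm_simps [simp]:
  "fm \<^bold>\<bottom>" "fm \<^bold>\<top>"
  "fm (A \<^bold>\<and> B) \<longleftrightarrow> fm A \<and> fm B"
  "fm (A \<^bold>\<or> B) \<longleftrightarrow> fm A \<and> fm B"
  "fm (A \<^bold>\<supset> B) \<longleftrightarrow> fm A \<and> fm B"
  "fm (All T b) \<longleftrightarrow>
    o_free T \<and> has_type [T] b To \<and> (\<forall>t. typed t T \<longrightarrow> fm (inst b 0 t))"
  "fm (Ex T b) \<longleftrightarrow>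
    o_free T \<and> has_type [T] b To \<and> (\<forall>t. typed t T \<longrightarrow> fm (inst b 0 t))"
  "fm (patom p us) \<longleftrightarrow> typed (patom p us) To"
  by (auto intro: fm.intros fm_typed elim: fm.cases dest!: eq_patom_head)

lemma derives_conv1:
  assumes "derives D (add_mset A \<Gamma>) C" "A \<approx> A'" "typed A' To"
  shows "derives D (add_mset A' \<Gamma>) C"
proof (rule d_conv[OF assms(1)])
  show "rel_mset (\<approx>) (add_mset A \<Gamma>) (add_mset A' \<Gamma>)"
    using assms(2) by (intro rel_mset_Plus multiset.rel_refl conv_refl)
qed (use derives_wf_seq[OF assms(1)] assms(3) in \<open>auto simp: wf_seq_def conv_refl\<close>)

lemma derives_convR:
  assumes "derives D \<Gamma> C" "C \<approx> C'" "typed C' To"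
  shows "derives D \<Gamma> C'"
  using assms derives_wf_seq[OF assms(1)]
  by (auto simp: wf_seq_def intro!: d_conv[OF assms(1)] multiset.rel_refl conv_refl)

lemma derives_id: "fm A \<Longrightarrow> \<forall>B\<in>#\<Gamma>. typed B To \<Longrightarrow> derives D (add_mset A \<Gamma>) A"
proof (induction arbitrary: \<Gamma> rule: fm.induct)
  case (fm_atom p us)
  then show ?case by (auto simp: wf_seq_def intro: d_init)
next
  case fm_bot
  then show ?case by (auto simp: wf_seq_def has_type_simps intro: d_botL)
next
  case fm_top
  then show ?case by (auto simp: wf_seq_def has_type_simps intro: d_topR)
next
  case (fm_and A B)
  then show ?case by (auto intro!: d_andR intro: d_andL1 d_andL2 fm_typed)
next
  case (fm_or A B)
  then show ?case by (auto intro!: d_orL intro: d_orR1 d_orR2 fm_typed)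
next
  case (fm_imp A B)
  have "derives D (add_mset (A \<^bold>\<supset> B) (add_mset A \<Gamma>)) B"
    using fm_imp by (intro d_impL fm_imp.IH) (auto intro: fm_typed)
  then show ?case by (intro d_impR) (simp add: add_mset_commute)
next
  case (fm_all T b)
  obtain x where x: "(x, T) \<notin> fvs \<Gamma> \<union> fv b" using ex_fresh[of "fvs \<Gamma> \<union> fv b"] by auto
  have t: "typed (Free (x, T)) T" using fm_all by (simp add: has_type_simps)
  \<comment> \<open>The quantifier rules act on the redex \<open>Lam b\<close> applied to the
    eigenvariable, the induction hypothesis on its contractum.\<close>
  have c: "inst b 0 (Free (x, T)) \<approx> Lam b \<cdot> Free (x, T)" by (intro conv_sym[OF conv_beta])
  have h: "typed (Lam b) (T \<rightarrow>\<^sub>t To)" using fm_all by (auto intro: ht_lam)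
  have "derives D (add_mset (Lam b \<cdot> Free (x, T)) \<Gamma>) (Lam b \<cdot> Free (x, T))"
    by (intro derives_convR[OF derives_conv1[OF fm_all.IH[OF t fm_all.prems] c] c] ht_app[OF h t])
  then show ?case using fm_all t h x
    by (intro d_allR[where x = x] d_allL) (auto simp: fvs_def)
next
  case (fm_ex T b)
  obtain x where x: "(x, T) \<notin> fvs \<Gamma> \<union> fv b" using ex_fresh[of "fvs \<Gamma> \<union> fv b"] by auto
  have t: "typed (Free (x, T)) T" using fm_ex by (simp add: has_type_simps)
  have c: "inst b 0 (Free (x, T)) \<approx> Lam b \<cdot> Free (x, T)" by (intro conv_sym[OF conv_beta])
  have h: "typed (Lam b) (T \<rightarrow>\<^sub>t To)" using fm_ex by (auto intro: ht_lam)
  have "derives D (add_mset (Lam b \<cdot> Free (x, T)) \<Gamma>) (Lam b \<cdot> Free (x, T))"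
    by (intro derives_convR[OF derives_conv1[OF fm_ex.IH[OF t fm_ex.prems] c] c] ht_app[OF h t])
  then show ?case using fm_ex t h x
    by (intro d_exL[where x = x] d_exR) (auto simp: fvs_def)
qed

text \<open>Weakening is not a rule of the calculus; it is a cut against the generalised initial
  sequent on \<open>C\<close>, whence the assumption \<open>fm C\<close>.\<close>

lemma derives_weaken:
  assumes "derives D \<Gamma> C" "fm C" "\<forall>B\<in>#\<Delta>. typed B To"
  shows "derives D (\<Gamma> + \<Delta>) C"
  using d_cut[OF assms(1) derives_id[OF assms(2,3)]] .

lemma derives_contract:
  "derives D (\<Gamma> + \<Delta>) C \<Longrightarrow> set_mset \<Gamma> \<subseteq> set_mset \<Delta> \<Longrightarrow> derives D \<Delta> C"
proof (induction \<Gamma>)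
  case (add A \<Gamma>)
  then obtain \<Delta>' where d: "\<Delta> = add_mset A \<Delta>'" by (auto dest: multi_member_split)
  with add.prems have "derives D (add_mset A (add_mset A (\<Gamma> + \<Delta>'))) C" by simp
  from d_contract[OF this] add d show ?case by simp
qed simp

text \<open>Passes from sets of hypotheses back to multisets: contraction merges the copies of
  \<open>A\<close> into at most one, the form in which a rule can act on it.\<close>

lemma derives_split:
  assumes "derives D \<Gamma> C" "set_mset \<Gamma> \<subseteq> insert A X"
  shows "\<exists>\<Gamma>'. set_mset \<Gamma>' \<subseteq> X \<and> (derives D \<Gamma>' C \<or> derives D (add_mset A \<Gamma>') C)"
proof (cases "A \<in># \<Gamma>")
  case True
  then obtain \<Gamma>1 where g: "\<Gamma> = add_mset A \<Gamma>1" by (auto dest: multi_member_split)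
  let ?E = "filter_mset (\<lambda>B. B = A) \<Gamma>1" and ?N = "filter_mset (\<lambda>B. B \<noteq> A) \<Gamma>1"
  have "add_mset A \<Gamma>1 = add_mset A (?E + ?N)" by (rule arg_cong[OF multiset_partition])
  then have "\<Gamma> = ?E + add_mset A ?N" unfolding g by simp
  then have "derives D (add_mset A ?N) C"
    using assms(1) by (auto intro: derives_contract[of D ?E "add_mset A ?N"])
  moreover have "set_mset ?N \<subseteq> X" using assms(2) g by auto
  ultimately show ?thesis by blast
next
  case False
  then show ?thesis using assms by blast
qed

section \<open>Entailment and its natural deduction rules\<close>

text \<open>Hypotheses form a list to keep them finite, so that eigenvariables can be chosen fresh;
  order and multiplicity are invisible, which absorbs the structural rules. \<open>fm C\<close> is
  kept inside because weakening relies on it.\<close>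

definition ent :: "tm list \<Rightarrow> tm \<Rightarrow> bool"  (infix "||-" 45) where
  "S ||- C \<longleftrightarrow> fm C \<and> (\<exists>\<Gamma>. set_mset \<Gamma> \<subseteq> set S \<and> derives D_all \<Gamma> C)"

lemma ent_fm: "S ||- C \<Longrightarrow> fm C"
  by (simp add: ent_def)

lemma ent_mono: "S ||- C \<Longrightarrow> S \<sqsubseteq> S' \<Longrightarrow> S' ||- C"
  by (auto simp: ent_def)

lemma entI: "derives D_all \<Gamma> C \<Longrightarrow> fm C \<Longrightarrow> set_mset \<Gamma> \<subseteq> set S \<Longrightarrow> S ||- C"
  by (auto simp: ent_def)

lemma ent_hyp: "A \<in> set S \<Longrightarrow> fm A \<Longrightarrow> S ||- A"
  by (rule entI[OF derives_id[where \<Gamma> = "{#}"]]) auto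

lemma ent_cut: "S ||- A \<Longrightarrow> A # S ||- C \<Longrightarrow> S ||- C"
proof -
  assume a: "S ||- A" and c: "A # S ||- C"
  then obtain \<Gamma> \<Delta> where g: "set_mset \<Gamma> \<subseteq> set S" "derives D_all \<Gamma> A"
    and d: "set_mset \<Delta> \<subseteq> insert A (set S)" "derives D_all \<Delta> C" by (auto simp: ent_def)
  from derives_split[OF d(2,1)] obtain \<Delta>' where "set_mset \<Delta>' \<subseteq> set S"
    "derives D_all \<Delta>' C \<or> derives D_all (add_mset A \<Delta>') C" by auto
  with g d_cut[OF g(2), of \<Delta>' C] show ?thesis
    using ent_fm[OF c] entI[of \<Delta>' C S] entI[of "\<Gamma> + \<Delta>'" C S] by auto
qed

lemma ent_derives: "S ||- C \<Longrightarrow> \<forall>A\<in>set S. typed A To \<Longrightarrow> derives D_all (mset S) C"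
  unfolding ent_def using derives_contract[OF derives_weaken[of D_all _ C "mset S"]] by auto

lemma ent_trans1: "S ||- A \<Longrightarrow> [A] ||- C \<Longrightarrow> S ||- C"
  by (erule ent_cut) (erule ent_mono, simp)

lemma ent_trans: "S ||- A \<Longrightarrow> derives D_all {#A#} C \<Longrightarrow> fm C \<Longrightarrow> S ||- C"
  by (erule ent_trans1) (auto intro: entI)

lemma ent_conv: "S ||- A \<Longrightarrow> A \<approx> B \<Longrightarrow> fm B \<Longrightarrow> S ||- B"
  by (frule ent_fm, erule ent_trans)
    (auto intro: derives_convR[OF derives_id[where \<Gamma> = "{#}"]] fm_typed)

lemma ent_topI: "S ||- \<^bold>\<top>"
  by (rule entI[OF d_topR[of "{#}"]]) (auto simp: wf_seq_def has_type_simps)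

lemma ent_botE: "S ||- \<^bold>\<bottom> \<Longrightarrow> fm C \<Longrightarrow> S ||- C"
  by (erule ent_trans) (auto intro!: d_botL simp: wf_seq_def fm_typed)

lemma ent_andI: "S ||- A \<Longrightarrow> S ||- B \<Longrightarrow> S ||- A \<^bold>\<and> B"
proof -
  assume ab: "S ||- A" "S ||- B"
  then obtain \<Gamma> \<Delta> where g: "set_mset \<Gamma> \<subseteq> set S" "derives D_all \<Gamma> A"
    and d: "set_mset \<Delta> \<subseteq> set S" "derives D_all \<Delta> B" by (auto simp: ent_def)
  have "derives D_all (\<Gamma> + \<Delta>) A"
    using g d ab derives_wf_seq[OF d(2)] by (intro derives_weaken) (auto simp: wf_seq_def ent_fm)
  moreover have "derives D_all (\<Delta> + \<Gamma>) B"
    using g d ab derives_wf_seq[OF g(2)] by (intro derives_weaken) (auto simp: wf_seq_def ent_fm)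
  ultimately have "derives D_all (\<Gamma> + \<Delta>) (A \<^bold>\<and> B)" by (intro d_andR) (auto simp: add.commute)
  then show ?thesis using g d ab by (auto intro!: entI dest: ent_fm)
qed

lemma ent_and [simp]: "S ||- A \<^bold>\<and> B \<longleftrightarrow> S ||- A \<and> S ||- B"
proof
  assume h: "S ||- A \<^bold>\<and> B"
  then have "fm A" "fm B" by (auto dest: ent_fm)
  with h show "S ||- A \<and> S ||- B"
    by (auto intro!: ent_trans[OF h] d_andL1[OF derives_id] d_andL2[OF derives_id] fm_typed)
qed (auto intro: ent_andI)

lemma ent_orI1: "S ||- A \<Longrightarrow> fm B \<Longrightarrow> S ||- A \<^bold>\<or> B"
  by (frule ent_fm, erule ent_trans[OF _ d_orR1[OF derives_id]]) (auto intro: fm_typed)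

lemma ent_orI2: "S ||- B \<Longrightarrow> fm A \<Longrightarrow> S ||- A \<^bold>\<or> B"
  by (frule ent_fm, erule ent_trans[OF _ d_orR2[OF derives_id]]) (auto intro: fm_typed)

lemma ent_impI:
  assumes "fm A" "\<And>S'. S \<sqsubseteq> S' \<Longrightarrow> S' ||- A \<Longrightarrow> S' ||- B"
  shows "S ||- A \<^bold>\<supset> B"
proof -
  \<comment> \<open>Among the extensions only \<open>A # S\<close> is used; quantifying over all of
    them spares explicit weakening when the premise is proved.\<close>
  have b: "A # S ||- B" by (rule assms(2)[OF _ ent_hyp]) (use assms(1) in auto)
  then obtain \<Gamma> where g: "set_mset \<Gamma> \<subseteq> insert A (set S)" "derives D_all \<Gamma> B" by (auto simp: ent_def)
  from derives_split[OF g(2,1)] obtain \<Delta> where d: "set_mset \<Delta> \<subseteq> set S"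
    "derives D_all \<Delta> B \<or> derives D_all (add_mset A \<Delta>) B" by auto
  then have "derives D_all (add_mset A \<Delta>) B"
    using derives_weaken[of D_all \<Delta> B "{#A#}"] ent_fm[OF b] fm_typed[OF assms(1)] by auto
  from d_impR[OF this] show ?thesis using d assms(1) ent_fm[OF b] by (auto intro: entI)
qed

lemma ent_mp: "S ||- A \<^bold>\<supset> B \<Longrightarrow> S ||- A \<Longrightarrow> S ||- B"
proof -
  assume h: "S ||- A \<^bold>\<supset> B" "S ||- A"
  then have f: "fm A" "fm B" by (auto dest: ent_fm)
  have "derives D_all (add_mset (A \<^bold>\<supset> B) {#A#}) B"
    using f by (intro d_impL derives_id) (auto intro: fm_typed derives_id[where \<Gamma> = "{#}"])
  then have "A # (A \<^bold>\<supset> B) # S ||- B" using f by (auto intro: entI)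
  moreover have "(A \<^bold>\<supset> B) # S ||- A" using h(2) by (auto intro: ent_mono)
  ultimately have "(A \<^bold>\<supset> B) # S ||- B" by (auto intro: ent_cut)
  with h(1) show ?thesis by (rule ent_cut)
qed

lemma ent_orE:
  assumes "S ||- A \<^bold>\<or> B"
    and A: "\<And>S'. S \<sqsubseteq> S' \<Longrightarrow> S' ||- A \<Longrightarrow> S' ||- C"
    and B: "\<And>S'. S \<sqsubseteq> S' \<Longrightarrow> S' ||- B \<Longrightarrow> S' ||- C"
  shows "S ||- C"
proof -
  have f: "fm A" "fm B" using ent_fm[OF assms(1)] by auto
  \<comment> \<open>The branches are packed into implications, so that the left rule is applied to
    one small sequent and the implications are cut in afterwards.\<close>
  have "S ||- A \<^bold>\<supset> C" "S ||- B \<^bold>\<supset> C" using f A B by (auto intro!: ent_impI)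
  then have c: "fm C" by (auto dest: ent_fm)
  have "derives D_all (add_mset (A \<^bold>\<or> B) {#A \<^bold>\<supset> C, B \<^bold>\<supset> C#}) C"
  proof (rule d_orL)
    have "derives D_all (add_mset (A \<^bold>\<supset> C) {#A, B \<^bold>\<supset> C#}) C"
      using f c by (intro d_impL derives_id) (auto intro: fm_typed)
    then show "derives D_all (add_mset A {#A \<^bold>\<supset> C, B \<^bold>\<supset> C#}) C" by (simp add: add_mset_commute)
    have "derives D_all (add_mset (B \<^bold>\<supset> C) {#B, A \<^bold>\<supset> C#}) C"
      using f c by (intro d_impL derives_id) (auto intro: fm_typed)
    then show "derives D_all (add_mset B {#A \<^bold>\<supset> C, B \<^bold>\<supset> C#}) C" by (simp add: add_mset_commute)
  qed
  then have "[A \<^bold>\<supset> C, B \<^bold>\<supset> C, A \<^bold>\<or> B] ||- C" using c by (auto intro: entI)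
  then have 1: "(A \<^bold>\<supset> C) # (B \<^bold>\<supset> C) # (A \<^bold>\<or> B) # S ||- C" by (rule ent_mono) auto
  have "(B \<^bold>\<supset> C) # (A \<^bold>\<or> B) # S ||- C"
    by (rule ent_cut[OF _ 1], rule ent_mono[OF \<open>S ||- A \<^bold>\<supset> C\<close>]) auto
  then have "(A \<^bold>\<or> B) # S ||- C"
    by (rule ent_cut[rotated], intro ent_mono[OF \<open>S ||- B \<^bold>\<supset> C\<close>]) auto
  with assms(1) show ?thesis by (rule ent_cut)
qed

lemma ent_allE:
  assumes "S ||- All T b" "typed t T"
  shows "S ||- inst b 0 t"
proof (rule ent_trans[OF assms(1)])
  have f: "o_free T" "has_type [T] b To" "fm (inst b 0 t)"
    using ent_fm[OF assms(1)] assms(2) by auto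
  then show "fm (inst b 0 t)" by simp
  have l: "typed (Lam b) (T \<rightarrow>\<^sub>t To)" using f by (auto intro: ht_lam)
  have "derives D_all {#Lam b \<cdot> t#} (inst b 0 t)"
    by (rule derives_conv1[OF derives_id[OF f(3)] conv_sym[OF conv_beta]])
      (auto intro: ht_app[OF l assms(2)])
  then show "derives D_all {#All T b#} (inst b 0 t)"
    by (rule d_allL) (use f l assms in auto)
qed

lemma ent_allI:
  assumes "o_free T" "has_type [T] b To" "\<And>t. typed t T \<Longrightarrow> S ||- inst b 0 t"
  shows "S ||- All T b"
proof -
  obtain x where x: "(x, T) \<notin> fvs (mset S) \<union> fv b" using ex_fresh[of "fvs (mset S) \<union> fv b"] by auto
  \<comment> \<open>A fresh variable is itself a typed term, so the premise for all terms contains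
    the one for an eigenvariable.\<close>
  have t: "typed (Free (x, T)) T" using assms by (simp add: has_type_simps)
  from assms(3)[OF this] obtain \<Gamma> where g: "set_mset \<Gamma> \<subseteq> set S" "derives D_all \<Gamma> (inst b 0 (Free (x, T)))"
    by (auto simp: ent_def)
  have l: "typed (Lam b) (T \<rightarrow>\<^sub>t To)" using assms by (auto intro: ht_lam)
  have "derives D_all \<Gamma> (Lam b \<cdot> Free (x, T))"
    by (rule derives_convR[OF g(2) conv_sym[OF conv_beta]]) (rule ht_app[OF l t])
  then have "derives D_all \<Gamma> (All T b)"
    by (rule d_allR) (use assms l x g in \<open>auto simp: fvs_def\<close>)
  then show ?thesis using g assms(1,2) ent_fm[OF assms(3)] by (auto intro!: entI)
qed

lemma ent_exI:
  assumes "S ||- inst b 0 t" "typed t T" "fm (Ex T b)"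
  shows "S ||- Ex T b"
proof (rule ent_trans[OF assms(1) _ assms(3)])
  have f: "o_free T" "has_type [T] b To" "fm (inst b 0 t)" using assms by auto
  have l: "typed (Lam b) (T \<rightarrow>\<^sub>t To)" using f by (auto intro: ht_lam)
  have "derives D_all {#inst b 0 t#} (Lam b \<cdot> t)"
    by (rule derives_convR[OF derives_id[OF f(3)] conv_sym[OF conv_beta]])
      (auto intro: ht_app[OF l assms(2)])
  then show "derives D_all {#inst b 0 t#} (Ex T b)"
    by (rule d_exR) (use f l assms in auto)
qed

lemma ent_exE:
  assumes "S ||- Ex T b"
    and C: "\<And>S' t. S \<sqsubseteq> S' \<Longrightarrow> typed t T \<Longrightarrow> S' ||- inst b 0 t \<Longrightarrow> S' ||- C"
  shows "S ||- C"
proof (rule ent_cut[OF assms(1)])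
  let ?V = "fvs (mset S) \<union> fv b \<union> fv C"
  obtain x where x: "(x, T) \<notin> ?V" using ex_fresh[of ?V] by auto
  have f: "o_free T" "has_type [T] b To" "\<And>t. typed t T \<Longrightarrow> fm (inst b 0 t)"
    using ent_fm[OF assms(1)] by auto
  have t: "typed (Free (x, T)) T" using f by (simp add: has_type_simps)
  have l: "typed (Lam b) (T \<rightarrow>\<^sub>t To)" using f by (auto intro: ht_lam)
  let ?A = "inst b 0 (Free (x, T))"
  have c: "?A # S ||- C" by (rule C[OF _ t ent_hyp]) (use f t in auto)
  then obtain \<Gamma> where g: "set_mset \<Gamma> \<subseteq> insert ?A (set S)" "derives D_all \<Gamma> C"
    by (auto simp: ent_def)
  from derives_split[OF g(2,1)] obtain \<Delta> where d: "set_mset \<Delta> \<subseteq> set S"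
    "derives D_all \<Delta> C \<or> derives D_all (add_mset ?A \<Delta>) C" by auto
  from d(2) show "Ex T b # S ||- C"
  proof
    assume "derives D_all (add_mset ?A \<Delta>) C"
    then have "derives D_all (add_mset (Lam b \<cdot> Free (x, T)) \<Delta>) C"
      by (rule derives_conv1[OF _ conv_sym[OF conv_beta]]) (rule ht_app[OF l t])
    then have "derives D_all (add_mset (Ex T b) \<Delta>) C"
      by (rule d_exL) (use f l x d in \<open>auto simp: fvs_def\<close>)
    then show ?thesis by (rule entI) (use d(1) ent_fm[OF c] in auto)
  qed (rule entI, use d(1) ent_fm[OF c] in auto)
qed

lemma ent_nat_zero: "S ||- nat_fm zero_tm"
  by (rule entI[OF d_natR_z[of "{#}"]]) (auto simp: wf_seq_def has_type_simps)

lemma ent_nat_suc: "S ||- nat_fm t \<Longrightarrow> S ||- nat_fm (suc_tm t)"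
  by (frule ent_fm, erule ent_trans[OF _ d_natR_s[OF derives_id]]) (auto simp: has_type_simps)

text \<open>Base and step are required for every \<open>S\<close>, because these premises of
  \<open>d_natL\<close> have no side formulas: facts about the surroundings must be part of
  \<open>b\<close>. For the same reason the step does not offer \<open>nat\<close> of
  \<open>j\<close>; where it is needed, \<open>b\<close> includes it as a conjunct.\<close>

lemma ent_nat_induct:
  assumes "S ||- nat_fm t" "has_type [Tnt] b To"
    and z: "\<And>S. S ||- inst b 0 zero_tm"
    and s: "\<And>S j. typed j Tnt \<Longrightarrow> S ||- inst b 0 j \<Longrightarrow> S ||- inst b 0 (suc_tm j)"
    and f: "\<And>t. typed t Tnt \<Longrightarrow> fm (inst b 0 t)"
  shows "S ||- inst b 0 t"
proof (rule ent_trans[OF assms(1)])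
  have t: "typed t Tnt" using ent_fm[OF assms(1)] by simp
  then show "fm (inst b 0 t)" by (rule f)
  have l: "typed (Lam b) (Tnt \<rightarrow>\<^sub>t To)" using assms(2) by (auto intro: ht_lam)
  obtain x where x: "(x, Tnt) \<notin> fv b" using ex_fresh[of "fv b"] by auto
  let ?x = "Free (x, Tnt)"
  have tx: "typed ?x Tnt" "typed (suc_tm ?x) Tnt" by (auto simp: has_type_simps)
  note c = conv_sym[OF conv_beta]
  have "derives D_all {#} (Lam b \<cdot> zero_tm)"
    using ent_derives[OF z[of "[]"]]
    by (intro derives_convR[OF _ c] ht_app[OF l]) (auto simp: has_type_simps)
  moreover have "[inst b 0 ?x] ||- inst b 0 (suc_tm ?x)" by (intro s tx ent_hyp f) auto
  from ent_derives[OF this] have "derives D_all {#inst b 0 ?x#} (inst b 0 (suc_tm ?x))"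
    using f[OF tx(1)] fm_typed by auto
  then have "derives D_all {#Lam b \<cdot> ?x#} (Lam b \<cdot> suc_tm ?x)"
    by (intro derives_convR[OF derives_conv1[OF _ c] c] ht_app[OF l] tx)
  moreover have "derives D_all (add_mset (Lam b \<cdot> t) {#}) (inst b 0 t)"
    by (intro derives_conv1[OF derives_id[OF f[OF t]] c] ht_app[OF l] t) auto
  ultimately show "derives D_all {#nat_fm t#} (inst b 0 t)"
    by (rule d_natL) (use l t x in auto)
qed

lemma ent_defR:
  assumes "S ||- subst \<sigma> B" "(p, ts, B) \<in> D_all" "is_subst \<sigma>"
    and "patom p us \<approx> patom p (map (subst \<sigma>) ts)" "typed (patom p us) To"
  shows "S ||- patom p us"
proof -
  from assms(1) obtain \<Gamma> where g: "set_mset \<Gamma> \<subseteq> set S" "derives D_all \<Gamma> (subst \<sigma> B)"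
    by (auto simp: ent_def)
  have "derives D_all \<Gamma> (patom p us)"
    by (rule d_defR[OF g(2) assms(2,3)])
      (use assms derives_wf_seq[OF g(2)] in \<open>auto simp: wf_seq_def\<close>)
  then show ?thesis using g assms by (auto intro: entI)
qed

lemma ex_renaming_apart: "finite V \<Longrightarrow> \<exists>\<pi>. is_renaming \<pi> \<and> range \<pi> \<inter> V = {}"
proof -
  assume "finite V"
  then obtain k where k: "\<forall>n\<in>fst ` V. n < k" using finite_nat_set_iff_bounded by blast
  then show ?thesis
    by (intro exI[of _ "\<lambda>v. (fst v + k, snd v)"])
      (force simp: is_renaming_def inj_def prod_eq_iff)
qed

lemma fv_rename: "fv (rename \<pi> t) = \<pi> ` fv t"
  unfolding rename_def by (induction t) auto

lemma complete_unifiers_all: "complete_unifiers V t u {\<theta>. unifier \<theta> t u}"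
  unfolding complete_unifiers_def
proof (intro conjI allI impI)
  fix \<sigma> assume "unifier \<sigma> t u"
  then show "\<exists>\<theta>\<in>{\<theta>. unifier \<theta> t u}. \<exists>\<rho>. is_subst \<rho> \<and> (\<forall>v\<in>V. \<sigma> v \<approx> subst \<rho> (\<theta> v))"
    by (intro bexI[of _ \<sigma>] exI[of _ Free]) (auto simp: conv_refl)
qed simp

text \<open>
  Using the set of all unifiers spares the computation of most general ones, at the price that
  every substitution instance of the conclusion has to be derived.
\<close>

lemma ent_defL_hyp:
  assumes "S ||- patom p us" "p \<noteq> P_nat" "fm C"
    and cl: "\<And>ts B \<theta> \<sigma>. (p, ts, B) \<in> D_all \<Longrightarrow> is_subst \<theta> \<Longrightarrow> is_subst \<sigma> \<Longrightarrow>
      patom p (map (subst \<theta>) us) \<approx> patom p (map (subst \<sigma>) ts) \<Longrightarrow> [subst \<sigma> B] ||- subst \<theta> C"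
  shows "S ||- C"
proof (rule ent_trans[OF assms(1) _ assms(3)])
  \<comment> \<open>Only the atom itself is on the left, so no side formula undergoes the unifier;
    further hypotheses are to be made antecedents of \<open>C\<close> beforehand.\<close>
  show "derives D_all {#patom p us#} C"
  proof (rule d_defL)
    fix ts B assume d: "(p, ts, B) \<in> D_all"
    then have B: "typed B To" using is_definition_D_all by (auto simp: is_definition_def)
    let ?V = "fv (patom p us) \<union> fvs {#} \<union> fv C"
    have "finite ?V" using finite_fv finite_fvs by blast
    then obtain \<pi> where \<pi>: "is_renaming \<pi>" "range \<pi> \<inter> ?V = {}" using ex_renaming_apart[OF \<open>finite ?V\<close>] by blast
    let ?S = "{\<theta>. unifier \<theta> (patom p us) (rename \<pi> (patom p ts))}"
    have "derives D_all (add_mset (subst \<theta> (rename \<pi> B)) (image_mset (subst \<theta>) {#})) (subst \<theta> C)"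
      if "\<theta> \<in> ?S" for \<theta>
    proof -
      \<comment> \<open>Composed with the renaming, \<theta> becomes a substitution for the original
        clause; \<open>cl\<close> is stated for two unrelated substitutions, so nothing about the
        renaming remains.\<close>
      have s: "is_subst (\<lambda>v. \<theta> (\<pi> v))" using that \<pi>
        by (auto simp: unifier_def is_subst_def is_renaming_def) (metis prod.collapse snd_conv)
      have "[subst (\<lambda>v. \<theta> (\<pi> v)) B] ||- subst \<theta> C"
        by (rule cl[OF d _ s]) (use that in \<open>auto simp: unifier_def subst_rename\<close>)
      from ent_derives[OF this] show ?thesis using has_type_subst[OF s B] by (simp add: subst_rename)
    qed
    moreover have "complete_unifiers (fv (rename \<pi> (patom p ts)) \<union> ?V) (patom p us)
       (rename \<pi> (patom p ts)) ?S"
      by (rule complete_unifiers_all)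
    moreover have "fv (rename \<pi> (patom p ts)) \<inter> ?V = {}" unfolding fv_rename using \<pi>(2) by blast
    ultimately show "\<exists>\<pi> S. is_renaming \<pi> \<and> fv (rename \<pi> (patom p ts)) \<inter> ?V = {} \<and>
        complete_unifiers (fv (rename \<pi> (patom p ts)) \<union> fv (patom p us) \<union> fvs {#} \<union> fv C)
          (patom p us) (rename \<pi> (patom p ts)) S \<and>
        (\<forall>\<theta>\<in>S. derives D_all (add_mset (subst \<theta> (rename \<pi> B)) (image_mset (subst \<theta>) {#})) (subst \<theta> C))"
      using \<pi>(1) unfolding Un_assoc[symmetric] by (intro exI[of _ \<pi>] exI[of _ ?S]) blast
  qed (use assms ent_fm[OF assms(1)] in \<open>auto simp: wf_seq_def fm_typed\<close>)
qed

lemma derivable_ent: "[] ||- F \<Longrightarrow> derivable D_all F"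
  using ent_derives[of "[]" F] by (simp add: derivable_def)

section \<open>Clauses of the object-level sequent calculus\<close>

text \<open>The type occurs only in the premises of \<open>lift_typed\<close> and
  \<open>inst_typed\<close>, so the simplifier is given one instance for each type in use.\<close>

lemmas closed_simps [simp] =
  lift_typed[where \<Delta> = "[]" and T = Tnt, simplified] inst_typed[where \<Delta> = "[]" and T = Tnt, simplified]
  lift_typed[where \<Delta> = "[]" and T = Ti, simplified] inst_typed[where \<Delta> = "[]" and T = Ti, simplified]
  lift_typed[where \<Delta> = "[]" and T = Tatm, simplified] inst_typed[where \<Delta> = "[]" and T = Tatm, simplified]
  lift_typed[where \<Delta> = "[]" and T = Tprp, simplified] inst_typed[where \<Delta> = "[]" and T = Tprp, simplified]
  lift_typed[where \<Delta> = "[]" and T = Tlst, simplified] inst_typed[where \<Delta> = "[]" and T = Tlst, simplified]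
  lift_typed[where \<Delta> = "[]" and T = Tii, simplified]
  inst_typed[where \<Delta> = "[]" and T = Tii, simplified]
  lift_typed[where \<Delta> = "[]" and T = "Ti \<rightarrow>\<^sub>t Tprp", simplified]
  inst_typed[where \<Delta> = "[]" and T = "Ti \<rightarrow>\<^sub>t Tprp", simplified]

declare has_type_simps(1,2,3,5) [simp]

lemma has_type_cst_app [simp]:
  "has_type \<Delta> (Cst c \<cdot> t) U \<longleftrightarrow> (\<exists>T. cst_type c = T \<rightarrow>\<^sub>t U \<and> cst_ok c \<and> has_type \<Delta> t T)"
  "has_type \<Delta> (Cst c \<cdot> t \<cdot> u) V \<longleftrightarrow>
    (\<exists>T U. cst_type c = T \<rightarrow>\<^sub>t U \<rightarrow>\<^sub>t V \<and> cst_ok c \<and> has_type \<Delta> t T \<and> has_type \<Delta> u U)"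
  by (auto simp: has_type_simps) metis+

lemma has_type_weaken_Cons [simp]: "typed t T \<Longrightarrow> has_type (U # \<Delta>) t T"
  by (rule has_type_weaken)

lemma has_type_app_Ti [simp]:
  "has_type \<Delta> r Tii \<Longrightarrow> has_type \<Delta> n Ti \<Longrightarrow> has_type \<Delta> (r \<cdot> n) Ti"
  "has_type \<Delta> F (Ti \<rightarrow>\<^sub>t Tprp) \<Longrightarrow> has_type \<Delta> n Ti \<Longrightarrow> has_type \<Delta> (F \<cdot> n) Tprp"
  by (auto simp: has_type_simps(4))

lemma has_type_subst_simp [simp]:
  "is_subst \<theta> \<Longrightarrow> typed t T \<Longrightarrow> typed (subst \<theta> t) T"
  "is_subst \<theta> \<Longrightarrow> o_free T \<Longrightarrow> typed (\<theta> (x, T)) T"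
  by (auto simp: has_type_subst is_subst_def)

lemma patom_conv_iff [simp]:
  "length us = length vs \<Longrightarrow> patom p us \<approx> patom p vs \<longleftrightarrow> list_all2 (\<approx>) us vs"
proof (induction us arbitrary: vs rule: rev_induct)
  case (snoc u us)
  then obtain w ws where v: "vs = ws @ [w]" "length us = length ws" by (cases vs rule: rev_cases) auto
  have "patom p (us @ [u]) \<approx> patom p (ws @ [w]) \<longleftrightarrow> patom p us \<cdot> u \<approx> patom p ws \<cdot> w"
    by (simp add: patom_def)
  then show ?case using snoc v by (auto simp: list_all2_append)
qed (auto simp: patom_def)

declare conv_refl [simp]

lemmas D_defs = D_all_def D_nat_def D_list_def D_intuit_def D_lambda_def D_equiv_def Let_def

lemma D_all_seq:
  "(P_seq, ts, B) \<in> D_all \<longleftrightarrow> (P_seq, ts, B) \<in> D_intuit"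
  by (auto simp: D_defs)

lemma D_all_element:
  "(P_element, ts, B) \<in> D_all \<longleftrightarrow> (P_element, ts, B) \<in> D_list"
  by (auto simp: D_defs)

lemma D_all_prog: "(P_prog, ts, B) \<in> D_all \<longleftrightarrow> (P_prog, ts, B) \<in> D_lambda"
  by (auto simp: D_defs)

lemma D_all_equiv: "(P_equiv, ts, B) \<in> D_all \<longleftrightarrow> (P_equiv, ts, B) \<in> D_equiv"
  by (auto simp: D_defs)

lemma D_all_eq: "(P_eq, ts, B) \<in> D_all \<longleftrightarrow> (P_eq, ts, B) \<in> D_nat"
  by (auto simp: D_defs)

lemma fm_clause:
  assumes "(p, ts, B) \<in> D_all" "is_subst \<sigma>"
  shows "fm (subst \<sigma> B)"
proof -
  have [simp]:
    "has_type \<Delta> (patom P_sum [i, j, k]) To \<longleftrightarrow> has_type \<Delta> i Tnt \<and> has_type \<Delta> j Tnt \<and> has_type \<Delta> k Tnt"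
    "has_type \<Delta> (patom P_less [i, j]) To \<longleftrightarrow> has_type \<Delta> i Tnt \<and> has_type \<Delta> j Tnt"
    "has_type \<Delta> (patom P_length [l, i]) To \<longleftrightarrow> has_type \<Delta> l Tlst \<and> has_type \<Delta> i Tnt"
    "has_type \<Delta> (patom P_split [l, m, n]) To \<longleftrightarrow>
      has_type \<Delta> l Tlst \<and> has_type \<Delta> m Tlst \<and> has_type \<Delta> n Tlst"
    "has_type \<Delta> (patom P_permute [l, m]) To \<longleftrightarrow> has_type \<Delta> l Tlst \<and> has_type \<Delta> m Tlst"
    for \<Delta> i j k l m n
    by (auto simp: patom_def has_type_simps(4))
  show ?thesis using assms by (auto simp: D_defs all_fm_def ex_fm_def lam_def)
qed

text \<open>Each case has a new \<open>S\<close> unrelated to the old one: of the surroundings only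
  the conclusion passes through the rule. All that is known of the new \<open>S\<close> is that it
  entails the clause body, so the cases can be proved by the Kripke-style clauses.\<close>

lemma ent_defL:
  assumes "S ||- patom p us" "p \<noteq> P_nat" "fm C"
    and "\<And>S ts B \<theta> \<sigma>. (p, ts, B) \<in> D_all \<Longrightarrow> is_subst \<theta> \<Longrightarrow> is_subst \<sigma> \<Longrightarrow>
      patom p (map (subst \<theta>) us) \<approx> patom p (map (subst \<sigma>) ts) \<Longrightarrow> S ||- subst \<sigma> B \<Longrightarrow> S ||- subst \<theta> C"
  shows "S ||- C"
proof (rule ent_defL_hyp[OF assms(1-3)])
  fix ts B \<theta> \<sigma>
  assume h: "(p, ts, B) \<in> D_all" "is_subst \<theta>" "is_subst \<sigma>"
    "patom p (map (subst \<theta>) us) \<approx> patom p (map (subst \<sigma>) ts)"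
  show "[subst \<sigma> B] ||- subst \<theta> C"
    by (rule assms(4)[OF h]) (use h fm_clause in \<open>auto intro: ent_hyp\<close>)
qed

lemma ent_conv_atom:
  "S ||- patom p us \<Longrightarrow> list_all2 (\<approx>) us vs \<Longrightarrow> typed (patom p vs) To \<Longrightarrow> S ||- patom p vs"
  by (erule ent_conv) (auto simp: list_all2_lengthD)

lemma seq_conv:
  "S ||- seq_fm i l b \<Longrightarrow> i \<approx> i' \<Longrightarrow> l \<approx> l' \<Longrightarrow> b \<approx> b' \<Longrightarrow>
    typed i' Tnt \<Longrightarrow> typed l' Tlst \<Longrightarrow> typed b' Tprp \<Longrightarrow> S ||- seq_fm i' l' b'"
  by (erule ent_conv_atom) auto

lemma ent_typed: "S ||- A \<Longrightarrow> typed A To"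
  by (auto dest: ent_fm fm_typed)

lemma ent_ty [dest]:
  "S ||- nat_fm i \<Longrightarrow> typed i Tnt"
  "S ||- seq_fm i l b \<Longrightarrow> typed i Tnt \<and> typed l Tlst \<and> typed b Tprp"
  "S ||- patom P_element [x, l] \<Longrightarrow> typed x Tatm \<and> typed l Tlst"
  "S ||- prog_fm x b \<Longrightarrow> typed x Tatm \<and> typed b Tprp"
  "S ||- m \<^bold>\<equiv> n \<Longrightarrow> typed m Ti \<and> typed n Ti"
  by (auto dest: ent_typed)

text \<open>The context found by unification is already rewritten to \<open>subst \<theta> l\<close>
  in the subgoals; only the shapes of height and formula remain as conversions. Quantified bodies
  arrive as a family of instances or as a witness.\<close>

lemma seq_defL:
  assumes h: "S ||- seq_fm i l b" and C: "fm C"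
    and element: "\<And>S \<theta> a. is_subst \<theta> \<Longrightarrow> subst \<theta> b \<approx> \<^bold>\<langle>a\<^bold>\<rangle> \<Longrightarrow>
      S ||- patom P_element [a, subst \<theta> l] \<Longrightarrow> S ||- subst \<theta> C"
    and tt: "\<And>S \<theta>. is_subst \<theta> \<Longrightarrow> subst \<theta> b \<approx> tt_tm \<Longrightarrow> S ||- subst \<theta> C"
    and amp: "\<And>S \<theta> j c d. is_subst \<theta> \<Longrightarrow> subst \<theta> i \<approx> suc_tm j \<Longrightarrow> subst \<theta> b \<approx> c \<^bold>& d \<Longrightarrow>
      S ||- seq_fm j (subst \<theta> l) c \<Longrightarrow> S ||- seq_fm j (subst \<theta> l) d \<Longrightarrow> S ||- subst \<theta> C"
    and imp: "\<And>S \<theta> j a c. is_subst \<theta> \<Longrightarrow> subst \<theta> i \<approx> suc_tm j \<Longrightarrow> subst \<theta> b \<approx> a \<^bold>\<Rightarrow> c \<Longrightarrow>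
      S ||- seq_fm j (a \<^bold># subst \<theta> l) c \<Longrightarrow> S ||- subst \<theta> C"
    and all: "\<And>S \<theta> j f. is_subst \<theta> \<Longrightarrow> subst \<theta> i \<approx> suc_tm j \<Longrightarrow> subst \<theta> b \<approx> \<^bold>\<And> f \<Longrightarrow>
      typed j Tnt \<Longrightarrow> typed f (Ti \<rightarrow>\<^sub>t Tprp) \<Longrightarrow>
      (\<And>x. typed x Ti \<Longrightarrow> S ||- seq_fm j (subst \<theta> l) (f \<cdot> x)) \<Longrightarrow> S ||- subst \<theta> C"
    and atom: "\<And>S \<theta> j a g. is_subst \<theta> \<Longrightarrow> subst \<theta> i \<approx> suc_tm j \<Longrightarrow> subst \<theta> b \<approx> \<^bold>\<langle>a\<^bold>\<rangle> \<Longrightarrow>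
      S ||- prog_fm a g \<Longrightarrow> S ||- seq_fm j (subst \<theta> l) g \<Longrightarrow> S ||- subst \<theta> C"
  shows "S ||- C"
proof (rule ent_defL[OF h _ C])
  fix S0 ts B \<theta> \<sigma>
  assume cl: "(P_seq, ts, B) \<in> D_all" and \<theta>: "is_subst \<theta>" and \<sigma>: "is_subst \<sigma>"
    and u: "patom P_seq (map (subst \<theta>) [i, l, b]) \<approx> patom P_seq (map (subst \<sigma>) ts)"
    and hB: "S0 ||- subst \<sigma> B"
  have ty: "typed i Tnt" "typed l Tlst" "typed b Tprp" using ent_ty(2)[OF h] by auto
  note s = \<theta> \<sigma> ty conv_sym
  from cl consider
      "ts = [Free (0, Tnt), Free (1, Tatm) \<^bold># Free (0, Tlst), \<^bold>\<langle>Free (0, Tatm)\<^bold>\<rangle>]"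
      "B = patom P_element [Free (0, Tatm), Free (1, Tatm) \<^bold># Free (0, Tlst)]"
    | "ts = [Free (0, Tnt), Free (0, Tlst), tt_tm]" "B = \<^bold>\<top>"
    | "ts = [suc_tm (Free (0, Tnt)), Free (0, Tlst), Free (0, Tprp) \<^bold>& Free (1, Tprp)]"
      "B = seq_fm (Free (0, Tnt)) (Free (0, Tlst)) (Free (0, Tprp)) \<^bold>\<and>
           seq_fm (Free (0, Tnt)) (Free (0, Tlst)) (Free (1, Tprp))"
    | "ts = [suc_tm (Free (0, Tnt)), Free (0, Tlst), Free (0, Tatm) \<^bold>\<Rightarrow> Free (0, Tprp)]"
      "B = seq_fm (Free (0, Tnt)) (Free (0, Tatm) \<^bold># Free (0, Tlst)) (Free (0, Tprp))"
    | "ts = [suc_tm (Free (0, Tnt)), Free (0, Tlst), \<^bold>\<And> (Free (0, Ti \<rightarrow>\<^sub>t Tprp))]"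
      "B = All Ti (seq_fm (Free (0, Tnt)) (Free (0, Tlst)) (Free (0, Ti \<rightarrow>\<^sub>t Tprp) \<cdot> Bnd 0))"
    | "ts = [suc_tm (Free (0, Tnt)), Free (0, Tlst), \<^bold>\<langle>Free (0, Tatm)\<^bold>\<rangle>]"
      "B = Ex Tprp (prog_fm (Free (0, Tatm)) (Bnd 0) \<^bold>\<and>
           seq_fm (Free (0, Tnt)) (Free (0, Tlst)) (Bnd 0))"
    by (auto simp: D_all_seq D_intuit_def Let_def all_fm_def ex_fm_def lam_def)
  then show "S0 ||- subst \<theta> C"
  proof cases
    case 1
    have "S0 ||- patom P_element [\<sigma> (0, Tatm), subst \<theta> l]"
      using hB s u 1 by (auto elim!: ent_conv_atom)
    then show ?thesis using u 1 by (auto intro: element[OF \<theta>])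
  next
    case 2
    show ?thesis by (rule tt[OF \<theta>]) (use u 2 in simp)
  next
    case 3
    have "S0 ||- seq_fm (\<sigma> (0, Tnt)) (subst \<theta> l) (\<sigma> (0, Tprp))"
      "S0 ||- seq_fm (\<sigma> (0, Tnt)) (subst \<theta> l) (\<sigma> (1, Tprp))"
      using hB s u 3 by (auto elim: seq_conv)
    then show ?thesis using u 3 by (auto intro: amp[OF \<theta>])
  next
    case 4
    have "S0 ||- seq_fm (\<sigma> (0, Tnt)) (\<sigma> (0, Tatm) \<^bold># subst \<theta> l) (\<sigma> (0, Tprp))"
      using hB s u 4 by (auto elim!: ent_conv_atom)
    then show ?thesis using u 4 by (auto intro: imp[OF \<theta>])
  next
    case 5
    have x: "S0 ||- seq_fm (\<sigma> (0, Tnt)) (subst \<theta> l) (\<sigma> (0, Ti \<rightarrow>\<^sub>t Tprp) \<cdot> x)" if "typed x Ti" for x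
      by (rule ent_conv_atom[OF ent_allE[OF hB[unfolded 5, simplified] that, simplified]])
        (use u s 5 that in auto)
    show ?thesis
      by (rule all[OF \<theta>, of "\<sigma> (0, Tnt)" "\<sigma> (0, Ti \<rightarrow>\<^sub>t Tprp)"]) (use u 5 \<sigma> x in simp_all)
  next
    case 6
    show ?thesis
    proof (rule ent_exE[OF hB[unfolded 6, simplified]])
      fix S' g assume g: "typed g Tprp" and p: "S' ||- inst (prog_fm (\<sigma> (0, Tatm)) (Bnd 0) \<^bold>\<and>
           seq_fm (\<sigma> (0, Tnt)) (\<sigma> (0, Tlst)) (Bnd 0)) 0 g"
      have "S' ||- prog_fm (\<sigma> (0, Tatm)) g" "S' ||- seq_fm (\<sigma> (0, Tnt)) (\<sigma> (0, Tlst)) g"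
        using p g \<sigma> by auto
      then show "S' ||- subst \<theta> C"
        by (intro atom[OF \<theta>, of "\<sigma> (0, Tnt)" "\<sigma> (0, Tatm)" S' g])
          (use u 6 s g in \<open>auto elim!: ent_conv_atom[where p = P_seq]\<close>)
    qed
  qed
qed simp

lemmas clause_simps = D_all_seq D_all_element D_all_prog D_all_equiv D_all_eq
  D_intuit_def D_list_def D_lambda_def D_equiv_def D_nat_def Let_def all_fm_def ex_fm_def lam_def

section \<open>Introduction rules for \<open>element\<close> and \<open>seq\<close>\<close>

lemma element_headI: "typed a Tatm \<Longrightarrow> typed l Tlst \<Longrightarrow> S ||- patom P_element [a, a \<^bold># l]"
  by (rule ent_defR[where ts = "[Free (0, Tatm), Free (0, Tatm) \<^bold># Free (0, Tlst)]" and B = "\<^bold>\<top>"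
        and \<sigma> = "Free((0, Tatm) := a, (0, Tlst) := l)"])
    (auto simp: clause_simps ent_topI)

lemma element_tailI:
  "S ||- patom P_element [a, l] \<Longrightarrow> typed c Tatm \<Longrightarrow> S ||- patom P_element [a, c \<^bold># l]"
  by (frule ent_ty(3), rule ent_defR[where ts = "[Free (0, Tatm), Free (1, Tatm) \<^bold># Free (0, Tlst)]"
        and B = "patom P_element [Free (0, Tatm), Free (0, Tlst)]"
        and \<sigma> = "Free((0, Tatm) := a, (1, Tatm) := c, (0, Tlst) := l)"])
    (auto simp: clause_simps)

lemma seq_ttI: "typed i Tnt \<Longrightarrow> typed l Tlst \<Longrightarrow> S ||- seq_fm i l tt_tm"
  by (rule ent_defR[where ts = "[Free (0, Tnt), Free (0, Tlst), tt_tm]" and B = "\<^bold>\<top>"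
        and \<sigma> = "Free((0, Tnt) := i, (0, Tlst) := l)"])
    (auto simp: clause_simps ent_topI)

lemma seq_elementI_Cons:
  "S ||- patom P_element [a, c \<^bold># l] \<Longrightarrow> typed i Tnt \<Longrightarrow> S ||- seq_fm i (c \<^bold># l) \<^bold>\<langle>a\<^bold>\<rangle>"
  by (frule ent_ty(3), rule ent_defR[where
        ts = "[Free (0, Tnt), Free (1, Tatm) \<^bold># Free (0, Tlst), \<^bold>\<langle>Free (0, Tatm)\<^bold>\<rangle>]"
        and B = "patom P_element [Free (0, Tatm), Free (1, Tatm) \<^bold># Free (0, Tlst)]"
        and \<sigma> = "Free((0, Tatm) := a, (1, Tatm) := c, (0, Tlst) := l, (0, Tnt) := i)"])
    (auto simp: clause_simps)

lemma seq_ampI: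
  "S ||- seq_fm i l b \<Longrightarrow> S ||- seq_fm i l c \<Longrightarrow> S ||- seq_fm (suc_tm i) l (b \<^bold>& c)"
  by (frule ent_ty(2), frule ent_ty(2)[of _ _ _ c], rule ent_defR[where
        ts = "[suc_tm (Free (0, Tnt)), Free (0, Tlst), Free (0, Tprp) \<^bold>& Free (1, Tprp)]"
        and B = "seq_fm (Free (0, Tnt)) (Free (0, Tlst)) (Free (0, Tprp)) \<^bold>\<and>
           seq_fm (Free (0, Tnt)) (Free (0, Tlst)) (Free (1, Tprp))"
        and \<sigma> = "Free((0, Tnt) := i, (0, Tlst) := l, (0, Tprp) := b, (1, Tprp) := c)"])
    (auto simp: clause_simps)

lemma seq_impI:
  "S ||- seq_fm i (a \<^bold># l) b \<Longrightarrow> S ||- seq_fm (suc_tm i) l (a \<^bold>\<Rightarrow> b)"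
  by (frule ent_ty(2), rule ent_defR[where
        ts = "[suc_tm (Free (0, Tnt)), Free (0, Tlst), Free (0, Tatm) \<^bold>\<Rightarrow> Free (0, Tprp)]"
        and B = "seq_fm (Free (0, Tnt)) (Free (0, Tatm) \<^bold># Free (0, Tlst)) (Free (0, Tprp))"
        and \<sigma> = "Free((0, Tnt) := i, (0, Tlst) := l, (0, Tprp) := b, (0, Tatm) := a)"])
    (auto simp: clause_simps)

lemma seq_allI:
  assumes "\<And>x. typed x Ti \<Longrightarrow> S ||- seq_fm i l (f \<cdot> x)"
    and ty: "typed i Tnt" "typed l Tlst" "typed f (Ti \<rightarrow>\<^sub>t Tprp)"
  shows "S ||- seq_fm (suc_tm i) l (\<^bold>\<And> f)"
proof (rule ent_defR)
  let ?\<sigma> = "Free((0, Tnt) := i, (0, Tlst) := l, (0, Ti \<rightarrow>\<^sub>t Tprp) := f)"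
  let ?B = "All Ti (seq_fm (Free (0, Tnt)) (Free (0, Tlst)) (Free (0, Ti \<rightarrow>\<^sub>t Tprp) \<cdot> Bnd 0))"
  show "S ||- subst ?\<sigma> ?B" using assms by (auto intro!: ent_allI)
  show "(P_seq, [suc_tm (Free (0, Tnt)), Free (0, Tlst), \<^bold>\<And> (Free (0, Ti \<rightarrow>\<^sub>t Tprp))], ?B) \<in> D_all"
    by (auto simp: clause_simps)
qed (use ty in auto)

lemma seq_atomI:
  assumes "S ||- prog_fm a g" "S ||- seq_fm i l g"
  shows "S ||- seq_fm (suc_tm i) l \<^bold>\<langle>a\<^bold>\<rangle>"
proof (rule ent_defR)
  let ?\<sigma> = "Free((0, Tnt) := i, (0, Tlst) := l, (0, Tatm) := a)"
  let ?B = "Ex Tprp (prog_fm (Free (0, Tatm)) (Bnd 0) \<^bold>\<and>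
           seq_fm (Free (0, Tnt)) (Free (0, Tlst)) (Bnd 0))"
  have ty: "typed i Tnt" "typed l Tlst" "typed a Tatm" "typed g Tprp"
    using assms by auto
  show "S ||- subst ?\<sigma> ?B" using assms ty by (auto intro!: ent_exI[where t = g])
  show "(P_seq, [suc_tm (Free (0, Tnt)), Free (0, Tlst), \<^bold>\<langle>Free (0, Tatm)\<^bold>\<rangle>], ?B) \<in> D_all"
    by (auto simp: clause_simps)
qed (use ent_ty(2)[OF assms(2)] ent_ty(4)[OF assms(1)] in auto)

lemma element_defL:
  assumes h: "S ||- patom P_element [x, l]" and C: "fm C"
    and hd: "\<And>S \<theta> k. is_subst \<theta> \<Longrightarrow> typed k Tlst \<Longrightarrow> subst \<theta> l \<approx> subst \<theta> x \<^bold># k \<Longrightarrow>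
      S ||- subst \<theta> C"
    and tl: "\<And>S \<theta> y k. is_subst \<theta> \<Longrightarrow> typed y Tatm \<Longrightarrow> typed k Tlst \<Longrightarrow>
      subst \<theta> l \<approx> y \<^bold># k \<Longrightarrow> S ||- patom P_element [subst \<theta> x, k] \<Longrightarrow> S ||- subst \<theta> C"
  shows "S ||- C"
proof (rule ent_defL[OF h _ C])
  fix S0 ts B \<theta> \<sigma>
  assume cl: "(P_element, ts, B) \<in> D_all" and \<theta>: "is_subst \<theta>" and \<sigma>: "is_subst \<sigma>"
    and u: "patom P_element (map (subst \<theta>) [x, l]) \<approx> patom P_element (map (subst \<sigma>) ts)"
    and hB: "S0 ||- subst \<sigma> B"
  have ty: "typed x Tatm" "typed l Tlst" using ent_ty(3)[OF h] by auto
  from cl consider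
      "ts = [Free (0, Tatm), Free (0, Tatm) \<^bold># Free (0, Tlst)]" "B = \<^bold>\<top>"
    | "ts = [Free (0, Tatm), Free (1, Tatm) \<^bold># Free (0, Tlst)]"
      "B = patom P_element [Free (0, Tatm), Free (0, Tlst)]"
    by (auto simp: clause_simps)
  then show "S0 ||- subst \<theta> C"
  proof cases
    case 1
    then have "subst \<theta> x \<approx> \<sigma> (0, Tatm)" "subst \<theta> l \<approx> \<sigma> (0, Tatm) \<^bold># \<sigma> (0, Tlst)" using u by auto
    then have "subst \<theta> l \<approx> subst \<theta> x \<^bold># \<sigma> (0, Tlst)"
      by (meson conv_app conv_refl conv_sym conv_trans)
    then show ?thesis using \<sigma> by (intro hd[OF \<theta>, of "\<sigma> (0, Tlst)"]) auto
  next
    case 2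
    have "S0 ||- patom P_element [subst \<theta> x, \<sigma> (0, Tlst)]"
      using hB \<theta> \<sigma> ty u 2 by (auto elim!: ent_conv_atom intro: conv_sym)
    then show ?thesis using \<sigma> u 2 by (intro tl[OF \<theta>, of "\<sigma> (1, Tatm)" "\<sigma> (0, Tlst)"]) auto
  qed
qed simp

text \<open>The initial clause matches nonempty contexts only. Case analysis on membership exposes
  the first cell of the context in both cases.\<close>

lemma seq_elementI:
  assumes h: "S ||- patom P_element [a, l]" and i: "typed i Tnt"
  shows "S ||- seq_fm i l \<^bold>\<langle>a\<^bold>\<rangle>"
proof (rule element_defL[OF h])
  have ty: "typed a Tatm" "typed l Tlst" using ent_ty(3)[OF h] by auto
  then show "fm (seq_fm i l \<^bold>\<langle>a\<^bold>\<rangle>)" using i by simp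
  note s = i ty conv_sym
  show "S ||- subst \<theta> (seq_fm i l \<^bold>\<langle>a\<^bold>\<rangle>)"
    if "is_subst \<theta>" "typed k Tlst" "subst \<theta> l \<approx> subst \<theta> a \<^bold># k" for S \<theta> k
    using seq_elementI_Cons[OF element_headI[of "subst \<theta> a" k S], of "subst \<theta> i"] that s
    by (auto elim!: seq_conv)
  show "S ||- subst \<theta> (seq_fm i l \<^bold>\<langle>a\<^bold>\<rangle>)"
    if "is_subst \<theta>" "typed y Tatm" "typed k Tlst" "subst \<theta> l \<approx> y \<^bold># k"
      "S ||- patom P_element [subst \<theta> a, k]" for S \<theta> y k
    using seq_elementI_Cons[OF element_tailI[OF that(5,2)], of "subst \<theta> i"] that s
    by (auto elim!: seq_conv)
qed

lemma ent_imp3I: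
  assumes "fm A" "fm B" "fm C"
    and "\<And>S'. S \<sqsubseteq> S' \<Longrightarrow> S' ||- A \<Longrightarrow> S' ||- B \<Longrightarrow> S' ||- C \<Longrightarrow> S' ||- D"
  shows "S ||- A \<^bold>\<supset> B \<^bold>\<supset> C \<^bold>\<supset> D"
  by (intro ent_impI assms(1-3), rule assms(4)) (auto intro: ent_mono)

lemma ent_imp2I:
  assumes "fm A" "fm B"
    and "\<And>S'. S \<sqsubseteq> S' \<Longrightarrow> S' ||- A \<Longrightarrow> S' ||- B \<Longrightarrow> S' ||- D"
  shows "S ||- A \<^bold>\<supset> B \<^bold>\<supset> D"
  by (intro ent_impI assms(1-2), rule assms(3)) (auto intro: ent_mono)

lemma ent_all_mp:
  "S ||- All T (A \<^bold>\<supset> B) \<Longrightarrow> typed t T \<Longrightarrow> S ||- inst A 0 t \<Longrightarrow> S ||- inst B 0 t"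
  using ent_allE[of S T "A \<^bold>\<supset> B" t] ent_mp by simp

section \<open>Weakening of object-level derivations\<close>

text \<open>At height zero only the initial clause and the clause for \<open>tt\<close> can match,
  and \<open>E\<close> answers the former.\<close>

lemma seq_zero:
  assumes h: "S ||- seq_fm zero_tm l b"
    and E: "\<And>S' a. S \<sqsubseteq> S' \<Longrightarrow> S' ||- patom P_element [a, l] \<Longrightarrow> S' ||- seq_fm k l' \<^bold>\<langle>a\<^bold>\<rangle>"
    and k: "typed k Tnt" and l': "typed l' Tlst"
  shows "S ||- seq_fm k l' b"
proof -
  \<comment> \<open>\<open>E\<close> speaks of the original terms; as a formula it is instantiated
    by \<theta> together with the goal.\<close>
  let ?E = "All Tatm (patom P_element [Bnd 0, l] \<^bold>\<supset> seq_fm k l' \<^bold>\<langle>Bnd 0\<^bold>\<rangle>)"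
  have ty: "typed l Tlst" "typed b Tprp" using ent_ty(2)[OF h] by auto
  note s = ty k l'
  have "S ||- ?E" using s by (auto intro!: ent_allI ent_impI E)
  moreover have "S ||- ?E \<^bold>\<supset> seq_fm k l' b"
  proof (rule seq_defL[OF h])
    \<comment> \<open>Behind the unifier, the antecedent is unfolded into a HOL hypothesis
      again.\<close>
    have *: "S0 ||- subst \<theta> (?E \<^bold>\<supset> seq_fm k l' b)"
      if \<theta>: "is_subst \<theta>" and g: "\<And>S'. S0 \<sqsubseteq> S' \<Longrightarrow>
        (\<And>a. S' ||- patom P_element [a, subst \<theta> l] \<Longrightarrow> S' ||- seq_fm (subst \<theta> k) (subst \<theta> l') \<^bold>\<langle>a\<^bold>\<rangle>) \<Longrightarrow>
        S' ||- seq_fm (subst \<theta> k) (subst \<theta> l') (subst \<theta> b)" for S0 \<theta>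
    proof -
      have "S0 ||- subst \<theta> ?E \<^bold>\<supset> seq_fm (subst \<theta> k) (subst \<theta> l') (subst \<theta> b)"
      proof (rule ent_impI)
        show "fm (subst \<theta> ?E)" using s \<theta> by simp
        fix S' assume S': "S0 \<sqsubseteq> S'" and e: "S' ||- subst \<theta> ?E"
        have e': "S' ||- seq_fm (subst \<theta> k) (subst \<theta> l') \<^bold>\<langle>a\<^bold>\<rangle>"
          if "S' ||- patom P_element [a, subst \<theta> l]" for a
          using ent_all_mp[OF e[simplified], of a] that s \<theta> ent_ty(3)[OF that] by simp
        show "S' ||- seq_fm (subst \<theta> k) (subst \<theta> l') (subst \<theta> b)" by (rule g[OF S' e'])
      qed
      then show ?thesis by simp
    qed
    show "fm (?E \<^bold>\<supset> seq_fm k l' b)" using s by simp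
    show "S0 ||- subst \<theta> (?E \<^bold>\<supset> seq_fm k l' b)" if "is_subst \<theta>" "subst \<theta> b \<approx> \<^bold>\<langle>a\<^bold>\<rangle>"
      "S0 ||- patom P_element [a, subst \<theta> l]" for S0 \<theta> a
      by (rule *[OF that(1)], rule seq_conv[where b = "\<^bold>\<langle>a\<^bold>\<rangle>"])
        (use s that in \<open>auto intro: ent_mono conv_sym\<close>)
    show "S0 ||- subst \<theta> (?E \<^bold>\<supset> seq_fm k l' b)" if "is_subst \<theta>" "subst \<theta> b \<approx> tt_tm" for S0 \<theta>
      by (rule *[OF that(1)], rule seq_conv[OF seq_ttI[of "subst \<theta> k" "subst \<theta> l'"]]) (use s that in \<open>auto intro: conv_sym\<close>)
  qed auto
  ultimately show ?thesis by (auto intro: ent_mp)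
qed

text \<open>One layer of a derivation is rebuilt with another height and context. \<open>E\<close>
  replaces initial sequents, \<open>H1\<close> premises in the same context, \<open>H2\<close> the
  premise of an implication, where both contexts grow. Monotonicity takes \<open>k\<close> one above
  \<open>i\<close>, weakening takes \<open>k\<close> equal to \<open>i\<close>, and cut takes a
  bound supplied by induction.\<close>

lemma seq_step:
  assumes h: "S ||- seq_fm (suc_tm i) l b"
    and E: "\<And>S' a. S \<sqsubseteq> S' \<Longrightarrow> S' ||- patom P_element [a, l] \<Longrightarrow> S' ||- seq_fm (suc_tm k) l' \<^bold>\<langle>a\<^bold>\<rangle>"
    and H1: "\<And>S' c. S \<sqsubseteq> S' \<Longrightarrow> S' ||- seq_fm i l c \<Longrightarrow> S' ||- seq_fm k l' c"
    and H2: "\<And>S' a c. S \<sqsubseteq> S' \<Longrightarrow> S' ||- seq_fm i (a \<^bold># l) c \<Longrightarrow> S' ||- seq_fm k (a \<^bold># l') c"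
    and k: "typed k Tnt" and l': "typed l' Tlst"
  shows "S ||- seq_fm (suc_tm k) l' b"
proof -
  let ?E = "All Tatm (patom P_element [Bnd 0, l] \<^bold>\<supset> seq_fm (suc_tm k) l' \<^bold>\<langle>Bnd 0\<^bold>\<rangle>)"
  let ?H1 = "All Tprp (seq_fm i l (Bnd 0) \<^bold>\<supset> seq_fm k l' (Bnd 0))"
  let ?H2 = "All Tatm (All Tprp
    (seq_fm i (Bnd 1 \<^bold># l) (Bnd 0) \<^bold>\<supset> seq_fm k (Bnd 1 \<^bold># l') (Bnd 0)))"
  let ?C = "?E \<^bold>\<supset> ?H1 \<^bold>\<supset> ?H2 \<^bold>\<supset> seq_fm (suc_tm k) l' b"
  have ty: "typed i Tnt" "typed l Tlst" "typed b Tprp" using ent_ty(2)[OF h] by auto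
  note s = ty k l'
  have "S ||- ?E" "S ||- ?H1" "S ||- ?H2" using s by (auto intro!: ent_allI ent_impI E H1 H2)
  moreover have "S ||- ?C"
  proof (rule seq_defL[OF h])
    \<comment> \<open>The three hypotheses are recovered at the instantiated terms, and the formula
      is replaced by its shape \<open>b'\<close>, to which a right rule for \<open>seq\<close>
      applies.\<close>
    have *: "S0 ||- subst \<theta> ?C"
      if \<theta>: "is_subst \<theta>" and sb: "subst \<theta> b \<approx> b'" and b': "typed b' Tprp"
        and g: "\<And>S'. S0 \<sqsubseteq> S' \<Longrightarrow>
        (\<And>a. S' ||- patom P_element [a, subst \<theta> l] \<Longrightarrow>
          S' ||- seq_fm (suc_tm (subst \<theta> k)) (subst \<theta> l') \<^bold>\<langle>a\<^bold>\<rangle>) \<Longrightarrow>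
        (\<And>c. S' ||- seq_fm (subst \<theta> i) (subst \<theta> l) c \<Longrightarrow> S' ||- seq_fm (subst \<theta> k) (subst \<theta> l') c) \<Longrightarrow>
        (\<And>a c. S' ||- seq_fm (subst \<theta> i) (a \<^bold># subst \<theta> l) c \<Longrightarrow>
          S' ||- seq_fm (subst \<theta> k) (a \<^bold># subst \<theta> l') c) \<Longrightarrow>
        S' ||- seq_fm (suc_tm (subst \<theta> k)) (subst \<theta> l') b'" for S0 \<theta> b'
    proof -
      have "S0 ||- subst \<theta> ?E \<^bold>\<supset> subst \<theta> ?H1 \<^bold>\<supset> subst \<theta> ?H2 \<^bold>\<supset>
        seq_fm (suc_tm (subst \<theta> k)) (subst \<theta> l') (subst \<theta> b)"
      proof (rule ent_imp3I)
        show "fm (subst \<theta> ?E)" "fm (subst \<theta> ?H1)" "fm (subst \<theta> ?H2)" using s \<theta> by simp_all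
        fix S' assume S': "S0 \<sqsubseteq> S'"
          and e: "S' ||- subst \<theta> ?E" and h1: "S' ||- subst \<theta> ?H1" and h2: "S' ||- subst \<theta> ?H2"
        have e': "S' ||- seq_fm (suc_tm (subst \<theta> k)) (subst \<theta> l') \<^bold>\<langle>a\<^bold>\<rangle>"
          if "S' ||- patom P_element [a, subst \<theta> l]" for a
          using ent_all_mp[OF e[simplified], of a] that s \<theta> ent_ty(3)[OF that] by simp
        have h1': "S' ||- seq_fm (subst \<theta> k) (subst \<theta> l') c"
          if "S' ||- seq_fm (subst \<theta> i) (subst \<theta> l) c" for c
          using ent_all_mp[OF h1[simplified], of c] that s \<theta> ent_ty(2)[OF that] by simp
        have h2': "S' ||- seq_fm (subst \<theta> k) (a \<^bold># subst \<theta> l') c"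
          if "S' ||- seq_fm (subst \<theta> i) (a \<^bold># subst \<theta> l) c" for a c
        proof -
          have t: "typed a Tatm" "typed c Tprp" using ent_ty(2)[OF that] by auto
          from ent_all_mp[OF ent_allE[OF h2[simplified] t(1), simplified], of c] that s \<theta> t
          show ?thesis by simp
        qed
        have "S' ||- seq_fm (suc_tm (subst \<theta> k)) (subst \<theta> l') b'" by (rule g[OF S' e' h1' h2'])
        then show "S' ||- seq_fm (suc_tm (subst \<theta> k)) (subst \<theta> l') (subst \<theta> b)"
          by (rule seq_conv) (use s \<theta> sb in \<open>auto intro: conv_sym\<close>)
      qed
      then show ?thesis by simp
    qed
    show "fm ?C" using s by simp
    show "S0 ||- subst \<theta> ?C" if "is_subst \<theta>" "subst \<theta> b \<approx> \<^bold>\<langle>a\<^bold>\<rangle>"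
      "S0 ||- patom P_element [a, subst \<theta> l]" for S0 \<theta> a
      by (rule *[OF that(1,2)]) (use that(3) in \<open>auto intro: ent_mono\<close>)
    show "S0 ||- subst \<theta> ?C" if "is_subst \<theta>" "subst \<theta> b \<approx> tt_tm" for S0 \<theta>
      by (rule *[OF that(1,2)]) (use that s in \<open>auto intro!: seq_ttI\<close>)
    show "S0 ||- subst \<theta> ?C" if "is_subst \<theta>" "subst \<theta> (suc_tm i) \<approx> suc_tm j" "subst \<theta> b \<approx> c \<^bold>& d"
      "S0 ||- seq_fm j (subst \<theta> l) c" "S0 ||- seq_fm j (subst \<theta> l) d" for S0 \<theta> j c d
    proof (rule *[OF that(1,3)])
      have "S0 ||- seq_fm (subst \<theta> i) (subst \<theta> l) c" "S0 ||- seq_fm (subst \<theta> i) (subst \<theta> l) d"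
        using that s by (auto intro: seq_conv[OF that(4)] seq_conv[OF that(5)] conv_sym)
      then show "S' ||- seq_fm (suc_tm (subst \<theta> k)) (subst \<theta> l') (c \<^bold>& d)"
        if "S0 \<sqsubseteq> S'" "\<And>c. S' ||- seq_fm (subst \<theta> i) (subst \<theta> l) c \<Longrightarrow>
          S' ||- seq_fm (subst \<theta> k) (subst \<theta> l') c" for S'
        using that by (auto intro!: seq_ampI that(2) elim: ent_mono)
    qed (use that in auto)
    show "S0 ||- subst \<theta> ?C" if "is_subst \<theta>" "subst \<theta> (suc_tm i) \<approx> suc_tm j" "subst \<theta> b \<approx> a \<^bold>\<Rightarrow> c"
      "S0 ||- seq_fm j (a \<^bold># subst \<theta> l) c" for S0 \<theta> j a c
    proof (rule *[OF that(1,3)])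
      have "S0 ||- seq_fm (subst \<theta> i) (a \<^bold># subst \<theta> l) c"
        using that s by (auto intro: seq_conv[OF that(4)] conv_sym)
      then show "S' ||- seq_fm (suc_tm (subst \<theta> k)) (subst \<theta> l') (a \<^bold>\<Rightarrow> c)"
        if "S0 \<sqsubseteq> S'" "\<And>a c. S' ||- seq_fm (subst \<theta> i) (a \<^bold># subst \<theta> l) c \<Longrightarrow>
          S' ||- seq_fm (subst \<theta> k) (a \<^bold># subst \<theta> l') c" for S'
        using that by (auto intro!: seq_impI that(2) elim: ent_mono)
    qed (use ent_ty(2)[OF that(4)] in auto)
    show "S0 ||- subst \<theta> ?C" if "is_subst \<theta>" "subst \<theta> (suc_tm i) \<approx> suc_tm j" "subst \<theta> b \<approx> \<^bold>\<And> f"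
      "typed f (Ti \<rightarrow>\<^sub>t Tprp)"
      "\<And>x. typed x Ti \<Longrightarrow> S0 ||- seq_fm j (subst \<theta> l) (f \<cdot> x)" for S0 \<theta> j f
    proof (rule *[OF that(1,3)])
      have "S0 ||- seq_fm (subst \<theta> i) (subst \<theta> l) (f \<cdot> x)" if "typed x Ti" for x
        using that \<open>subst \<theta> (suc_tm i) \<approx> suc_tm j\<close> \<open>typed f (Ti \<rightarrow>\<^sub>t Tprp)\<close> \<open>is_subst \<theta>\<close> s
        by (auto intro: seq_conv[OF \<open>typed x Ti \<Longrightarrow> S0 ||- seq_fm j (subst \<theta> l) (f \<cdot> x)\<close>] conv_sym)
      then show "S' ||- seq_fm (suc_tm (subst \<theta> k)) (subst \<theta> l') (\<^bold>\<And> f)"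
        if "S0 \<sqsubseteq> S'" "\<And>c. S' ||- seq_fm (subst \<theta> i) (subst \<theta> l) c \<Longrightarrow>
          S' ||- seq_fm (subst \<theta> k) (subst \<theta> l') c" for S'
        using that \<open>typed f (Ti \<rightarrow>\<^sub>t Tprp)\<close> \<open>is_subst \<theta>\<close> s
        by (auto intro!: seq_allI that(2) intro: ent_mono[of S0])
    qed (use that in auto)
    show "S0 ||- subst \<theta> ?C" if "is_subst \<theta>" "subst \<theta> (suc_tm i) \<approx> suc_tm j" "subst \<theta> b \<approx> \<^bold>\<langle>a\<^bold>\<rangle>"
      "S0 ||- prog_fm a g" "S0 ||- seq_fm j (subst \<theta> l) g" for S0 \<theta> j a g
    proof (rule *[OF that(1,3)])
      have "S0 ||- seq_fm (subst \<theta> i) (subst \<theta> l) g"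
        using that s by (auto intro: seq_conv[OF that(5)] conv_sym)
      then show "S' ||- seq_fm (suc_tm (subst \<theta> k)) (subst \<theta> l') \<^bold>\<langle>a\<^bold>\<rangle>"
        if "S0 \<sqsubseteq> S'" "\<And>c. S' ||- seq_fm (subst \<theta> i) (subst \<theta> l) c \<Longrightarrow>
          S' ||- seq_fm (subst \<theta> k) (subst \<theta> l') c" for S'
        using that \<open>S0 ||- prog_fm a g\<close> by (auto intro!: seq_atomI[of _ _ g] that(2) elim: ent_mono)
    qed (use ent_ty(4)[OF that(4)] in auto)
  qed
  ultimately show ?thesis by (blast intro: ent_mp)
qed

section \<open>Unfolding entailment of iterated connectives\<close>

lemma ent_all_iff:
  "S ||- All T b \<longleftrightarrow>
    o_free T \<and> has_type [T] b To \<and> (\<forall>t. typed t T \<longrightarrow> S ||- inst b 0 t)"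
  by (auto intro: ent_allI ent_allE dest: ent_fm)

lemma ent_imp_iff:
  "S ||- A \<^bold>\<supset> B \<longleftrightarrow> fm A \<and> fm B \<and> (\<forall>S'. S \<sqsubseteq> S' \<longrightarrow> S' ||- A \<longrightarrow> S' ||- B)"
  by (auto intro: ent_impI ent_mp ent_mono dest: ent_fm)

text \<open>By monotonicity the successive extensions of \<open>S\<close> collapse into one, so both
  antecedents are available at the same \<open>S'\<close>.\<close>

lemma ent_imp2_iff:
  "S ||- A \<^bold>\<supset> B \<^bold>\<supset> C \<longleftrightarrow> fm A \<and> fm B \<and> fm C \<and>
    (\<forall>S'. S \<sqsubseteq> S' \<longrightarrow> S' ||- A \<longrightarrow> S' ||- B \<longrightarrow> S' ||- C)"
  by (auto intro: ent_imp2I dest: ent_fm) (meson ent_mono ent_mp)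

lemma ent_all2_iff:
  "S ||- All T (All U t) \<longleftrightarrow> o_free T \<and> o_free U \<and> has_type [U, T] t To \<and>
    (\<forall>a b. typed a T \<longrightarrow> typed b U \<longrightarrow> S ||- inst (inst t 1 a) 0 b)"
proof -
  have "has_type [U] (inst t 1 a) To" if "has_type [U, T] t To" "typed a T" for a
    using has_type_inst[OF that(2,1), of "[U]" "[]"] by simp
  moreover have "lift a k = a" if "typed a T" for a k using lift_typed[OF that] by simp
  ultimately show ?thesis by (auto simp: ent_all_iff)
qed

lemma ent_all3_iff:
  "S ||- All T (All U (All V t)) \<longleftrightarrow>
    o_free T \<and> o_free U \<and> o_free V \<and> has_type [V, U, T] t To \<and>
    (\<forall>a b c. typed a T \<longrightarrow> typed b U \<longrightarrow> typed c V \<longrightarrow>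
      S ||- inst (inst (inst t 2 a) 1 b) 0 c)"
proof -
  have "has_type [V] (inst (inst t (Suc (Suc 0)) a) (Suc 0) b) To"
    if "has_type [V, U, T] t To" "typed a T" "typed b U" for a b
    using has_type_inst[OF that(3) has_type_inst[OF that(2,1), of "[V, U]" "[]"], of "[V]" "[]"] by simp
  moreover have "lift a k = a" if "typed a T" for a k using lift_typed[OF that] by simp
  moreover have "lift a k = a" if "typed a U" for a k using lift_typed[OF that] by simp
  ultimately show ?thesis by (auto simp: ent_all2_iff ent_all_iff[where T = V] numeral_2_eq_2)
qed

lemmas forcing = ent_all_iff ent_imp_iff

text \<open>Context and formula are quantified inside the induction formula, since the premises of a
  clause change both.\<close>

lemma seq_mono:
  assumes "S ||- nat_fm i" "S ||- seq_fm i l b"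
  shows "S ||- seq_fm (suc_tm i) l b"
proof -
  \<comment> \<open>\<open>Bnd 2\<close> is the height, counted below the two quantifiers.\<close>
  let ?b = "All Tlst (All Tprp
    (seq_fm (Bnd 2) (Bnd 1) (Bnd 0) \<^bold>\<supset> seq_fm (suc_tm (Bnd 2)) (Bnd 1) (Bnd 0)))"
  have "S ||- inst ?b 0 i"
  proof (rule ent_nat_induct[OF assms(1)])
    show "S ||- inst ?b 0 zero_tm" for S
      by (auto simp: forcing elim!: seq_zero intro: seq_elementI)
    fix S j assume j: "typed j Tnt" and "S ||- inst ?b 0 j"
    then have H: "S' ||- seq_fm (suc_tm j) l b" if "S \<sqsubseteq> S'" "S' ||- seq_fm j l b" for S' l b
      using that ent_ty(2)[OF that(2)] by (auto simp: forcing)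
    have "S' ||- seq_fm (suc_tm (suc_tm j)) l b"
      if "S \<sqsubseteq> S'" "S' ||- seq_fm (suc_tm j) l b" for S' l b
      using that(2) by (rule seq_step) (use that j ent_ty(2)[OF that(2)] in \<open>auto intro!: seq_elementI H\<close>)
    then show "S ||- inst ?b 0 (suc_tm j)" using j by (auto simp: forcing)
  qed auto
  then show ?thesis using assms(2) ent_ty(1)[OF assms(1)] ent_ty(2)[OF assms(2)] by (auto simp: forcing)
qed

lemma subst_inst:
  assumes "is_subst \<theta>" "typed s U"
  shows "has_type \<Delta> t T \<Longrightarrow> subst \<theta> (inst t k s) = inst (subst \<theta> t) k (subst \<theta> s)"
proof (induction arbitrary: k rule: has_type.induct)
  case (ht_free T \<Delta> x)
  then have "typed (\<theta> (x, T)) T" using assms(1) by simp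
  from inst_typed[OF this] show ?case by simp
next
  case (ht_lam T \<Delta> t U)
  then show ?case using lift_typed[OF assms(2)] lift_typed[OF has_type_subst[OF assms]] by simp
qed auto

lemma inst_conv: "x \<approx> y \<Longrightarrow> inst t 0 x \<approx> inst t 0 y"
  by (meson conv_app conv_beta conv_refl conv_sym conv_trans)

text \<open>The motive \<open>A\<close> has a hole at \<open>Bnd 0\<close>: the head case yields
  only that \<theta> makes \<open>a\<close> and \<open>x\<close> convertible, which suffices to
  carry \<open>A\<close> from \<open>a\<close> to \<open>x\<close>. Being an atom, \<open>A\<close>
  stays a formula under all instances.\<close>

lemma element_ConsE:
  assumes h: "S ||- patom P_element [x, a \<^bold># l]" and A: "A = patom p us" "has_type [Tatm] A To"
    and hd: "S ||- inst A 0 a"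
    and tl: "\<And>S'. S \<sqsubseteq> S' \<Longrightarrow> S' ||- patom P_element [x, l] \<Longrightarrow> S' ||- inst A 0 x"
  shows "S ||- inst A 0 x"
proof -
  have ty: "typed x Tatm" "typed a Tatm" "typed l Tlst" using ent_ty(3)[OF h] by auto
  have f: "fm (inst A 0 t)" if "typed t Tatm" for t
    using has_type_inst0[OF A(2) that] A(1) by simp
  let ?T = "patom P_element [x, l] \<^bold>\<supset> inst A 0 x"
  have "S ||- inst A 0 a \<^bold>\<supset> ?T \<^bold>\<supset> inst A 0 x"
  proof (rule element_defL[OF h])
    show "fm (inst A 0 a \<^bold>\<supset> ?T \<^bold>\<supset> inst A 0 x)" using f ty by simp
    fix S \<theta> assume \<theta>: "is_subst \<theta>"
    let ?A = "subst \<theta> A"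
    note si = subst_inst[OF \<theta> _ A(2)]
    have f': "fm (inst ?A 0 t)" if "typed t Tatm" for t
      using has_type_inst0[OF has_type_subst[OF \<theta> A(2)] that] A(1) by simp
    show "S ||- subst \<theta> (inst A 0 a \<^bold>\<supset> ?T \<^bold>\<supset> inst A 0 x)"
      if "subst \<theta> (a \<^bold># l) \<approx> subst \<theta> x \<^bold># k" for k
    proof -
      have "inst ?A 0 (subst \<theta> a) \<approx> inst ?A 0 (subst \<theta> x)" using that by (auto intro: inst_conv)
      then have "S ||- inst ?A 0 (subst \<theta> a) \<^bold>\<supset> (patom P_element [subst \<theta> x, subst \<theta> l] \<^bold>\<supset>
        inst ?A 0 (subst \<theta> x)) \<^bold>\<supset> inst ?A 0 (subst \<theta> x)"
        using ty \<theta> f' by (intro ent_imp2I) (auto elim: ent_conv)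
      then show ?thesis using si ty by simp
    qed
    show "S ||- subst \<theta> (inst A 0 a \<^bold>\<supset> ?T \<^bold>\<supset> inst A 0 x)"
      if "subst \<theta> (a \<^bold># l) \<approx> y \<^bold># k" "S ||- patom P_element [subst \<theta> x, k]" for y k
    proof -
      have "S ||- patom P_element [subst \<theta> x, subst \<theta> l]"
        using that ty \<theta> by (auto elim!: ent_conv_atom intro: conv_sym)
      then have "S ||- inst ?A 0 (subst \<theta> a) \<^bold>\<supset> (patom P_element [subst \<theta> x, subst \<theta> l] \<^bold>\<supset>
        inst ?A 0 (subst \<theta> x)) \<^bold>\<supset> inst ?A 0 (subst \<theta> x)"
        using ty \<theta> f' by (intro ent_imp2I) (auto elim!: ent_mp intro: ent_mono)
      then show ?thesis using si ty by simp
    qed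
  qed
  moreover have "S ||- ?T" using ty f tl by (auto intro!: ent_impI)
  ultimately show ?thesis using hd by (blast intro: ent_mp)
qed

text \<open>Contexts are compared by membership, so this covers exchange and contraction as well as
  weakening. The inclusion belongs to the induction formula, since it must be reestablished for the
  larger contexts that implication creates.\<close>

lemma seq_weaken:
  assumes "S ||- nat_fm i" "S ||- seq_fm i l b" "typed l' Tlst"
    and sub: "\<And>S' x. S \<sqsubseteq> S' \<Longrightarrow> S' ||- patom P_element [x, l] \<Longrightarrow> S' ||- patom P_element [x, l']"
  shows "S ||- seq_fm i l' b"
proof -
  \<comment> \<open>\<open>Bnd 3\<close> and \<open>Bnd 2\<close> are the old and the new context,
    shifted by the quantifier of \<open>?X\<close> itself.\<close>
  let ?X = "All Tatm (patom P_element [Bnd 0, Bnd 3] \<^bold>\<supset> patom P_element [Bnd 0, Bnd 2])"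
  let ?b = "All Tlst (All Tlst (All Tprp
    (?X \<^bold>\<supset> seq_fm (Bnd 3) (Bnd 2) (Bnd 0) \<^bold>\<supset> seq_fm (Bnd 3) (Bnd 1) (Bnd 0))))"
  let ?sub = "\<lambda>S l l'. \<forall>S' x. S \<sqsubseteq> S' \<longrightarrow> S' ||- patom P_element [x, l] \<longrightarrow> S' ||- patom P_element [x, l']"
  have X: "S ||- All Tatm (patom P_element [Bnd 0, l] \<^bold>\<supset> patom P_element [Bnd 0, l']) \<longleftrightarrow>
      ?sub S l l'" if "typed l Tlst" "typed l' Tlst" for S l l'
    using that by (auto simp: forcing)
  have iff': "S ||- inst ?b 0 i \<longleftrightarrow> (\<forall>l l' b. typed l Tlst \<longrightarrow> typed l' Tlst \<longrightarrow>
      typed b Tprp \<longrightarrow> (\<forall>S'. S \<sqsubseteq> S' \<longrightarrow> ?sub S' l l' \<longrightarrow>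
      S' ||- seq_fm i l b \<longrightarrow> S' ||- seq_fm i l' b))" if "typed i Tnt" for S i
    using that X by (simp add: ent_all3_iff ent_imp2_iff)
  have iff: "S ||- inst ?b 0 i \<longleftrightarrow> (\<forall>S' l l' b. S \<sqsubseteq> S' \<longrightarrow> typed l' Tlst \<longrightarrow> ?sub S' l l' \<longrightarrow>
      S' ||- seq_fm i l b \<longrightarrow> S' ||- seq_fm i l' b)" if "typed i Tnt" for S i
    unfolding iff'[OF that] by (blast dest: ent_ty(2))
  have "S ||- inst ?b 0 i"
  proof (rule ent_nat_induct[OF assms(1)])
    show "S ||- inst ?b 0 zero_tm" for S
      by (subst iff) (auto elim!: seq_zero intro: seq_elementI)
    fix S j assume j: "typed j Tnt" and H: "S ||- inst ?b 0 j"
    show "S ||- inst ?b 0 (suc_tm j)"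
    proof (subst iff, simp add: j, intro allI impI)
      fix S' l l' b
      assume h: "S \<sqsubseteq> S'" "typed l' Tlst" "?sub S' l l'" "S' ||- seq_fm (suc_tm j) l b"
      show "S' ||- seq_fm (suc_tm j) l' b"
      proof (rule seq_step[OF h(4)])
        show "S2 ||- seq_fm (suc_tm j) l' \<^bold>\<langle>a\<^bold>\<rangle>" if "S' \<sqsubseteq> S2" "S2 ||- patom P_element [a, l]" for S2 a
          using that h(3) j by (auto intro: seq_elementI)
        show "S2 ||- seq_fm j l' c" if "S' \<sqsubseteq> S2" "S2 ||- seq_fm j l c" for S2 c
          using H[unfolded iff[OF j], rule_format, of S2 l' l c] that h by auto
        show "S2 ||- seq_fm j (a \<^bold># l') c" if "S' \<sqsubseteq> S2" "S2 ||- seq_fm j (a \<^bold># l) c" for S2 a c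
        proof -
          have a: "typed a Tatm" using ent_ty(2)[OF that(2)] by auto
          \<comment> \<open>The inclusion persists when both contexts gain \<open>a\<close>: the
            head is kept, the tail is included by assumption.\<close>
          have "S3 ||- patom P_element [x, a \<^bold># l']"
            if e: "S2 \<sqsubseteq> S3" "S3 ||- patom P_element [x, a \<^bold># l]" for S3 x
          proof -
            have x: "typed x Tatm" using ent_ty(3)[OF e(2)] by auto
            have "S3 ||- inst (patom P_element [Bnd 0, a \<^bold># l']) 0 x"
              by (rule element_ConsE[OF e(2) refl])
                (use a x h(2,3) e(1) \<open>S' \<sqsubseteq> S2\<close> in \<open>auto intro: element_headI element_tailI\<close>)
            then show ?thesis using a h(2) by simp
          qed
          then show ?thesis
            using H[unfolded iff[OF j], rule_format, of S2 "a \<^bold># l'" "a \<^bold># l" c] that h a by auto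
        qed
      qed (use j h in auto)
    qed
  qed auto
  then show ?thesis using iff ent_ty(1)[OF assms(1)] assms(2-) by blast
qed

section \<open>Cut and inversion for object-level derivations\<close>

text \<open>This and the next two formulas internalise \<open>seq_le\<close>, \<open>ctx_le\<close>
  and \<open>cut_to\<close>, so that an induction formula can speak of them.\<close>

abbreviation simF :: "tm \<Rightarrow> tm \<Rightarrow> tm" where
  "simF k k' \<equiv> All Tlst (All Tprp
    (seq_fm k (Bnd (Suc 0)) (Bnd 0) \<^bold>\<supset> seq_fm k' (Bnd (Suc 0)) (Bnd 0)))"

abbreviation ctxF :: "tm \<Rightarrow> tm \<Rightarrow> tm \<Rightarrow> tm" where
  "ctxF k l l' \<equiv> All Tatm (patom P_element [Bnd 0, l] \<^bold>\<supset> seq_fm k l' \<^bold>\<langle>Bnd 0\<^bold>\<rangle>)"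

abbreviation cutF :: "tm \<Rightarrow> tm \<Rightarrow> tm \<Rightarrow> tm" where
  "cutF i k k' \<equiv> All Tlst (All Tlst (All Tprp
    (ctxF k (Bnd 3) (Bnd 2) \<^bold>\<supset> seq_fm i (Bnd 2) (Bnd 0) \<^bold>\<supset> seq_fm k' (Bnd (Suc 0)) (Bnd 0))))"

definition seq_le :: "tm list \<Rightarrow> tm \<Rightarrow> tm \<Rightarrow> bool" where
  "seq_le S k k' \<longleftrightarrow> (\<forall>S' l b. S \<sqsubseteq> S' \<longrightarrow> S' ||- seq_fm k l b \<longrightarrow> S' ||- seq_fm k' l b)"

definition ctx_le :: "tm list \<Rightarrow> tm \<Rightarrow> tm \<Rightarrow> tm \<Rightarrow> bool" where
  "ctx_le S k l l' \<longleftrightarrow>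
    (\<forall>S' x. S \<sqsubseteq> S' \<longrightarrow> S' ||- patom P_element [x, l] \<longrightarrow> S' ||- seq_fm k l' \<^bold>\<langle>x\<^bold>\<rangle>)"

text \<open>Simultaneous cut: all hypotheses in \<open>l\<close> are discharged at once by
  derivations of height \<open>k\<close> in \<open>l'\<close>, and \<open>k'\<close> is fixed before
  contexts and formula are given. The simultaneous form passes under implication by keeping the new
  atom on both sides.\<close>

definition cut_to :: "tm list \<Rightarrow> tm \<Rightarrow> tm \<Rightarrow> tm \<Rightarrow> bool" where
  "cut_to S i k k' \<longleftrightarrow> (\<forall>S' l l' b. S \<sqsubseteq> S' \<longrightarrow> typed l' Tlst \<longrightarrow> ctx_le S' k l l' \<longrightarrow>
    S' ||- seq_fm i l b \<longrightarrow> S' ||- seq_fm k' l' b)"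

lemma ent_simF: "typed k Tnt \<Longrightarrow> typed k' Tnt \<Longrightarrow> S ||- simF k k' \<longleftrightarrow> seq_le S k k'"
  unfolding seq_le_def by (simp add: ent_all2_iff ent_imp_iff) (blast dest: ent_ty(2))

lemma ent_ctxF:
  "typed k Tnt \<Longrightarrow> typed l Tlst \<Longrightarrow> typed l' Tlst \<Longrightarrow>
    S ||- ctxF k l l' \<longleftrightarrow> ctx_le S k l l'"
  unfolding ctx_le_def by (simp add: ent_all_iff ent_imp_iff) (blast dest: ent_ty(3))

lemma ent_cutF:
  assumes "typed i Tnt" "typed k Tnt" "typed k' Tnt"
  shows "S ||- cutF i k k' \<longleftrightarrow> cut_to S i k k'"
proof -
  have "S ||- cutF i k k' \<longleftrightarrow> (\<forall>l l' b. typed l Tlst \<longrightarrow> typed l' Tlst \<longrightarrow>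
      typed b Tprp \<longrightarrow> (\<forall>S'. S \<sqsubseteq> S' \<longrightarrow> ctx_le S' k l l' \<longrightarrow>
      S' ||- seq_fm i l b \<longrightarrow> S' ||- seq_fm k' l' b))"
    using assms by (simp add: ent_all3_iff ent_imp2_iff ent_ctxF)
  then show ?thesis unfolding cut_to_def by (blast dest: ent_ty(2))
qed

text \<open>
  An index that occurs below different numbers of binders is passed once per depth, so that the
  abbreviation also makes sense for loose bound variables.
\<close>

abbreviation cutexF :: "tm \<Rightarrow> tm \<Rightarrow> tm \<Rightarrow> tm" where
  "cutexF i k3 k5 \<equiv> Ex Tnt (nat_fm (Bnd 0) \<^bold>\<and> simF k3 (Bnd 2) \<^bold>\<and> cutF i k5 (Bnd 3))"

text \<open>Induction on \<open>i\<close>. The witness is \<open>k\<close> at zero and the successor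
  of the previous one at \<open>suc_tm j\<close>, so it amounts to the sum of \<open>i\<close> and
  \<open>k\<close>. As it is found before contexts and formula are chosen, one witness serves all
  premises of a clause. The conjunct \<open>simF\<close> lifts the derivations that answer the
  context, of height \<open>k\<close>, to the witness.\<close>

lemma ent_cutexF:
  assumes "S ||- nat_fm i" "S ||- nat_fm k"
  shows "S ||- cutexF i k k"
proof -
  let ?b = "All Tnt (nat_fm (Bnd 0) \<^bold>\<supset> cutexF (Bnd 5) (Bnd 3) (Bnd 5))"
  have iff: "S ||- inst ?b 0 i \<longleftrightarrow>
      (\<forall>k S'. S \<sqsubseteq> S' \<longrightarrow> S' ||- nat_fm k \<longrightarrow> S' ||- cutexF i k k)" if "typed i Tnt" for S i
    using that by (simp add: ent_all_iff ent_imp_iff) (blast dest: ent_ty(1))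
  have exI: "S ||- cutexF i k k"
    if "S ||- nat_fm k'" "seq_le S k k'" "cut_to S i k k'" "typed i Tnt" "typed k Tnt" for S i k k'
    using that ent_ty(1)[OF that(1)] by (intro ent_exI[where t = k']) (auto simp: ent_simF ent_cutF)
  have "S ||- inst ?b 0 i"
  proof (rule ent_nat_induct[OF assms(1)])
    show "S ||- inst ?b 0 zero_tm" for S
      by (subst iff) (auto intro!: exI simp: seq_le_def cut_to_def ctx_le_def elim!: seq_zero)
    fix S j assume j: "typed j Tnt" and H: "S ||- inst ?b 0 j"
    show "S ||- inst ?b 0 (suc_tm j)"
    proof (subst iff, simp add: j, intro allI impI)
      fix k S' assume S': "S \<sqsubseteq> S'" and k: "S' ||- nat_fm k"
      have tk: "typed k Tnt" using ent_ty(1)[OF k] .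
      have "S' ||- cutexF j k k" using H S' k unfolding iff[OF j] by blast
      then show "S' ||- cutexF (suc_tm j) k k"
      proof (rule ent_exE)
        fix S1 k1 assume S1: "S' \<sqsubseteq> S1" and t1: "typed k1 Tnt"
          and "S1 ||- inst (nat_fm (Bnd 0) \<^bold>\<and> simF k (Bnd 2) \<^bold>\<and> cutF j k (Bnd 3)) 0 k1"
        then have h: "S1 ||- nat_fm k1" "seq_le S1 k k1" "cut_to S1 j k k1"
          using tk j by (auto simp: ent_simF ent_cutF)
        have k1: "S1 ||- nat_fm k" using ent_mono[OF k S1] .
        \<comment> \<open>The \<open>nat_fm\<close> conjunct for the witness is used here, as
          \<open>seq_mono\<close> is an induction on it.\<close>
        have sim: "seq_le S1 k (suc_tm k1)"
          using h(2) unfolding seq_le_def by (blast intro: seq_mono ent_mono[OF h(1)])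
        have "cut_to S1 (suc_tm j) k (suc_tm k1)"
          unfolding cut_to_def
        proof (intro allI impI)
          fix S2 l l' b assume S2: "S1 \<sqsubseteq> S2" and l': "typed l' Tlst"
            and c: "ctx_le S2 k l l'" and b: "S2 ||- seq_fm (suc_tm j) l b"
          show "S2 ||- seq_fm (suc_tm k1) l' b"
          proof (rule seq_step[OF b])
            show "S3 ||- seq_fm (suc_tm k1) l' \<^bold>\<langle>a\<^bold>\<rangle>" if "S2 \<sqsubseteq> S3" "S3 ||- patom P_element [a, l]" for S3 a
              using that c sim S2 unfolding ctx_le_def seq_le_def by blast
            show "S3 ||- seq_fm k1 l' c'" if "S2 \<sqsubseteq> S3" "S3 ||- seq_fm j l c'" for S3 c'
              using that c h(3) S2 l' unfolding ctx_le_def cut_to_def by (meson subset_trans)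
            show "S3 ||- seq_fm k1 (a \<^bold># l') c'" if "S2 \<sqsubseteq> S3" "S3 ||- seq_fm j (a \<^bold># l) c'" for S3 a c'
            proof -
              have a: "typed a Tatm" using ent_ty(2)[OF that(2)] by auto
              \<comment> \<open>Passing under implication: the new atom \<open>a\<close> is answered
                by itself, the old ones by weakening their derivations to the context with
                \<open>a\<close>.\<close>
              have "S4 ||- seq_fm k (a \<^bold># l') \<^bold>\<langle>x\<^bold>\<rangle>"
                if e: "S3 \<sqsubseteq> S4" "S4 ||- patom P_element [x, a \<^bold># l]" for S4 x
              proof -
                have x: "typed x Tatm" using ent_ty(3)[OF e(2)] by auto
                have up: "S5 ||- seq_fm k (a \<^bold># l') \<^bold>\<langle>x\<^bold>\<rangle>"
                  if "S4 \<sqsubseteq> S5" "S5 ||- patom P_element [x, l]" for S5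
                proof (rule seq_weaken)
                  show "S5 ||- nat_fm k" by (rule ent_mono[OF k1])
                      (use S2 \<open>S2 \<sqsubseteq> S3\<close> e(1) that in auto)
                  show "S5 ||- seq_fm k l' \<^bold>\<langle>x\<^bold>\<rangle>"
                    using c that \<open>S2 \<sqsubseteq> S3\<close> e(1) unfolding ctx_le_def by (meson subset_trans)
                qed (use a l' in \<open>auto intro: element_tailI\<close>)
                have "S4 ||- inst (seq_fm k (a \<^bold># l') \<^bold>\<langle>Bnd 0\<^bold>\<rangle>) 0 x"
                  by (rule element_ConsE[OF e(2) refl])
                    (use a x l' tk up in \<open>auto intro!: seq_elementI element_headI\<close>)
                then show ?thesis using a l' tk by simp
              qed
              then have "ctx_le S3 k (a \<^bold># l) (a \<^bold># l')" unfolding ctx_le_def by blast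
              then show ?thesis using h(3) that S2 a l' unfolding cut_to_def by (auto dest: subset_trans)
            qed
          qed (use t1 l' in auto)
        qed
        then show "S1 ||- cutexF (suc_tm j) k k"
          using h sim tk j t1 by (auto intro!: exI[of _ "suc_tm k1"] ent_nat_suc)
      qed
    qed
  qed auto
  then show ?thesis using iff ent_ty(1)[OF assms(1)] assms(2) by blast
qed

lemma seq_cutE:
  assumes "S ||- nat_fm i" "S ||- nat_fm k"
    and C: "\<And>S' k'. S \<sqsubseteq> S' \<Longrightarrow> S' ||- nat_fm k' \<Longrightarrow> seq_le S' k k' \<Longrightarrow> cut_to S' i k k' \<Longrightarrow> S' ||- C"
  shows "S ||- C"
  using ent_cutexF[OF assms(1,2)]
proof (rule ent_exE)
  fix S1 k1 assume "S \<sqsubseteq> S1" "typed k1 Tnt"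
    "S1 ||- inst (nat_fm (Bnd 0) \<^bold>\<and> simF k (Bnd 2) \<^bold>\<and> cutF i k (Bnd 3)) 0 k1"
  then show "S1 ||- C" using ent_ty(1)[OF assms(1)] ent_ty(1)[OF assms(2)]
    by (intro C[of S1 k1]) (auto simp: ent_simF ent_cutF)
qed

text \<open>Cut with every hypothesis answered by itself turns the bound into a common upper bound:
  \<open>cut_to\<close> raises the first derivation, \<open>seq_le\<close> the second.\<close>

lemma seq_maxE:
  assumes "S ||- nat_fm i" "S ||- seq_fm i l b" "S ||- nat_fm j" "S ||- seq_fm j m c"
    and C: "\<And>S' k. S \<sqsubseteq> S' \<Longrightarrow> S' ||- nat_fm k \<Longrightarrow> S' ||- seq_fm k l b \<Longrightarrow> S' ||- seq_fm k m c \<Longrightarrow> S' ||- C"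
  shows "S ||- C"
proof (rule seq_cutE[OF assms(1,3)])
  fix S' k' assume S': "S \<sqsubseteq> S'" and k': "S' ||- nat_fm k'" "seq_le S' j k'" "cut_to S' i j k'"
  have "ctx_le S' j l l" using ent_ty(1)[OF assms(3)] by (auto simp: ctx_le_def intro: seq_elementI)
  then have "S' ||- seq_fm k' l b"
    using k'(3) ent_mono[OF assms(2) S'] ent_ty(2)[OF assms(2)] unfolding cut_to_def by blast
  moreover have "S' ||- seq_fm k' m c"
    using k'(2) ent_mono[OF assms(4) S'] unfolding seq_le_def by blast
  ultimately show "S' ||- C" using C[OF S' k'(1)] by blast
qed

section \<open>Inversion of the object-level rules\<close>

text \<open>Conjoining \<open>nat\<close> to the induction formula makes \<open>nat\<close> of
  \<open>j\<close> available in the successor case.\<close>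

lemma ent_nat_cases:
  assumes "S ||- nat_fm t" "has_type [Tnt] b To"
    and z: "\<And>S. S ||- inst b 0 zero_tm"
    and s: "\<And>S j. S ||- nat_fm j \<Longrightarrow> S ||- inst b 0 (suc_tm j)"
    and f: "\<And>t. typed t Tnt \<Longrightarrow> fm (inst b 0 t)"
  shows "S ||- inst b 0 t"
proof -
  have "S ||- inst (nat_fm (Bnd 0) \<^bold>\<and> b) 0 t"
    by (rule ent_nat_induct[OF assms(1)])
      (use assms(2) z s f in \<open>auto intro: ent_nat_zero ent_nat_suc\<close>)
  then show ?thesis by simp
qed

lemma eq_defL:
  assumes "S ||- patom P_eq [i, j]" "fm C"
    and "\<And>S \<theta>. is_subst \<theta> \<Longrightarrow> subst \<theta> i \<approx> subst \<theta> j \<Longrightarrow> S ||- subst \<theta> C"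
  shows "S ||- C"
proof (rule ent_defL[OF assms(1) _ assms(2)])
  fix S0 ts B \<theta> \<sigma>
  assume "(P_eq, ts, B) \<in> D_all" "is_subst \<theta>"
    "patom P_eq (map (subst \<theta>) [i, j]) \<approx> patom P_eq (map (subst \<sigma>) ts)"
  then show "S0 ||- subst \<theta> C"
    by (intro assms(3)) (auto simp: clause_simps intro: conv_trans conv_sym)
qed simp

lemma eqI: "typed i Tnt \<Longrightarrow> typed j Tnt \<Longrightarrow> i \<approx> j \<Longrightarrow> S ||- patom P_eq [i, j]"
  by (rule ent_defR[where ts = "[Free (0, Tnt), Free (0, Tnt)]" and B = "\<^bold>\<top>" and \<sigma> = "Free((0, Tnt) := i)"])
    (auto simp: clause_simps ent_topI intro: conv_sym)

lemma equiv_defL: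
  assumes "S ||- m \<^bold>\<equiv> n" "fm C"
    and "\<And>S \<theta>. is_subst \<theta> \<Longrightarrow> subst \<theta> m \<approx> subst \<theta> n \<Longrightarrow> S ||- subst \<theta> C"
  shows "S ||- C"
proof (rule ent_defL[OF assms(1) _ assms(2)])
  fix S0 ts B \<theta> \<sigma>
  assume "(P_equiv, ts, B) \<in> D_all" "is_subst \<theta>"
    "patom P_equiv (map (subst \<theta>) [m, n]) \<approx> patom P_equiv (map (subst \<sigma>) ts)"
  then show "S0 ||- subst \<theta> C"
    by (intro assms(3)) (auto simp: clause_simps intro: conv_trans conv_sym)
qed simp

lemma equivI: "typed m Ti \<Longrightarrow> typed n Ti \<Longrightarrow> m \<approx> n \<Longrightarrow> S ||- m \<^bold>\<equiv> n"
  by (rule ent_defR[where ts = "[Free (0, Ti), Free (0, Ti)]" and B = "\<^bold>\<top>" and \<sigma> = "Free((0, Ti) := m)"])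
    (auto simp: clause_simps ent_topI intro: conv_sym)

text \<open>States monotonicity from the predecessor of \<open>i\<close> without naming it:
  \<open>=\<close> turns the equation into a formula, which remains meaningful under a unifier. Both
  arguments stand for the same number, written at its two depths.\<close>

abbreviation predF :: "tm \<Rightarrow> tm \<Rightarrow> tm" where
  "predF i i' \<equiv> All Tnt (patom P_eq [i, suc_tm (Bnd 0)] \<^bold>\<supset> simF (Bnd 2) i')"

lemma ent_predF:
  assumes "S ||- nat_fm i"
  shows "S ||- predF i i"
proof -
  have "S ||- inst (predF (Bnd (Suc 0)) (Bnd 3)) 0 i"
  proof (rule ent_nat_cases[OF assms])
    show "S ||- inst (predF (Bnd (Suc 0)) (Bnd 3)) 0 zero_tm" for S
      by (auto intro!: ent_allI ent_impI elim!: eq_defL)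
    fix S j assume j: "S ||- nat_fm j"
    have tj: "typed j Tnt" using ent_ty(1)[OF j] .
    have "S' ||- simF t (suc_tm j)" if "S \<sqsubseteq> S'" "S' ||- patom P_eq [suc_tm j, suc_tm t]"
      "typed t Tnt" for S' t
    proof -
      \<comment> \<open>The equation between successors is used through its unifiers, under which
        the two instances of \<open>simF\<close> are convertible.\<close>
      have "S' ||- simF j (suc_tm j) \<^bold>\<supset> simF t (suc_tm j)"
      proof (rule eq_defL[OF that(2)])
        show "fm (simF j (suc_tm j) \<^bold>\<supset> simF t (suc_tm j))" using tj that by simp
        fix S0 \<theta> assume \<theta>: "is_subst \<theta>" "subst \<theta> (suc_tm j) \<approx> subst \<theta> (suc_tm t)"
        have "simF (subst \<theta> j) (suc_tm (subst \<theta> j)) \<approx> simF (subst \<theta> t) (suc_tm (subst \<theta> j))"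
          using \<theta>(2) by (intro conv_app conv_lam patom_conv) auto
        then have "S0 ||- simF (subst \<theta> j) (suc_tm (subst \<theta> j)) \<^bold>\<supset> simF (subst \<theta> t) (suc_tm (subst \<theta> j))"
          using \<theta> tj that(3) by (intro ent_impI) (auto elim!: ent_conv)
        then show "S0 ||- subst \<theta> (simF j (suc_tm j) \<^bold>\<supset> simF t (suc_tm j))" by simp
      qed
      moreover have "S' ||- simF j (suc_tm j)"
        using tj ent_mono[OF j that(1)] by (auto simp: ent_simF seq_le_def intro: seq_mono ent_mono)
      ultimately show ?thesis by (rule ent_mp)
    qed
    then show "S ||- inst (predF (Bnd (Suc 0)) (Bnd 3)) 0 (suc_tm j)"
      using tj by (simp add: ent_all_iff[where T = Tnt] ent_imp_iff)
  qed auto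
  then show ?thesis using ent_ty(1)[OF assms] by simp
qed

text \<open>The premises come back at the height of the conclusion rather than one below, so that
  inversion does not mention predecessors. The predecessor \<open>j\<close> is known only after
  unification; \<open>predF i i\<close>, put in front of the goal, then yields \<open>seq\<close> at
  \<open>i\<close> from \<open>seq\<close> at \<open>j\<close>.\<close>

lemma seq_nat_defL:
  assumes i: "S ||- nat_fm i" and h: "S ||- seq_fm i l b" and C: "fm C"
    and element: "\<And>S \<theta> a. is_subst \<theta> \<Longrightarrow> subst \<theta> b \<approx> \<^bold>\<langle>a\<^bold>\<rangle> \<Longrightarrow>
      S ||- patom P_element [a, subst \<theta> l] \<Longrightarrow> S ||- subst \<theta> C"
    and tt: "\<And>S \<theta>. is_subst \<theta> \<Longrightarrow> subst \<theta> b \<approx> tt_tm \<Longrightarrow> S ||- subst \<theta> C"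
    and amp: "\<And>S \<theta> c d. is_subst \<theta> \<Longrightarrow> subst \<theta> b \<approx> c \<^bold>& d \<Longrightarrow>
      S ||- seq_fm (subst \<theta> i) (subst \<theta> l) c \<Longrightarrow> S ||- seq_fm (subst \<theta> i) (subst \<theta> l) d \<Longrightarrow> S ||- subst \<theta> C"
    and imp: "\<And>S \<theta> a c. is_subst \<theta> \<Longrightarrow> subst \<theta> b \<approx> a \<^bold>\<Rightarrow> c \<Longrightarrow>
      S ||- seq_fm (subst \<theta> i) (a \<^bold># subst \<theta> l) c \<Longrightarrow> S ||- subst \<theta> C"
    and all: "\<And>S \<theta> f. is_subst \<theta> \<Longrightarrow> subst \<theta> b \<approx> \<^bold>\<And> f \<Longrightarrow> typed f (Ti \<rightarrow>\<^sub>t Tprp) \<Longrightarrow>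
      (\<And>x. typed x Ti \<Longrightarrow> S ||- seq_fm (subst \<theta> i) (subst \<theta> l) (f \<cdot> x)) \<Longrightarrow> S ||- subst \<theta> C"
    and atom: "\<And>S \<theta> a g. is_subst \<theta> \<Longrightarrow> subst \<theta> b \<approx> \<^bold>\<langle>a\<^bold>\<rangle> \<Longrightarrow>
      S ||- prog_fm a g \<Longrightarrow> S ||- seq_fm (subst \<theta> i) (subst \<theta> l) g \<Longrightarrow> S ||- subst \<theta> C"
  shows "S ||- C"
proof -
  have ti: "typed i Tnt" using ent_ty(1)[OF i] .
  have "S ||- predF i i \<^bold>\<supset> C"
  proof (rule seq_defL[OF h])
    show "fm (predF i i \<^bold>\<supset> C)" using C ti by simp
    have *: "S0 ||- subst \<theta> (predF i i \<^bold>\<supset> C)" if \<theta>: "is_subst \<theta>" and j: "subst \<theta> i \<approx> suc_tm j" "typed j Tnt"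
      and g: "\<And>S'. S0 \<sqsubseteq> S' \<Longrightarrow>
        (\<And>l b. S' ||- seq_fm j l b \<Longrightarrow> S' ||- seq_fm (subst \<theta> i) l b) \<Longrightarrow> S' ||- subst \<theta> C" for S0 \<theta> j
    proof -
      have "S0 ||- predF (subst \<theta> i) (subst \<theta> i) \<^bold>\<supset> subst \<theta> C"
      proof (rule ent_impI)
        show "fm (predF (subst \<theta> i) (subst \<theta> i))" using \<theta> ti by simp
        fix S' assume S': "S0 \<sqsubseteq> S'" and p: "S' ||- predF (subst \<theta> i) (subst \<theta> i)"
        have "S' ||- simF j (subst \<theta> i)"
          using ent_all_mp[OF p j(2)] j \<theta> ti eqI[of "subst \<theta> i" "suc_tm j" S'] by simp
        then have "seq_le S' j (subst \<theta> i)" using j \<theta> ti by (simp add: ent_simF)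
        then show "S' ||- subst \<theta> C" by (intro g[OF S']) (auto simp: seq_le_def)
      qed
      then show ?thesis by simp
    qed
    have **: "S0 ||- subst \<theta> (predF i i \<^bold>\<supset> C)" if \<theta>: "is_subst \<theta>"
      and g: "\<And>S'. S0 \<sqsubseteq> S' \<Longrightarrow> S' ||- subst \<theta> C" for S0 \<theta>
    proof -
      have "S0 ||- predF (subst \<theta> i) (subst \<theta> i) \<^bold>\<supset> subst \<theta> C"
        by (rule ent_impI) (use \<theta> ti g in auto)
      then show ?thesis by simp
    qed
    show "S0 ||- subst \<theta> (predF i i \<^bold>\<supset> C)" if "is_subst \<theta>" "subst \<theta> b \<approx> \<^bold>\<langle>a\<^bold>\<rangle>"
      "S0 ||- patom P_element [a, subst \<theta> l]" for S0 \<theta> a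
      by (rule **[OF that(1)], rule element[OF that(1,2)], rule ent_mono[OF that(3)])
    show "S0 ||- subst \<theta> (predF i i \<^bold>\<supset> C)" if "is_subst \<theta>" "subst \<theta> b \<approx> tt_tm" for S0 \<theta>
      by (rule **[OF that(1)], rule tt[OF that])
    show "S0 ||- subst \<theta> (predF i i \<^bold>\<supset> C)" if "is_subst \<theta>" "subst \<theta> i \<approx> suc_tm j" "subst \<theta> b \<approx> c \<^bold>& d"
      "S0 ||- seq_fm j (subst \<theta> l) c" "S0 ||- seq_fm j (subst \<theta> l) d" for S0 \<theta> j c d
      by (rule *[OF that(1,2)], use ent_ty(2)[OF that(4)] in simp, rule amp[OF that(1,3)])
        (blast intro: ent_mono[OF that(4)] ent_mono[OF that(5)])+
    show "S0 ||- subst \<theta> (predF i i \<^bold>\<supset> C)" if "is_subst \<theta>" "subst \<theta> i \<approx> suc_tm j" "subst \<theta> b \<approx> a \<^bold>\<Rightarrow> c"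
      "S0 ||- seq_fm j (a \<^bold># subst \<theta> l) c" for S0 \<theta> j a c
      by (rule *[OF that(1,2)], use ent_ty(2)[OF that(4)] in simp, rule imp[OF that(1,3)])
        (blast intro: ent_mono[OF that(4)])
    show "S0 ||- subst \<theta> (predF i i \<^bold>\<supset> C)" if "is_subst \<theta>" "subst \<theta> i \<approx> suc_tm j" "subst \<theta> b \<approx> \<^bold>\<And> f"
      "typed j Tnt" "typed f (Ti \<rightarrow>\<^sub>t Tprp)"
      "\<And>x. typed x Ti \<Longrightarrow> S0 ||- seq_fm j (subst \<theta> l) (f \<cdot> x)" for S0 \<theta> j f
      by (rule *[OF that(1,2,4)], rule all[OF that(1,3,5)]) (blast intro: ent_mono[OF that(6)])
    show "S0 ||- subst \<theta> (predF i i \<^bold>\<supset> C)" if "is_subst \<theta>" "subst \<theta> i \<approx> suc_tm j" "subst \<theta> b \<approx> \<^bold>\<langle>a\<^bold>\<rangle>"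
      "S0 ||- prog_fm a g" "S0 ||- seq_fm j (subst \<theta> l) g" for S0 \<theta> j a g
      by (rule *[OF that(1,2)], use ent_ty(2)[OF that(5)] in simp, rule atom[OF that(1,3)])
        (blast intro: ent_mono[OF that(4)] ent_mono[OF that(5)])+
  qed
  then show ?thesis by (rule ent_mp[OF _ ent_predF[OF i]])
qed

lemma seq_ampE:
  assumes i: "S ||- nat_fm i" and h: "S ||- seq_fm i l (b \<^bold>& c)"
  shows "S ||- seq_fm i l b" "S ||- seq_fm i l c"
proof -
  have ty: "typed i Tnt" "typed l Tlst" "typed b Tprp" "typed c Tprp"
    using ent_ty(2)[OF h] by auto
  have "S ||- seq_fm i l b \<^bold>\<and> seq_fm i l c"
    by (rule seq_nat_defL[OF i h]) (use ty in \<open>auto elim: seq_conv intro: conv_sym\<close>)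
  then show "S ||- seq_fm i l b" "S ||- seq_fm i l c" by auto
qed

lemma seq_impE:
  assumes i: "S ||- nat_fm i" and h: "S ||- seq_fm i l (a \<^bold>\<Rightarrow> b)"
  shows "S ||- seq_fm i (a \<^bold># l) b"
proof -
  have ty: "typed i Tnt" "typed l Tlst" "typed a Tatm" "typed b Tprp"
    using ent_ty(2)[OF h] by auto
  show ?thesis
    by (rule seq_nat_defL[OF i h]) (use ty in \<open>auto elim!: seq_conv intro: conv_sym\<close>)
qed

lemma seq_allE:
  assumes i: "S ||- nat_fm i" and h: "S ||- seq_fm i l (\<^bold>\<And> f)" and x: "typed x Ti"
  shows "S ||- seq_fm i l (f \<cdot> x)"
proof -
  have ty: "typed i Tnt" "typed l Tlst" "typed f (Ti \<rightarrow>\<^sub>t Tprp)"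
    using ent_ty(2)[OF h] by auto
  show ?thesis
  proof (rule seq_nat_defL[OF i h])
    show "S ||- subst \<theta> (seq_fm i l (f \<cdot> x))" if "is_subst \<theta>" "subst \<theta> (\<^bold>\<And> f) \<approx> \<^bold>\<And> f'"
      "\<And>x. typed x Ti \<Longrightarrow> S ||- seq_fm (subst \<theta> i) (subst \<theta> l) (f' \<cdot> x)" for S \<theta> f'
    proof -
      have "f' \<cdot> subst \<theta> x \<approx> subst \<theta> f \<cdot> subst \<theta> x" using that(2) by (auto intro: conv_app conv_sym)
      then show ?thesis using seq_conv[OF that(3)[of "subst \<theta> x"]] that(1) ty x by simp
    qed
  qed (use ty x in auto)
qed

lemma element_nilE:
  assumes "S ||- patom P_element [x, nil_tm]" "fm C"
  shows "S ||- C"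
proof -
  \<comment> \<open>The goal bottom is fixed by every substitution, so it survives the case analysis
    unchanged.\<close>
  have "S ||- \<^bold>\<bottom>" by (rule element_defL[OF assms(1)]) auto
  then show ?thesis using assms(2) by (rule ent_botE)
qed

text \<open>An empty context rules out the initial clause, so an atom is proved by backchaining. The
  clause body is first collected in the formula \<open>?D\<close>, on which the unifier can act, and
  then opened.\<close>

lemma seq_atomE:
  assumes i: "S ||- nat_fm i" and h: "S ||- seq_fm i nil_tm \<^bold>\<langle>a\<^bold>\<rangle>"
    and C: "\<And>S' g. S \<sqsubseteq> S' \<Longrightarrow> S' ||- prog_fm a g \<Longrightarrow> S' ||- seq_fm i nil_tm g \<Longrightarrow> S' ||- C"
  shows "S ||- C"
proof -
  have ty: "typed i Tnt" "typed a Tatm" using ent_ty(2)[OF h] by auto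
  let ?D = "Ex Tprp (prog_fm a (Bnd 0) \<^bold>\<and> seq_fm i nil_tm (Bnd 0))"
  have "S ||- ?D"
  proof (rule seq_nat_defL[OF i h])
    show "S ||- subst \<theta> ?D" if "is_subst \<theta>" "S ||- patom P_element [a', subst \<theta> nil_tm]" for S \<theta> a'
      by (rule element_nilE) (use that ty in auto)
    show "S ||- subst \<theta> ?D" if "is_subst \<theta>" "subst \<theta> \<^bold>\<langle>a\<^bold>\<rangle> \<approx> \<^bold>\<langle>a'\<^bold>\<rangle>"
      "S ||- prog_fm a' g" "S ||- seq_fm (subst \<theta> i) (subst \<theta> nil_tm) g" for S \<theta> a' g
    proof -
      have "S ||- prog_fm (subst \<theta> a) g" using ent_ty(4)[OF that(3)] that(1,2) ty
        by (auto intro!: ent_conv_atom[OF that(3)] intro: conv_sym)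
      then show ?thesis using that ty ent_ty(4)[OF that(3)] by (auto intro!: ent_exI[where t = g])
    qed
  qed (use ty in auto)
  then show ?thesis
  proof (rule ent_exE)
    fix S' g assume "S \<sqsubseteq> S'" "typed g Tprp"
      "S' ||- inst (prog_fm a (Bnd 0) \<^bold>\<and> seq_fm i nil_tm (Bnd 0)) 0 g"
    then show "S' ||- C" using ty by (intro C[of S' g]) auto
  qed
qed

lemma seq_zero_atomE:
  assumes h: "S ||- seq_fm zero_tm nil_tm \<^bold>\<langle>a\<^bold>\<rangle>" and "fm C"
  shows "S ||- C"
proof -
  have "S ||- \<^bold>\<bottom>" by (rule seq_defL[OF h]) (auto elim: element_nilE)
  then show ?thesis using assms(2) by (rule ent_botE)
qed

text \<open>In contrast to \<open>seq_atomE\<close> the body is obtained at the smaller height, as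
  induction on the height requires.\<close>

lemma seq_suc_atomE:
  assumes h: "S ||- seq_fm (suc_tm i) nil_tm \<^bold>\<langle>a\<^bold>\<rangle>"
    and C: "\<And>S' g. S \<sqsubseteq> S' \<Longrightarrow> S' ||- prog_fm a g \<Longrightarrow> S' ||- seq_fm i nil_tm g \<Longrightarrow> S' ||- C"
  shows "S ||- C"
proof -
  have ty: "typed i Tnt" "typed a Tatm" using ent_ty(2)[OF h] by auto
  let ?D = "Ex Tprp (prog_fm a (Bnd 0) \<^bold>\<and> seq_fm i nil_tm (Bnd 0))"
  have "S ||- ?D"
  proof (rule seq_defL[OF h])
    show "S ||- subst \<theta> ?D" if "is_subst \<theta>" "S ||- patom P_element [a', subst \<theta> nil_tm]" for S \<theta> a'
      by (rule element_nilE) (use that ty in auto)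
    show "S ||- subst \<theta> ?D" if "is_subst \<theta>" "subst \<theta> (suc_tm i) \<approx> suc_tm j" "subst \<theta> \<^bold>\<langle>a\<^bold>\<rangle> \<approx> \<^bold>\<langle>a'\<^bold>\<rangle>"
      "S ||- prog_fm a' g" "S ||- seq_fm j (subst \<theta> nil_tm) g" for S \<theta> j a' g
    proof -
      have g: "typed g Tprp" using ent_ty(4)[OF that(4)] by simp
      have "S ||- prog_fm (subst \<theta> a) g" using that(1,3) ty g
        by (auto intro!: ent_conv_atom[OF that(4)] intro: conv_sym)
      moreover have "S ||- seq_fm (subst \<theta> i) nil_tm g" using that(1,2) ty g
        by (auto intro!: seq_conv[OF that(5)] intro: conv_sym)
      ultimately show ?thesis using that(1) ty g by (auto intro!: ent_exI[where t = g])
    qed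
  qed (use ty in auto)
  then show ?thesis
  proof (rule ent_exE)
    fix S' g assume "S \<sqsubseteq> S'" "typed g Tprp"
      "S' ||- inst (prog_fm a (Bnd 0) \<^bold>\<and> seq_fm i nil_tm (Bnd 0)) 0 g"
    then show "S' ||- C" using ty by (intro C[of S' g]) auto
  qed
qed

section \<open>Provability of object-level judgements\<close>

lemma has_type_lift:
  "has_type (\<Delta> @ T # \<Delta>') (lift t (length \<Delta>)) U \<longleftrightarrow> has_type (\<Delta> @ \<Delta>') t U"
proof (induction t arbitrary: \<Delta> U)
  case (Bnd i)
  then show ?case by (auto simp: nth_append Suc_diff_le)
next
  case (App t u)
  then show ?case by (simp add: has_type_simps(4))
next
  case (Lam t)
  then show ?case using Lam[of "_ # \<Delta>"] by simp
qed auto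

lemma has_type_lift0 [simp]: "has_type (T # \<Delta>) (lift t 0) U \<longleftrightarrow> has_type \<Delta> t U"
  using has_type_lift[of "[]"] by simp

lemma bind_lift: "i \<le> k \<Longrightarrow> bind v (Suc k) (lift t i) = lift (bind v k t) i"
  by (induction t arbitrary: i k) auto

lemma has_type_provable [simp]: "has_type \<Delta> (provable b) T \<longleftrightarrow> T = To \<and> has_type \<Delta> b Tprp"
  by (auto simp: provable_def)

lemma inst_provable [simp]: "inst (provable b) k s = provable (inst b k s)"
  by (simp add: provable_def inst_lift_le)

lemma bind_provable [simp]: "bind v k (provable b) = provable (bind v k b)"
  by (simp add: provable_def bind_lift)

lemma fv_lift [simp]: "fv (lift t k) = fv t"
  by (induction t arbitrary: k) auto

lemma fv_provable [simp]: "fv (provable b) = fv b"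
  by (simp add: provable_def)

lemma subst_provable [simp]:
  "is_subst \<theta> \<Longrightarrow> typed b Tprp \<Longrightarrow> subst \<theta> (provable b) = provable (subst \<theta> b)"
  by (simp add: provable_def)

lemma fm_provable [simp]: "fm (provable b) \<longleftrightarrow> typed b Tprp"
proof
  assume "fm (provable b)"
  from fm_typed[OF this] show "typed b Tprp" by simp
qed (simp add: provable_def)

lemma provable_conv:
  "typed b Tprp \<Longrightarrow> typed c Tprp \<Longrightarrow> b \<approx> c \<Longrightarrow> provable b \<approx> provable c"
  by (auto simp: provable_def intro!: conv_app conv_lam)

lemma ent_ty_prov: "S ||- provable b \<Longrightarrow> typed b Tprp"
  by (drule ent_fm) simp

lemma provI: "S ||- nat_fm i \<Longrightarrow> S ||- seq_fm i nil_tm b \<Longrightarrow> S ||- provable b"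
  unfolding provable_def using ent_ty(1)[of S i] ent_ty(2)[of S i nil_tm b]
  by (intro ent_exI[where t = i]) auto

lemma provE:
  assumes "S ||- provable b"
    and C: "\<And>S' i. S \<sqsubseteq> S' \<Longrightarrow> S' ||- nat_fm i \<Longrightarrow> S' ||- seq_fm i nil_tm b \<Longrightarrow> S' ||- C"
  shows "S ||- C"
  using assms(1)[unfolded provable_def]
proof (rule ent_exE)
  fix S' i assume "S \<sqsubseteq> S'" "typed i Tnt"
    "S' ||- inst (nat_fm (Bnd 0) \<^bold>\<and> seq_fm (Bnd 0) nil_tm (lift b 0)) 0 i"
  then show "S' ||- C" using ent_ty_prov[OF assms(1)] by (intro C[of S' i]) auto
qed

lemma prov_atom_tt: "S ||- prog_fm a tt_tm \<Longrightarrow> S ||- provable \<^bold>\<langle>a\<^bold>\<rangle>"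
  by (rule provI[OF ent_nat_suc[OF ent_nat_zero] seq_atomI]) (auto intro: seq_ttI)

lemma prov_atom_one: "S ||- prog_fm a g \<Longrightarrow> S ||- provable g \<Longrightarrow> S ||- provable \<^bold>\<langle>a\<^bold>\<rangle>"
  by (erule provE) (auto intro: provI[OF ent_nat_suc seq_atomI] ent_mono)

lemma prov_amp:
  assumes "S ||- provable b" "S ||- provable c"
  shows "S ||- provable (b \<^bold>& c)"
  using assms(1)
proof (rule provE)
  fix S1 i assume 1: "S \<sqsubseteq> S1" "S1 ||- nat_fm i" "S1 ||- seq_fm i nil_tm b"
  from ent_mono[OF assms(2) 1(1)] show "S1 ||- provable (b \<^bold>& c)"
  proof (rule provE)
    fix S2 j assume 2: "S1 \<sqsubseteq> S2" "S2 ||- nat_fm j" "S2 ||- seq_fm j nil_tm c"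
    \<comment> \<open>The clause for \<open>&\<close> demands one height for both conjuncts.\<close>
    show "S2 ||- provable (b \<^bold>& c)"
      by (rule seq_maxE[OF ent_mono[OF 1(2) 2(1)] ent_mono[OF 1(3) 2(1)] 2(2,3)])
        (auto intro: provI[OF ent_nat_suc seq_ampI])
  qed
qed

section \<open>Clauses of the lambda calculus as derived rules\<close>

lemma prog_eval_abs: "typed r Tii \<Longrightarrow> S ||- prog_fm (abs_tm r \<^bold>\<Down> abs_tm r) tt_tm"
  by (rule ent_defR[where ts = "[abs_tm (Free (0, Tii)) \<^bold>\<Down> abs_tm (Free (0, Tii)), tt_tm]"
        and B = "\<^bold>\<top>" and \<sigma> = "Free((0, Tii) := r)"])
    (auto simp: clause_simps ent_topI)

lemma prog_eval_app:
  "typed m Ti \<Longrightarrow> typed n Ti \<Longrightarrow> typed v Ti \<Longrightarrow> typed r Tii \<Longrightarrow>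
    S ||- prog_fm (app_tm m n \<^bold>\<Down> v) (\<^bold>\<langle>m \<^bold>\<Down> abs_tm r\<^bold>\<rangle> \<^bold>& \<^bold>\<langle>(r \<cdot> n) \<^bold>\<Down> v\<^bold>\<rangle>)"
  by (rule ent_defR[where ts = "[app_tm (Free (0, Ti)) (Free (1, Ti)) \<^bold>\<Down> Free (5, Ti),
          \<^bold>\<langle>Free (0, Ti) \<^bold>\<Down> abs_tm (Free (0, Tii))\<^bold>\<rangle> \<^bold>& \<^bold>\<langle>(Free (0, Tii) \<cdot> Free (1, Ti)) \<^bold>\<Down> Free (5, Ti)\<^bold>\<rangle>]"
        and B = "\<^bold>\<top>" and \<sigma> = "Free((0, Tii) := r, (0, Ti) := m, (1, Ti) := n, (5, Ti) := v)"])
    (auto simp: clause_simps ent_topI)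

lemma prog_red_beta:
  "typed r Tii \<Longrightarrow> typed m Ti \<Longrightarrow> S ||- prog_fm (app_tm (abs_tm r) m \<^bold>\<leadsto> (r \<cdot> m)) tt_tm"
  by (rule ent_defR[where ts = "[app_tm (abs_tm (Free (0, Tii))) (Free (0, Ti)) \<^bold>\<leadsto>
          (Free (0, Tii) \<cdot> Free (0, Ti)), tt_tm]"
        and B = "\<^bold>\<top>" and \<sigma> = "Free((0, Tii) := r, (0, Ti) := m)"])
    (auto simp: clause_simps ent_topI)

lemma prog_red_app:
  "typed m Ti \<Longrightarrow> typed n Ti \<Longrightarrow> typed m' Ti \<Longrightarrow>
    S ||- prog_fm (app_tm m n \<^bold>\<leadsto> app_tm m' n) \<^bold>\<langle>m \<^bold>\<leadsto> m'\<^bold>\<rangle>"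
  by (rule ent_defR[where ts = "[app_tm (Free (0, Ti)) (Free (1, Ti)) \<^bold>\<leadsto>
          app_tm (Free (2, Ti)) (Free (1, Ti)), \<^bold>\<langle>Free (0, Ti) \<^bold>\<leadsto> Free (2, Ti)\<^bold>\<rangle>]"
        and B = "\<^bold>\<top>" and \<sigma> = "Free((0, Ti) := m, (1, Ti) := n, (2, Ti) := m')"])
    (auto simp: clause_simps ent_topI)

lemma prog_reds_refl: "typed m Ti \<Longrightarrow> S ||- prog_fm (m \<^bold>\<leadsto>\<^sup>* m) tt_tm"
  by (rule ent_defR[where ts = "[Free (0, Ti) \<^bold>\<leadsto>\<^sup>* Free (0, Ti), tt_tm]"
        and B = "\<^bold>\<top>" and \<sigma> = "Free((0, Ti) := m)"])
    (auto simp: clause_simps ent_topI)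

lemma prog_reds_step:
  "typed m Ti \<Longrightarrow> typed n Ti \<Longrightarrow> typed m' Ti \<Longrightarrow>
    S ||- prog_fm (m \<^bold>\<leadsto>\<^sup>* n) (\<^bold>\<langle>m \<^bold>\<leadsto> m'\<^bold>\<rangle> \<^bold>& \<^bold>\<langle>m' \<^bold>\<leadsto>\<^sup>* n\<^bold>\<rangle>)"
  by (rule ent_defR[where ts = "[Free (0, Ti) \<^bold>\<leadsto>\<^sup>* Free (1, Ti),
          \<^bold>\<langle>Free (0, Ti) \<^bold>\<leadsto> Free (2, Ti)\<^bold>\<rangle> \<^bold>& \<^bold>\<langle>Free (2, Ti) \<^bold>\<leadsto>\<^sup>* Free (1, Ti)\<^bold>\<rangle>]"
        and B = "\<^bold>\<top>" and \<sigma> = "Free((0, Ti) := m, (1, Ti) := n, (2, Ti) := m')"])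
    (auto simp: clause_simps ent_topI)

lemma prog_typeof_app:
  "typed m Ti \<Longrightarrow> typed n Ti \<Longrightarrow> typed t Ti \<Longrightarrow> typed u Ti \<Longrightarrow>
    S ||- prog_fm (typeof_tm (app_tm m n) t) (\<^bold>\<langle>typeof_tm m (arr_tm u t)\<^bold>\<rangle> \<^bold>& \<^bold>\<langle>typeof_tm n u\<^bold>\<rangle>)"
  by (rule ent_defR[where ts = "[typeof_tm (app_tm (Free (0, Ti)) (Free (1, Ti))) (Free (3, Ti)),
          \<^bold>\<langle>typeof_tm (Free (0, Ti)) (arr_tm (Free (4, Ti)) (Free (3, Ti)))\<^bold>\<rangle> \<^bold>& \<^bold>\<langle>typeof_tm (Free (1, Ti)) (Free (4, Ti))\<^bold>\<rangle>]"
        and B = "\<^bold>\<top>" and \<sigma> = "Free((0, Ti) := m, (1, Ti) := n, (3, Ti) := t, (4, Ti) := u)"])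
    (auto simp: clause_simps ent_topI)

lemma ent_ty_atom [dest]:
  "S ||- provable \<^bold>\<langle>m \<^bold>\<Down> v\<^bold>\<rangle> \<Longrightarrow> typed m Ti \<and> typed v Ti"
  "S ||- provable \<^bold>\<langle>m \<^bold>\<leadsto> v\<^bold>\<rangle> \<Longrightarrow> typed m Ti \<and> typed v Ti"
  "S ||- provable \<^bold>\<langle>m \<^bold>\<leadsto>\<^sup>* v\<^bold>\<rangle> \<Longrightarrow> typed m Ti \<and> typed v Ti"
  "S ||- provable \<^bold>\<langle>typeof_tm m v\<^bold>\<rangle> \<Longrightarrow> typed m Ti \<and> typed v Ti"
  by (auto dest: ent_ty_prov)

lemma eval_abs: "typed r Tii \<Longrightarrow> S ||- provable \<^bold>\<langle>abs_tm r \<^bold>\<Down> abs_tm r\<^bold>\<rangle>"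
  by (rule prov_atom_tt[OF prog_eval_abs])

lemma eval_app:
  assumes "S ||- provable \<^bold>\<langle>m \<^bold>\<Down> abs_tm r\<^bold>\<rangle>" "S ||- provable \<^bold>\<langle>(r \<cdot> n) \<^bold>\<Down> v\<^bold>\<rangle>" "typed n Ti"
  shows "S ||- provable \<^bold>\<langle>app_tm m n \<^bold>\<Down> v\<^bold>\<rangle>"
  using assms ent_ty_atom(1)[OF assms(1)] ent_ty_atom(1)[OF assms(2)]
  by (auto intro!: prov_atom_one[OF prog_eval_app[where r = r]] prov_amp)

lemma red_beta:
  "typed r Tii \<Longrightarrow> typed m Ti \<Longrightarrow> S ||- provable \<^bold>\<langle>app_tm (abs_tm r) m \<^bold>\<leadsto> (r \<cdot> m)\<^bold>\<rangle>"
  by (rule prov_atom_tt[OF prog_red_beta])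

lemma red_app:
  assumes "S ||- provable \<^bold>\<langle>m \<^bold>\<leadsto> m'\<^bold>\<rangle>" "typed n Ti"
  shows "S ||- provable \<^bold>\<langle>app_tm m n \<^bold>\<leadsto> app_tm m' n\<^bold>\<rangle>"
  using assms ent_ty_atom(2)[OF assms(1)] by (auto intro!: prov_atom_one[OF prog_red_app])

lemma reds_refl: "typed m Ti \<Longrightarrow> S ||- provable \<^bold>\<langle>m \<^bold>\<leadsto>\<^sup>* m\<^bold>\<rangle>"
  by (rule prov_atom_tt[OF prog_reds_refl])

lemma reds_step:
  assumes "S ||- provable \<^bold>\<langle>m \<^bold>\<leadsto> m'\<^bold>\<rangle>" "S ||- provable \<^bold>\<langle>m' \<^bold>\<leadsto>\<^sup>* n\<^bold>\<rangle>"
  shows "S ||- provable \<^bold>\<langle>m \<^bold>\<leadsto>\<^sup>* n\<^bold>\<rangle>"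
  using assms ent_ty_atom(2)[OF assms(1)] ent_ty_atom(3)[OF assms(2)]
  by (auto intro!: prov_atom_one[OF prog_reds_step[where m' = m']] prov_amp)

lemma typeof_app:
  assumes "S ||- provable \<^bold>\<langle>typeof_tm m (arr_tm u t)\<^bold>\<rangle>" "S ||- provable \<^bold>\<langle>typeof_tm n u\<^bold>\<rangle>"
  shows "S ||- provable \<^bold>\<langle>typeof_tm (app_tm m n) t\<^bold>\<rangle>"
  using assms ent_ty_atom(4)[OF assms(1)] ent_ty_atom(4)[OF assms(2)]
  by (auto intro!: prov_atom_one[OF prog_typeof_app[where u = u]] prov_amp)

section \<open>Rule induction for binary judgements\<close>

text \<open>In \<open>app2 p m v\<close>, \<open>m\<close> replaces \<open>Bnd 1\<close> and \<open>v\<close> replaces \<open>Bnd 0\<close>.\<close>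

abbreviation app2 :: "tm \<Rightarrow> tm \<Rightarrow> tm \<Rightarrow> tm" where
  "app2 p m v \<equiv> inst (inst p (Suc 0) m) 0 v"

text \<open>\<open>fv p = {}\<close> makes \<open>p\<close> invariant under unifiers, so that it
  stays the same in every case of an induction; its parameters are quantified inside
  \<open>p\<close>.\<close>

definition pred2 :: "tm \<Rightarrow> bool" where
  "pred2 p \<longleftrightarrow> has_type [Ti, Ti] p To \<and> fv p = {} \<and>
    (\<forall>m v. typed m Ti \<longrightarrow> typed v Ti \<longrightarrow> fm (app2 p m v))"

lemma app2_conv:
  assumes "S ||- app2 p m' v'" "pred2 p" "m \<approx> m'" "v \<approx> v'" "typed m Ti" "typed v Ti"
    "typed m' Ti" "typed v' Ti"
  shows "S ||- app2 p m v"
proof -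
  have e: "Lam (Lam p) \<cdot> x \<cdot> y \<approx> app2 p x y" if "typed x Ti" for x y
  proof -
    have "Lam (Lam p) \<cdot> x \<approx> Lam (inst p (Suc 0) x)" using conv_beta[of "Lam p" x] that by simp
    then have "Lam (Lam p) \<cdot> x \<cdot> y \<approx> Lam (inst p (Suc 0) x) \<cdot> y" by (intro conv_app) auto
    then show ?thesis using conv_beta conv_trans by blast
  qed
  have "Lam (Lam p) \<cdot> m' \<cdot> v' \<approx> Lam (Lam p) \<cdot> m \<cdot> v"
    using assms(3,4) by (intro conv_app) (auto intro: conv_sym)
  then have "app2 p m' v' \<approx> app2 p m v" using e assms(5,7) by (meson conv_sym conv_trans)
  with assms(1) show ?thesis by (rule ent_conv) (use assms in \<open>auto simp: pred2_def\<close>)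
qed

text \<open>Induction on the height of the derivation, common to the binary judgements. It stops at
  \<open>prog\<close>: \<open>step\<close> receives a unified clause, its body at height
  \<open>i\<close>, and the claim for every derivation of height \<open>i\<close> of the same
  judgement.\<close>

lemma atom_induct:
  assumes c: "fsym_type c = Ti \<rightarrow>\<^sub>t Ti \<rightarrow>\<^sub>t Tatm" and p: "pred2 p"
    and h: "S ||- provable \<^bold>\<langle>Cst (Fn c) \<cdot> m \<cdot> v\<^bold>\<rangle>"
    and step: "\<And>S i m v g ts \<sigma>. (P_prog, ts, \<^bold>\<top>) \<in> D_all \<Longrightarrow> is_subst \<sigma> \<Longrightarrow>
      patom P_prog [Cst (Fn c) \<cdot> m \<cdot> v, g] \<approx> patom P_prog (map (subst \<sigma>) ts) \<Longrightarrow>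
      typed m Ti \<Longrightarrow> typed v Ti \<Longrightarrow> S ||- nat_fm i \<Longrightarrow> S ||- seq_fm i nil_tm g \<Longrightarrow>
      (\<And>S' m v. S \<sqsubseteq> S' \<Longrightarrow> S' ||- seq_fm i nil_tm \<^bold>\<langle>Cst (Fn c) \<cdot> m \<cdot> v\<^bold>\<rangle> \<Longrightarrow> S' ||- app2 p m v) \<Longrightarrow>
      S ||- app2 p m v"
  shows "S ||- app2 p m v"
proof -
  let ?Q = "\<lambda>i. All Ti (All Ti
    (seq_fm i nil_tm \<^bold>\<langle>Cst (Fn c) \<cdot> Bnd (Suc 0) \<cdot> Bnd 0\<^bold>\<rangle> \<^bold>\<supset> p))"
  have tp: "has_type [Ti, Ti] p To" and fp: "\<And>\<theta>. subst \<theta> p = p"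
    and fmp: "\<And>m v. typed m Ti \<Longrightarrow> typed v Ti \<Longrightarrow> fm (app2 p m v)"
    using p by (auto simp: pred2_def intro: subst_closed)
  \<comment> \<open>Only indices 0 and 1 are loose in \<open>p\<close>, so the height substituted at
    index 2 leaves it alone.\<close>
  have p2: "inst p (Suc (Suc 0)) s = p" for s using inst_typed[OF tp] by simp
  have tp1: "has_type [Ti] (inst p (Suc 0) m) To" if "typed m Ti" for m
    using has_type_inst[OF that tp, of "[Ti]" "[]"] by simp
  have fmQ: "fm (?Q i)" if "typed i Tnt" for i using that tp tp1 c fmp by simp
  have Q: "S ||- ?Q i \<longleftrightarrow> (\<forall>S' m v. S \<sqsubseteq> S' \<longrightarrow>
      S' ||- seq_fm i nil_tm \<^bold>\<langle>Cst (Fn c) \<cdot> m \<cdot> v\<^bold>\<rangle> \<longrightarrow> S' ||- app2 p m v)" if i: "typed i Tnt" for S i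
  proof -
    have "S ||- ?Q i \<longleftrightarrow> (\<forall>m v. typed m Ti \<longrightarrow> typed v Ti \<longrightarrow> (\<forall>S'. S \<sqsubseteq> S' \<longrightarrow>
      S' ||- seq_fm i nil_tm \<^bold>\<langle>Cst (Fn c) \<cdot> m \<cdot> v\<^bold>\<rangle> \<longrightarrow> S' ||- app2 p m v))"
      using i tp c fmp by (simp add: ent_all2_iff ent_imp_iff)
    moreover have "typed m Ti \<and> typed v Ti"
      if "S' ||- seq_fm i nil_tm \<^bold>\<langle>Cst (Fn c) \<cdot> m \<cdot> v\<^bold>\<rangle>" for S' m v
      using ent_ty(2)[OF that] c by auto
    ultimately show ?thesis by blast
  qed
  have prog: "S ||- app2 p m v" if pr: "S ||- prog_fm (Cst (Fn c) \<cdot> m \<cdot> v) g" and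
    g: "S ||- seq_fm i nil_tm g" and i: "S ||- nat_fm i" and q: "S ||- ?Q i" for S i m v g
  proof -
    have ty: "typed m Ti" "typed v Ti" "typed g Tprp" "typed i Tnt"
      using ent_ty(4)[OF pr] ent_ty(1)[OF i] c by auto
    \<comment> \<open>The induction hypothesis \<open>?Q i\<close> enters the goal, to be
      instantiated along with it, while \<open>p\<close> itself is closed.\<close>
    let ?C = "seq_fm i nil_tm g \<^bold>\<supset> nat_fm i \<^bold>\<supset> ?Q i \<^bold>\<supset> app2 p m v"
    have "S ||- ?C"
    proof (rule ent_defL[OF pr])
      show "fm ?C" using ty fmp fmQ[OF ty(4)] by (simp del: fm_simps(6))
      fix S0 ts B \<theta> \<sigma>
      assume cl: "(P_prog, ts, B) \<in> D_all" and \<theta>: "is_subst \<theta>" and \<sigma>: "is_subst \<sigma>"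
        and u: "patom P_prog (map (subst \<theta>) [Cst (Fn c) \<cdot> m \<cdot> v, g]) \<approx> patom P_prog (map (subst \<sigma>) ts)"
      have B: "B = \<^bold>\<top>" using cl by (auto simp: clause_simps)
      let ?i = "subst \<theta> i" and ?m = "subst \<theta> m" and ?v = "subst \<theta> v"
      have t\<theta>: "typed ?i Tnt" "typed ?m Ti" "typed ?v Ti" "typed (subst \<theta> g) Tprp"
        using ty \<theta> by auto
      have "S0 ||- seq_fm ?i nil_tm (subst \<theta> g) \<^bold>\<supset> nat_fm ?i \<^bold>\<supset> ?Q ?i \<^bold>\<supset> app2 p ?m ?v"
      proof (rule ent_imp3I)
        fix S' assume a: "S' ||- seq_fm ?i nil_tm (subst \<theta> g)" "S' ||- nat_fm ?i" "S' ||- ?Q ?i"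
        show "S' ||- app2 p ?m ?v"
          by (rule step[OF cl[unfolded B] \<sigma> _ t\<theta>(2,3) a(2,1)]) (use u a(3) Q[OF t\<theta>(1)] in auto)
      qed (use t\<theta> fmQ in auto)
      moreover have "subst \<theta> (app2 p m v) = app2 p ?m ?v"
        using subst_inst[OF \<theta> ty(2) tp1[OF ty(1)]] subst_inst[OF \<theta> ty(1) tp] fp by simp
      ultimately show "S0 ||- subst \<theta> ?C" using fp by simp
    qed simp
    then show ?thesis using g i q by (blast intro: ent_mp)
  qed
  from h show ?thesis
  proof (rule provE)
    fix S' i assume S': "S \<sqsubseteq> S'" and i: "S' ||- nat_fm i"
      and a: "S' ||- seq_fm i nil_tm \<^bold>\<langle>Cst (Fn c) \<cdot> m \<cdot> v\<^bold>\<rangle>"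
    \<comment> \<open>\<open>nat\<close> is carried along because \<open>step\<close> expects it at
      the smaller height.\<close>
    have "S' ||- inst (nat_fm (Bnd 0) \<^bold>\<and> ?Q (Bnd 2)) 0 i"
    proof (rule ent_nat_induct[OF i])
      show "has_type [Tnt] (nat_fm (Bnd 0) \<^bold>\<and> ?Q (Bnd 2)) To"
        using has_type_append[OF tp, of "[Tnt]"] c by simp
      show "S ||- inst (nat_fm (Bnd 0) \<^bold>\<and> ?Q (Bnd 2)) 0 zero_tm" for S
      proof -
        have "S ||- ?Q zero_tm" unfolding Q[of zero_tm, simplified]
        proof (intro allI impI)
          fix S' m v assume z: "S' ||- seq_fm zero_tm nil_tm \<^bold>\<langle>Cst (Fn c) \<cdot> m \<cdot> v\<^bold>\<rangle>"
          show "S' ||- app2 p m v"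
            by (rule seq_zero_atomE[OF z]) (use ent_ty(2)[OF z] c fmp in auto)
        qed
        then show ?thesis by (simp add: p2 ent_nat_zero)
      qed
      show "S ||- inst (nat_fm (Bnd 0) \<^bold>\<and> ?Q (Bnd 2)) 0 (suc_tm j)"
        if j: "typed j Tnt" "S ||- inst (nat_fm (Bnd 0) \<^bold>\<and> ?Q (Bnd 2)) 0 j" for S j
      proof -
        have jj: "S ||- nat_fm j" "S ||- ?Q j" using j by (auto simp: p2)
        have sj: "typed (suc_tm j) Tnt" using j by simp
        have "S ||- ?Q (suc_tm j)" unfolding Q[OF sj]
        proof (intro allI impI)
          fix S' m v assume S': "S \<sqsubseteq> S'"
            and z: "S' ||- seq_fm (suc_tm j) nil_tm \<^bold>\<langle>Cst (Fn c) \<cdot> m \<cdot> v\<^bold>\<rangle>"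
          show "S' ||- app2 p m v"
          proof (rule seq_suc_atomE[OF z])
            fix S2 g assume "S' \<sqsubseteq> S2" "S2 ||- prog_fm (Cst (Fn c) \<cdot> m \<cdot> v) g" "S2 ||- seq_fm j nil_tm g"
            then show "S2 ||- app2 p m v"
              using S' by (intro prog[of S2 m v g j]) (auto intro: ent_mono[OF jj(1)] ent_mono[OF jj(2)])
          qed
        qed
        then show ?thesis using jj j by (simp add: p2 ent_nat_suc)
      qed
      show "fm (inst (nat_fm (Bnd 0) \<^bold>\<and> ?Q (Bnd 2)) 0 t)" if "typed t Tnt" for t
        using fmQ[OF that] that by (simp add: p2 del: fm_simps(6))
    qed
    then have "S' ||- ?Q i" using ent_ty(1)[OF i] by (simp add: p2)
    then show "S' ||- app2 p m v" using Q[OF ent_ty(1)[OF i]] a by blast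
  qed
qed

lemma seq_conv_goal:
  "S ||- seq_fm i nil_tm g \<Longrightarrow> g \<approx> b \<Longrightarrow> typed b Tprp \<Longrightarrow> S ||- seq_fm i nil_tm b"
  by (frule ent_ty(2), erule seq_conv) auto

lemma eval_induct:
  assumes p: "pred2 p" and h: "S ||- provable \<^bold>\<langle>m \<^bold>\<Down> v\<^bold>\<rangle>"
    and abs: "\<And>S r. typed r Tii \<Longrightarrow> S ||- app2 p (abs_tm r) (abs_tm r)"
    and app: "\<And>S m n r v. typed n Ti \<Longrightarrow> S ||- provable \<^bold>\<langle>m \<^bold>\<Down> abs_tm r\<^bold>\<rangle> \<Longrightarrow> S ||- app2 p m (abs_tm r) \<Longrightarrow>
      S ||- provable \<^bold>\<langle>(r \<cdot> n) \<^bold>\<Down> v\<^bold>\<rangle> \<Longrightarrow> S ||- app2 p (r \<cdot> n) v \<Longrightarrow> S ||- app2 p (app_tm m n) v"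
  shows "S ||- app2 p m v"
proof (rule atom_induct[OF _ p h])
  fix S i m v g ts \<sigma>
  assume cl: "(P_prog, ts, \<^bold>\<top>) \<in> D_all" and \<sigma>: "is_subst \<sigma>"
    and u: "patom P_prog [m \<^bold>\<Down> v, g] \<approx> patom P_prog (map (subst \<sigma>) ts)"
    and ty: "typed m Ti" "typed v Ti" and i: "S ||- nat_fm i" and g: "S ||- seq_fm i nil_tm g"
    and IH: "\<And>S' m v. S \<sqsubseteq> S' \<Longrightarrow> S' ||- seq_fm i nil_tm \<^bold>\<langle>m \<^bold>\<Down> v\<^bold>\<rangle> \<Longrightarrow> S' ||- app2 p m v"
  let ?M = "\<sigma> (0, Ti)" and ?N = "\<sigma> (1, Ti)" and ?V = "\<sigma> (5, Ti)" and ?R = "\<sigma> (0, Tii)"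
  \<comment> \<open>Of the clauses for \<open>prog\<close> only those for evaluation unify; the
    others fail on the head constant of the atom.\<close>
  from cl u consider
      "m \<approx> abs_tm ?R" "v \<approx> abs_tm ?R"
    | "m \<approx> app_tm ?M ?N" "v \<approx> ?V" "g \<approx> \<^bold>\<langle>?M \<^bold>\<Down> abs_tm ?R\<^bold>\<rangle> \<^bold>& \<^bold>\<langle>(?R \<cdot> ?N) \<^bold>\<Down> ?V\<^bold>\<rangle>"
    by (auto simp: clause_simps)
  then show "S ||- app2 p m v"
  proof cases
    case 1
    show ?thesis by (rule app2_conv[OF abs p 1]) (use \<sigma> ty in auto)
  next
    case 2
    \<comment> \<open>Inversion of \<open>&\<close> preserves the height, so the induction
      hypothesis applies to both conjuncts.\<close>
    have "S ||- seq_fm i nil_tm (\<^bold>\<langle>?M \<^bold>\<Down> abs_tm ?R\<^bold>\<rangle> \<^bold>& \<^bold>\<langle>(?R \<cdot> ?N) \<^bold>\<Down> ?V\<^bold>\<rangle>)"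
      by (rule seq_conv_goal[OF g 2(3)]) (use \<sigma> in simp)
    note s = seq_ampE[OF i this]
    have "S ||- app2 p (app_tm ?M ?N) ?V"
      by (rule app[OF _ provI[OF i s(1)] IH[OF subset_refl s(1)] provI[OF i s(2)] IH[OF subset_refl s(2)]])
        (use \<sigma> in simp)
    then show ?thesis by (rule app2_conv[OF _ p 2(1,2)]) (use \<sigma> ty in auto)
  qed
qed simp

lemma red_induct:
  assumes p: "pred2 p" and h: "S ||- provable \<^bold>\<langle>m \<^bold>\<leadsto> v\<^bold>\<rangle>"
    and beta: "\<And>S r n. typed r Tii \<Longrightarrow> typed n Ti \<Longrightarrow>
      S ||- app2 p (app_tm (abs_tm r) n) (r \<cdot> n)"
    and app: "\<And>S m m' n. typed n Ti \<Longrightarrow> S ||- provable \<^bold>\<langle>m \<^bold>\<leadsto> m'\<^bold>\<rangle> \<Longrightarrow> S ||- app2 p m m' \<Longrightarrow>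
      S ||- app2 p (app_tm m n) (app_tm m' n)"
  shows "S ||- app2 p m v"
proof (rule atom_induct[OF _ p h])
  fix S i m v g ts \<sigma>
  assume cl: "(P_prog, ts, \<^bold>\<top>) \<in> D_all" and \<sigma>: "is_subst \<sigma>"
    and u: "patom P_prog [m \<^bold>\<leadsto> v, g] \<approx> patom P_prog (map (subst \<sigma>) ts)"
    and ty: "typed m Ti" "typed v Ti" and i: "S ||- nat_fm i" and g: "S ||- seq_fm i nil_tm g"
    and IH: "\<And>S' m v. S \<sqsubseteq> S' \<Longrightarrow> S' ||- seq_fm i nil_tm \<^bold>\<langle>m \<^bold>\<leadsto> v\<^bold>\<rangle> \<Longrightarrow> S' ||- app2 p m v"
  let ?M = "\<sigma> (0, Ti)" and ?N = "\<sigma> (1, Ti)" and ?M' = "\<sigma> (2, Ti)" and ?R = "\<sigma> (0, Tii)"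
  from cl u consider
      "m \<approx> app_tm (abs_tm ?R) ?M" "v \<approx> ?R \<cdot> ?M"
    | "m \<approx> app_tm ?M ?N" "v \<approx> app_tm ?M' ?N" "g \<approx> \<^bold>\<langle>?M \<^bold>\<leadsto> ?M'\<^bold>\<rangle>"
    by (auto simp: clause_simps)
  then show "S ||- app2 p m v"
  proof cases
    case 1
    show ?thesis by (rule app2_conv[OF beta p 1]) (use \<sigma> ty in auto)
  next
    case 2
    have s: "S ||- seq_fm i nil_tm \<^bold>\<langle>?M \<^bold>\<leadsto> ?M'\<^bold>\<rangle>"
      by (rule seq_conv_goal[OF g 2(3)]) (use \<sigma> in simp)
    have "S ||- app2 p (app_tm ?M ?N) (app_tm ?M' ?N)"
      by (rule app[OF _ provI[OF i s] IH[OF subset_refl s]]) (use \<sigma> in simp)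
    then show ?thesis by (rule app2_conv[OF _ p 2(1,2)]) (use \<sigma> ty in auto)
  qed
qed simp

lemma reds_induct:
  assumes p: "pred2 p" and h: "S ||- provable \<^bold>\<langle>m \<^bold>\<leadsto>\<^sup>* v\<^bold>\<rangle>"
    and refl: "\<And>S m. typed m Ti \<Longrightarrow> S ||- app2 p m m"
    and step: "\<And>S m m' n. S ||- provable \<^bold>\<langle>m \<^bold>\<leadsto> m'\<^bold>\<rangle> \<Longrightarrow> S ||- provable \<^bold>\<langle>m' \<^bold>\<leadsto>\<^sup>* n\<^bold>\<rangle> \<Longrightarrow> S ||- app2 p m' n \<Longrightarrow>
      S ||- app2 p m n"
  shows "S ||- app2 p m v"
proof (rule atom_induct[OF _ p h])
  fix S i m v g ts \<sigma>
  assume cl: "(P_prog, ts, \<^bold>\<top>) \<in> D_all" and \<sigma>: "is_subst \<sigma>"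
    and u: "patom P_prog [m \<^bold>\<leadsto>\<^sup>* v, g] \<approx> patom P_prog (map (subst \<sigma>) ts)"
    and ty: "typed m Ti" "typed v Ti" and i: "S ||- nat_fm i" and g: "S ||- seq_fm i nil_tm g"
    and IH: "\<And>S' m v. S \<sqsubseteq> S' \<Longrightarrow> S' ||- seq_fm i nil_tm \<^bold>\<langle>m \<^bold>\<leadsto>\<^sup>* v\<^bold>\<rangle> \<Longrightarrow> S' ||- app2 p m v"
  let ?M = "\<sigma> (0, Ti)" and ?N = "\<sigma> (1, Ti)" and ?M' = "\<sigma> (2, Ti)"
  from cl u consider
      "m \<approx> ?M" "v \<approx> ?M"
    | "m \<approx> ?M" "v \<approx> ?N" "g \<approx> \<^bold>\<langle>?M \<^bold>\<leadsto> ?M'\<^bold>\<rangle> \<^bold>& \<^bold>\<langle>?M' \<^bold>\<leadsto>\<^sup>* ?N\<^bold>\<rangle>"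
    by (auto simp: clause_simps)
  then show "S ||- app2 p m v"
  proof cases
    case 1
    show ?thesis by (rule app2_conv[OF refl p 1]) (use \<sigma> ty in auto)
  next
    case 2
    have "S ||- seq_fm i nil_tm (\<^bold>\<langle>?M \<^bold>\<leadsto> ?M'\<^bold>\<rangle> \<^bold>& \<^bold>\<langle>?M' \<^bold>\<leadsto>\<^sup>* ?N\<^bold>\<rangle>)"
      by (rule seq_conv_goal[OF g 2(3)]) (use \<sigma> in simp)
    note s = seq_ampE[OF i this]
    have "S ||- app2 p ?M ?N"
      by (rule step[OF provI[OF i s(1)] provI[OF i s(2)] IH[OF subset_refl s(2)]])
    then show ?thesis by (rule app2_conv[OF _ p 2(1,2)]) (use \<sigma> ty in auto)
  qed
qed simp

section \<open>Inversion of judgements by their clauses\<close>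

text \<open>Case analysis on the clause that proves an atom: \<open>D\<close> states what the
  matching clauses yield, and \<open>D'\<close> is its form under a unifier. The height is an
  argument because \<open>D\<close> may speak of bodies derivable at that height. \<open>C\<close>
  is reached only after \<open>D\<close> is established.\<close>

lemma prov_atom_defL:
  assumes h: "S ||- provable \<^bold>\<langle>a\<^bold>\<rangle>" and a: "typed a Tatm"
    and D: "\<And>i. typed i Tnt \<Longrightarrow> fm (D i)"
    and D\<theta>: "\<And>\<theta> i. is_subst \<theta> \<Longrightarrow> typed i Tnt \<Longrightarrow> subst \<theta> (D i) = D' \<theta> (subst \<theta> i)"
    and cl: "\<And>S \<theta> \<sigma> ts i g. (P_prog, ts, \<^bold>\<top>) \<in> D_all \<Longrightarrow> is_subst \<theta> \<Longrightarrow> is_subst \<sigma> \<Longrightarrow>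
      patom P_prog [subst \<theta> a, g] \<approx> patom P_prog (map (subst \<sigma>) ts) \<Longrightarrow>
      S ||- nat_fm i \<Longrightarrow> S ||- seq_fm i nil_tm g \<Longrightarrow> S ||- D' \<theta> i"
    and C: "\<And>S' i. S \<sqsubseteq> S' \<Longrightarrow> S' ||- nat_fm i \<Longrightarrow> S' ||- D i \<Longrightarrow> S' ||- C"
  shows "S ||- C"
  using h
proof (rule provE)
  fix S1 i assume S1: "S \<sqsubseteq> S1" and i: "S1 ||- nat_fm i" and s: "S1 ||- seq_fm i nil_tm \<^bold>\<langle>a\<^bold>\<rangle>"
  have ti: "typed i Tnt" using ent_ty(1)[OF i] .
  from i s show "S1 ||- C"
  proof (rule seq_atomE)
    fix S2 g assume S2: "S1 \<sqsubseteq> S2" and p: "S2 ||- prog_fm a g" and g: "S2 ||- seq_fm i nil_tm g"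
    have tg: "typed g Tprp" using ent_ty(4)[OF p] by simp
    have "S2 ||- nat_fm i \<^bold>\<supset> seq_fm i nil_tm g \<^bold>\<supset> D i"
    proof (rule ent_defL[OF p])
      fix S0 ts B \<theta> \<sigma>
      assume c: "(P_prog, ts, B) \<in> D_all" and \<theta>: "is_subst \<theta>" and \<sigma>: "is_subst \<sigma>"
        and u: "patom P_prog (map (subst \<theta>) [a, g]) \<approx> patom P_prog (map (subst \<sigma>) ts)"
      have B: "B = \<^bold>\<top>" using c by (auto simp: clause_simps)
      have "S0 ||- nat_fm (subst \<theta> i) \<^bold>\<supset> seq_fm (subst \<theta> i) nil_tm (subst \<theta> g) \<^bold>\<supset> D' \<theta> (subst \<theta> i)"
        by (rule ent_imp2I) (use \<theta> ti tg u in \<open>auto intro: cl[OF c[unfolded B] \<theta> \<sigma>]\<close>)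
      then show "S0 ||- subst \<theta> (nat_fm i \<^bold>\<supset> seq_fm i nil_tm g \<^bold>\<supset> D i)" using D\<theta>[OF \<theta> ti] by simp
    qed (use ti tg D in auto)
    then have "S2 ||- D i" using ent_mono[OF i S2] g by (blast intro: ent_mp)
    then show "S2 ||- C" using C[OF _ ent_mono[OF i S2]] S1 S2 by auto
  qed
qed

lemma eval_abs_inv:
  assumes h: "S ||- provable \<^bold>\<langle>abs_tm r \<^bold>\<Down> v\<^bold>\<rangle>"
  shows "S ||- abs_tm r \<^bold>\<equiv> v"
  using h
proof (rule prov_atom_defL[where D = "\<lambda>i. abs_tm r \<^bold>\<equiv> v" and D' = "\<lambda>\<theta> i. abs_tm (subst \<theta> r) \<^bold>\<equiv> subst \<theta> v"])
  have ty: "typed r Tii" "typed v Ti" using ent_ty_prov[OF h] by auto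
  then show "typed (abs_tm r \<^bold>\<Down> v) Tatm" "fm (abs_tm r \<^bold>\<equiv> v)" by simp_all
  fix S \<theta> \<sigma> ts g assume a: "(P_prog, ts, \<^bold>\<top>) \<in> D_all" "is_subst \<theta>" "is_subst \<sigma>"
    "patom P_prog [subst \<theta> (abs_tm r \<^bold>\<Down> v), g] \<approx> patom P_prog (map (subst \<sigma>) ts)"
  then have "subst \<theta> r \<approx> \<sigma> (0, Tii)" "subst \<theta> v \<approx> abs_tm (\<sigma> (0, Tii))"
    by (auto simp: clause_simps)
  then have "abs_tm (subst \<theta> r) \<approx> subst \<theta> v" by (meson conv_app conv_refl conv_sym conv_trans)
  then show "S ||- abs_tm (subst \<theta> r) \<^bold>\<equiv> subst \<theta> v" using a(2) ty by (auto intro: equivI)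
qed auto

lemma eval_app_inv:
  assumes h: "S ||- provable \<^bold>\<langle>app_tm m n \<^bold>\<Down> v\<^bold>\<rangle>"
    and C: "\<And>S' r. S \<sqsubseteq> S' \<Longrightarrow> typed r Tii \<Longrightarrow> S' ||- provable \<^bold>\<langle>m \<^bold>\<Down> abs_tm r\<^bold>\<rangle> \<Longrightarrow>
      S' ||- provable \<^bold>\<langle>(r \<cdot> n) \<^bold>\<Down> v\<^bold>\<rangle> \<Longrightarrow> S' ||- C"
  shows "S ||- C"
proof -
  have ty: "typed m Ti" "typed n Ti" "typed v Ti" using ent_ty_prov[OF h] by auto
  let ?G = "\<lambda>m n v r. \<^bold>\<langle>m \<^bold>\<Down> abs_tm r\<^bold>\<rangle> \<^bold>& \<^bold>\<langle>(r \<cdot> n) \<^bold>\<Down> v\<^bold>\<rangle>"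
  let ?D = "\<lambda>m n v i. Ex Tii (seq_fm i nil_tm (?G m n v (Bnd 0)))"
  from h show ?thesis
  proof (rule prov_atom_defL[where D = "?D m n v" and D' = "\<lambda>\<theta>. ?D (subst \<theta> m) (subst \<theta> n) (subst \<theta> v)"])
    fix S \<theta> \<sigma> ts g i assume a: "(P_prog, ts, \<^bold>\<top>) \<in> D_all" "is_subst \<theta>" "is_subst \<sigma>"
      "patom P_prog [subst \<theta> (app_tm m n \<^bold>\<Down> v), g] \<approx> patom P_prog (map (subst \<sigma>) ts)"
      and i: "S ||- nat_fm i" and g: "S ||- seq_fm i nil_tm g"
    let ?r = "\<sigma> (0, Tii)"
    have u: "subst \<theta> m \<approx> \<sigma> (0, Ti)" "subst \<theta> n \<approx> \<sigma> (1, Ti)" "subst \<theta> v \<approx> \<sigma> (5, Ti)"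
      "g \<approx> ?G (\<sigma> (0, Ti)) (\<sigma> (1, Ti)) (\<sigma> (5, Ti)) ?r"
      using a by (auto simp: clause_simps)
    have "?G (\<sigma> (0, Ti)) (\<sigma> (1, Ti)) (\<sigma> (5, Ti)) ?r \<approx> ?G (subst \<theta> m) (subst \<theta> n) (subst \<theta> v) ?r"
      using u by (intro conv_app) (auto intro: conv_sym)
    with u(4) have "g \<approx> ?G (subst \<theta> m) (subst \<theta> n) (subst \<theta> v) ?r" by (rule conv_trans)
    then have "S ||- seq_fm i nil_tm (?G (subst \<theta> m) (subst \<theta> n) (subst \<theta> v) ?r)"
      by (rule seq_conv_goal[OF g]) (use a(2,3) ty in simp)
    then show "S ||- ?D (subst \<theta> m) (subst \<theta> n) (subst \<theta> v) i"
      using a(2,3) ty ent_ty(1)[OF i] by (auto intro!: ent_exI[where t = ?r])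
  next
    fix S' i assume S': "S \<sqsubseteq> S'" and i: "S' ||- nat_fm i" and d: "S' ||- ?D m n v i"
    from d show "S' ||- C"
    proof (rule ent_exE)
      fix S2 r assume S2: "S' \<sqsubseteq> S2" and r: "typed r Tii"
        and "S2 ||- inst (seq_fm i nil_tm (?G m n v (Bnd 0))) 0 r"
      then have "S2 ||- seq_fm i nil_tm (?G m n v r)" using ty ent_ty(1)[OF i] by simp
      note s = seq_ampE[OF ent_mono[OF i S2] this]
      show "S2 ||- C"
        using S' S2 by (intro C[OF _ r provI[OF ent_mono[OF i S2] s(1)] provI[OF ent_mono[OF i S2] s(2)]]) auto
    qed
  qed (use ty in auto)
qed

text \<open>No clause for \<open>\<leadsto>\<close> has an abstraction on its left, so bottom is
  derived.\<close>

lemma red_abs_inv: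
  assumes h: "S ||- provable \<^bold>\<langle>abs_tm r \<^bold>\<leadsto> v\<^bold>\<rangle>" and C: "fm C"
  shows "S ||- C"
  using h
proof (rule prov_atom_defL[where D = "\<lambda>i. \<^bold>\<bottom>" and D' = "\<lambda>\<theta> i. \<^bold>\<bottom>"])
  show "typed (abs_tm r \<^bold>\<leadsto> v) Tatm" using ent_ty_prov[OF h] by auto
qed (auto simp: clause_simps intro: ent_botE[OF _ C])

text \<open>Both reduction clauses may match, as \<open>m\<close> is arbitrary. What unification
  tells about \<open>m\<close> and \<open>v\<close> is recorded by \<open>\<equiv>\<close>, the only
  form in which it can leave the case analysis.\<close>

lemma red_app_inv:
  assumes h: "S ||- provable \<^bold>\<langle>app_tm m n \<^bold>\<leadsto> v\<^bold>\<rangle>"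
    and beta: "\<And>S' r. S \<sqsubseteq> S' \<Longrightarrow> typed r Tii \<Longrightarrow> S' ||- m \<^bold>\<equiv> abs_tm r \<Longrightarrow>
      S' ||- v \<^bold>\<equiv> (r \<cdot> n) \<Longrightarrow> S' ||- C"
    and app: "\<And>S' m'. S \<sqsubseteq> S' \<Longrightarrow> S' ||- v \<^bold>\<equiv> app_tm m' n \<Longrightarrow> S' ||- provable \<^bold>\<langle>m \<^bold>\<leadsto> m'\<^bold>\<rangle> \<Longrightarrow> S' ||- C"
  shows "S ||- C"
proof -
  have ty: "typed m Ti" "typed n Ti" "typed v Ti" using ent_ty_prov[OF h] by auto
  let ?B = "\<lambda>m n v. Ex Tii (m \<^bold>\<equiv> abs_tm (Bnd 0) \<^bold>\<and> v \<^bold>\<equiv> (Bnd 0 \<cdot> n))"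
  let ?A = "\<lambda>m n v i. Ex Ti (v \<^bold>\<equiv> app_tm (Bnd 0) n \<^bold>\<and> seq_fm i nil_tm \<^bold>\<langle>m \<^bold>\<leadsto> Bnd 0\<^bold>\<rangle>)"
  let ?D = "\<lambda>m n v i. ?B m n v \<^bold>\<or> ?A m n v i"
  from h show ?thesis
  proof (rule prov_atom_defL[where D = "?D m n v" and D' = "\<lambda>\<theta>. ?D (subst \<theta> m) (subst \<theta> n) (subst \<theta> v)"])
    fix S \<theta> \<sigma> ts g i assume a: "(P_prog, ts, \<^bold>\<top>) \<in> D_all" "is_subst \<theta>" "is_subst \<sigma>"
      "patom P_prog [subst \<theta> (app_tm m n \<^bold>\<leadsto> v), g] \<approx> patom P_prog (map (subst \<sigma>) ts)"
      and i: "S ||- nat_fm i" and g: "S ||- seq_fm i nil_tm g"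
    let ?R = "\<sigma> (0, Tii)" and ?M' = "\<sigma> (2, Ti)"
    have ti: "typed i Tnt" using ent_ty(1)[OF i] .
    from a(1,4) consider
        "subst \<theta> m \<approx> abs_tm ?R" "subst \<theta> n \<approx> \<sigma> (0, Ti)" "subst \<theta> v \<approx> ?R \<cdot> \<sigma> (0, Ti)"
      | "subst \<theta> m \<approx> \<sigma> (0, Ti)" "subst \<theta> n \<approx> \<sigma> (1, Ti)" "subst \<theta> v \<approx> app_tm ?M' (\<sigma> (1, Ti))"
        "g \<approx> \<^bold>\<langle>\<sigma> (0, Ti) \<^bold>\<leadsto> ?M'\<^bold>\<rangle>"
      by (auto simp: clause_simps)
    then show "S ||- ?D (subst \<theta> m) (subst \<theta> n) (subst \<theta> v) i"
    proof cases
      case 1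
      have "?R \<cdot> \<sigma> (0, Ti) \<approx> ?R \<cdot> subst \<theta> n" using 1(2) by (intro conv_app) (auto intro: conv_sym)
      with 1(3) have "subst \<theta> v \<approx> ?R \<cdot> subst \<theta> n" by (rule conv_trans)
      then have "S ||- ?B (subst \<theta> m) (subst \<theta> n) (subst \<theta> v)"
        using 1(1) a(2,3) ty by (auto intro!: ent_exI[where t = ?R] equivI)
      then show ?thesis by (rule ent_orI1) (use a(2) ty ti in simp)
    next
      case 2
      have "app_tm ?M' (\<sigma> (1, Ti)) \<approx> app_tm ?M' (subst \<theta> n)" using 2(2) by (auto intro: conv_sym)
      with 2(3) have v: "subst \<theta> v \<approx> app_tm ?M' (subst \<theta> n)" by (rule conv_trans)
      have "\<^bold>\<langle>\<sigma> (0, Ti) \<^bold>\<leadsto> ?M'\<^bold>\<rangle> \<approx> \<^bold>\<langle>subst \<theta> m \<^bold>\<leadsto> ?M'\<^bold>\<rangle>" using 2(1) by (auto intro: conv_sym)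
      with 2(4) have "g \<approx> \<^bold>\<langle>subst \<theta> m \<^bold>\<leadsto> ?M'\<^bold>\<rangle>" by (rule conv_trans)
      then have "S ||- seq_fm i nil_tm \<^bold>\<langle>subst \<theta> m \<^bold>\<leadsto> ?M'\<^bold>\<rangle>"
        by (rule seq_conv_goal[OF g]) (use a(2,3) ty in simp)
      then have "S ||- ?A (subst \<theta> m) (subst \<theta> n) (subst \<theta> v) i"
        using v a(2,3) ty ti by (auto intro!: ent_exI[where t = ?M'] equivI)
      then show ?thesis by (rule ent_orI2) (use a(2) ty in simp)
    qed
  next
    fix S' i assume S': "S \<sqsubseteq> S'" and i: "S' ||- nat_fm i" and d: "S' ||- ?D m n v i"
    have ti: "typed i Tnt" using ent_ty(1)[OF i] .
    from d show "S' ||- C"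
    proof (rule ent_orE)
      fix S1 assume S1: "S' \<sqsubseteq> S1" and "S1 ||- ?B m n v"
      from this(2) show "S1 ||- C"
      proof (rule ent_exE)
        fix S2 r assume "S1 \<sqsubseteq> S2" and r: "typed r Tii"
          and "S2 ||- inst (m \<^bold>\<equiv> abs_tm (Bnd 0) \<^bold>\<and> v \<^bold>\<equiv> (Bnd 0 \<cdot> n)) 0 r"
        then show "S2 ||- C" using S' S1 ty by (intro beta[OF _ r]) auto
      qed
    next
      fix S1 assume S1: "S' \<sqsubseteq> S1" and "S1 ||- ?A m n v i"
      from this(2) show "S1 ||- C"
      proof (rule ent_exE)
        fix S2 m' assume S2: "S1 \<sqsubseteq> S2" and "typed m' Ti"
          and "S2 ||- inst (v \<^bold>\<equiv> app_tm (Bnd 0) n \<^bold>\<and> seq_fm i nil_tm \<^bold>\<langle>m \<^bold>\<leadsto> Bnd 0\<^bold>\<rangle>) 0 m'"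
        then have "S2 ||- v \<^bold>\<equiv> app_tm m' n" "S2 ||- seq_fm i nil_tm \<^bold>\<langle>m \<^bold>\<leadsto> m'\<^bold>\<rangle>" using ty ti by auto
        then show "S2 ||- C" using S' S1 S2
          by (intro app[of S2 m'] provI[of S2 i]) (auto intro: ent_mono[OF i])
      qed
    qed
  qed (use ty in auto)
qed

lemma typeof_app_inv:
  assumes h: "S ||- provable \<^bold>\<langle>typeof_tm (app_tm m n) t\<^bold>\<rangle>"
    and C: "\<And>S' u. S \<sqsubseteq> S' \<Longrightarrow> S' ||- provable \<^bold>\<langle>typeof_tm m (arr_tm u t)\<^bold>\<rangle> \<Longrightarrow>
      S' ||- provable \<^bold>\<langle>typeof_tm n u\<^bold>\<rangle> \<Longrightarrow> S' ||- C"
  shows "S ||- C"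
proof -
  have ty: "typed m Ti" "typed n Ti" "typed t Ti" using ent_ty_prov[OF h] by auto
  let ?G = "\<lambda>m n t u. \<^bold>\<langle>typeof_tm m (arr_tm u t)\<^bold>\<rangle> \<^bold>& \<^bold>\<langle>typeof_tm n u\<^bold>\<rangle>"
  let ?D = "\<lambda>m n t i. Ex Ti (seq_fm i nil_tm (?G m n t (Bnd 0)))"
  from h show ?thesis
  proof (rule prov_atom_defL[where D = "?D m n t" and D' = "\<lambda>\<theta>. ?D (subst \<theta> m) (subst \<theta> n) (subst \<theta> t)"])
    fix S \<theta> \<sigma> ts g i assume a: "(P_prog, ts, \<^bold>\<top>) \<in> D_all" "is_subst \<theta>" "is_subst \<sigma>"
      "patom P_prog [subst \<theta> (typeof_tm (app_tm m n) t), g] \<approx> patom P_prog (map (subst \<sigma>) ts)"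
      and i: "S ||- nat_fm i" and g: "S ||- seq_fm i nil_tm g"
    let ?u = "\<sigma> (4, Ti)"
    have u: "subst \<theta> m \<approx> \<sigma> (0, Ti)" "subst \<theta> n \<approx> \<sigma> (1, Ti)" "subst \<theta> t \<approx> \<sigma> (3, Ti)"
      "g \<approx> ?G (\<sigma> (0, Ti)) (\<sigma> (1, Ti)) (\<sigma> (3, Ti)) ?u"
      using a by (auto simp: clause_simps)
    have "?G (\<sigma> (0, Ti)) (\<sigma> (1, Ti)) (\<sigma> (3, Ti)) ?u \<approx> ?G (subst \<theta> m) (subst \<theta> n) (subst \<theta> t) ?u"
      using u by (auto intro: conv_sym)
    with u(4) have "g \<approx> ?G (subst \<theta> m) (subst \<theta> n) (subst \<theta> t) ?u" by (rule conv_trans)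
    then have "S ||- seq_fm i nil_tm (?G (subst \<theta> m) (subst \<theta> n) (subst \<theta> t) ?u)"
      by (rule seq_conv_goal[OF g]) (use a(2,3) ty in simp)
    then show "S ||- ?D (subst \<theta> m) (subst \<theta> n) (subst \<theta> t) i"
      using a(2,3) ty ent_ty(1)[OF i] by (auto intro!: ent_exI[where t = ?u])
  next
    fix S' i assume S': "S \<sqsubseteq> S'" and i: "S' ||- nat_fm i" and d: "S' ||- ?D m n t i"
    from d show "S' ||- C"
    proof (rule ent_exE)
      fix S2 u assume S2: "S' \<sqsubseteq> S2" and u: "typed u Ti"
        and "S2 ||- inst (seq_fm i nil_tm (?G m n t (Bnd 0))) 0 u"
      then have "S2 ||- seq_fm i nil_tm (?G m n t u)" using ty ent_ty(1)[OF i] by simp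
      note s = seq_ampE[OF ent_mono[OF i S2] this]
      show "S2 ||- C"
        using S' S2 by (intro C[OF _ provI[OF ent_mono[OF i S2] s(1)] provI[OF ent_mono[OF i S2] s(2)]]) auto
    qed
  qed (use ty in auto)
qed

text \<open>Inverts the clause for abstractions, then its \<open>\<And>\<close> at the argument
  \<open>n\<close>, then the implication. What results is a derivation from the hypothesis that
  \<open>n\<close> has type \<open>u\<close>, ready for cut.\<close>

lemma typeof_abs_inv:
  assumes h: "S ||- provable \<^bold>\<langle>typeof_tm (abs_tm r) (arr_tm u t)\<^bold>\<rangle>" and n: "typed n Ti"
    and C: "\<And>S' i. S \<sqsubseteq> S' \<Longrightarrow> S' ||- nat_fm i \<Longrightarrow>
      S' ||- seq_fm i (typeof_tm n u \<^bold># nil_tm) \<^bold>\<langle>typeof_tm (r \<cdot> n) t\<^bold>\<rangle> \<Longrightarrow> S' ||- C"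
  shows "S ||- C"
proof -
  have ty: "typed r Tii" "typed u Ti" "typed t Ti"
    using ent_ty_prov[OF h] by auto
  let ?F = "\<lambda>r u t. Lam (typeof_tm (Bnd 0) u \<^bold>\<Rightarrow> \<^bold>\<langle>typeof_tm (r \<cdot> Bnd 0) t\<^bold>\<rangle>)"
  let ?D = "\<lambda>r u t i. seq_fm i nil_tm (\<^bold>\<And> (?F r u t))"
  from h show ?thesis
  proof (rule prov_atom_defL[where D = "?D r u t" and D' = "\<lambda>\<theta>. ?D (subst \<theta> r) (subst \<theta> u) (subst \<theta> t)"])
    fix S \<theta> \<sigma> ts g i assume a: "(P_prog, ts, \<^bold>\<top>) \<in> D_all" "is_subst \<theta>" "is_subst \<sigma>"
      "patom P_prog [subst \<theta> (typeof_tm (abs_tm r) (arr_tm u t)), g] \<approx> patom P_prog (map (subst \<sigma>) ts)"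
      and i: "S ||- nat_fm i" and g: "S ||- seq_fm i nil_tm g"
    let ?G = "?F (\<sigma> (0, Tii)) (\<sigma> (3, Ti)) (\<sigma> (4, Ti))"
    have v: "subst \<theta> r \<approx> \<sigma> (0, Tii)" "subst \<theta> u \<approx> \<sigma> (3, Ti)" "subst \<theta> t \<approx> \<sigma> (4, Ti)"
      "g \<approx> \<^bold>\<And> ?G"
      using a by (auto simp: clause_simps)
    have "\<^bold>\<And> ?G \<approx> \<^bold>\<And> (?F (subst \<theta> r) (subst \<theta> u) (subst \<theta> t))"
      using v by (intro conv_app conv_lam) (auto intro: conv_sym)
    with v(4) have "g \<approx> \<^bold>\<And> (?F (subst \<theta> r) (subst \<theta> u) (subst \<theta> t))" by (rule conv_trans)
    then show "S ||- ?D (subst \<theta> r) (subst \<theta> u) (subst \<theta> t) i"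
      by (rule seq_conv_goal[OF g]) (use a(2) ty in simp)
  next
    fix S' i assume S': "S \<sqsubseteq> S'" and i: "S' ||- nat_fm i" and d: "S' ||- ?D r u t i"
    have "?F r u t \<cdot> n \<approx> typeof_tm n u \<^bold>\<Rightarrow> \<^bold>\<langle>typeof_tm (r \<cdot> n) t\<^bold>\<rangle>"
      using conv_beta[of "typeof_tm (Bnd 0) u \<^bold>\<Rightarrow> \<^bold>\<langle>typeof_tm (r \<cdot> Bnd 0) t\<^bold>\<rangle>" n] ty n by simp
    from seq_conv_goal[OF seq_allE[OF i d n] this]
    have "S' ||- seq_fm i nil_tm (typeof_tm n u \<^bold>\<Rightarrow> \<^bold>\<langle>typeof_tm (r \<cdot> n) t\<^bold>\<rangle>)" using ty n by simp
    from C[OF S' i seq_impE[OF i this]] show "S' ||- C" .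
  qed (use ty in auto)
qed

text \<open>The simultaneous cut for a context with the single atom \<open>a\<close>, answered in
  the empty context; its bound is absorbed by the existential height of provability.\<close>

lemma prov_cut:
  assumes i: "S ||- nat_fm i" and b: "S ||- seq_fm i (a \<^bold># nil_tm) b" and a: "S ||- provable \<^bold>\<langle>a\<^bold>\<rangle>"
  shows "S ||- provable b"
  using a
proof (rule provE)
  fix S1 k assume S1: "S \<sqsubseteq> S1" and k: "S1 ||- nat_fm k" and sk: "S1 ||- seq_fm k nil_tm \<^bold>\<langle>a\<^bold>\<rangle>"
  show "S1 ||- provable b"
  proof (rule seq_cutE[OF ent_mono[OF i S1] k])
    fix S2 k' assume S2: "S1 \<sqsubseteq> S2" and k': "S2 ||- nat_fm k'" and c: "cut_to S2 i k k'"
    have "S3 ||- seq_fm k nil_tm \<^bold>\<langle>x\<^bold>\<rangle>" if "S2 \<sqsubseteq> S3" and e: "S3 ||- patom P_element [x, a \<^bold># nil_tm]" for S3 x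
    proof -
      have ty: "typed k Tnt" "typed x Tatm" using ent_ty(1)[OF k] ent_ty(3)[OF e] by auto
      have "S3 ||- inst (seq_fm k nil_tm \<^bold>\<langle>Bnd 0\<^bold>\<rangle>) 0 x"
        by (rule element_ConsE[OF e refl])
          (use ty that(1) S2 in \<open>auto intro: ent_mono[OF sk] elim: element_nilE\<close>)
      then show ?thesis using ty by simp
    qed
    then have "ctx_le S2 k (a \<^bold># nil_tm) nil_tm" by (auto simp: ctx_le_def)
    then have "S2 ||- seq_fm k' nil_tm b"
      using c ent_mono[OF b] S1 S2 unfolding cut_to_def by auto
    then show "S2 ||- provable b" by (rule provI[OF k'])
  qed
qed

section \<open>Rewriting with \<open>\<equiv>\<close>\<close>

lemma equiv_sym: "S ||- m \<^bold>\<equiv> n \<Longrightarrow> S ||- n \<^bold>\<equiv> m"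
  by (frule ent_ty(5), erule equiv_defL) (auto intro!: equivI conv_sym)

lemma equiv_trans:
  assumes "S ||- l \<^bold>\<equiv> m" "S ||- m \<^bold>\<equiv> n"
  shows "S ||- l \<^bold>\<equiv> n"
proof -
  have ty: "typed l Ti" "typed m Ti" "typed n Ti"
    using ent_ty(5)[OF assms(1)] ent_ty(5)[OF assms(2)] by auto
  have "S ||- m \<^bold>\<equiv> n \<^bold>\<supset> l \<^bold>\<equiv> n"
    by (rule equiv_defL[OF assms(1)])
      (use ty in \<open>auto intro!: ent_impI elim!: ent_conv_atom intro: conv_sym\<close>)
  then show ?thesis using assms(2) by (rule ent_mp)
qed

lemma equiv_app: "S ||- m \<^bold>\<equiv> m' \<Longrightarrow> typed n Ti \<Longrightarrow> S ||- app_tm m n \<^bold>\<equiv> app_tm m' n"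
  by (frule ent_ty(5), erule equiv_defL) (auto intro!: equivI)

lemma equiv_abs_inst:
  assumes "S ||- abs_tm r \<^bold>\<equiv> abs_tm r'" "typed n Ti"
  shows "S ||- (r \<cdot> n) \<^bold>\<equiv> (r' \<cdot> n)"
  using assms ent_ty(5)[OF assms(1)] by (elim equiv_defL) (auto intro!: equivI conv_app)

lemma prov_rewrite:
  assumes "S ||- m \<^bold>\<equiv> m'" "S ||- provable \<^bold>\<langle>Cst (Fn c) \<cdot> m \<cdot> v\<^bold>\<rangle>" and c: "fsym_type c = Ti \<rightarrow>\<^sub>t Ti \<rightarrow>\<^sub>t Tatm"
  shows "S ||- provable \<^bold>\<langle>Cst (Fn c) \<cdot> m' \<cdot> v\<^bold>\<rangle>"
proof -
  have ty: "typed m Ti" "typed m' Ti" "typed v Ti"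
    using ent_ty(5)[OF assms(1)] ent_ty_prov[OF assms(2)] c by auto
  have "S ||- provable \<^bold>\<langle>Cst (Fn c) \<cdot> m \<cdot> v\<^bold>\<rangle> \<^bold>\<supset> provable \<^bold>\<langle>Cst (Fn c) \<cdot> m' \<cdot> v\<^bold>\<rangle>"
    by (rule equiv_defL[OF assms(1)])
      (use ty c in \<open>auto intro!: ent_impI provable_conv elim!: ent_conv\<close>)
  then show ?thesis using assms(2) by (rule ent_mp)
qed

section \<open>Metatheory of evaluation, reduction and typing\<close>

text \<open>Rule induction on the first evaluation, inversion of the second. The hypothesis for the
  function gives equal abstractions, hence equal instances at the argument; rewriting with this
  makes the rest of the second evaluation start where the first continues.\<close>

lemma eval_det:
  assumes "S ||- \<^bold>\<turnstile> \<^bold>\<langle>m \<^bold>\<Down> v\<^bold>\<rangle>" "S ||- \<^bold>\<turnstile> \<^bold>\<langle>m \<^bold>\<Down> w\<^bold>\<rangle>"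
  shows "S ||- v \<^bold>\<equiv> w"
proof -
  \<comment> \<open>\<open>w\<close> is quantified inside, as the hypotheses are applied to other
    results; below this quantifier \<open>m\<close> is \<open>Bnd 2\<close> and \<open>v\<close> is
    \<open>Bnd (Suc 0)\<close>.\<close>
  let ?p = "All Ti (\<^bold>\<turnstile> \<^bold>\<langle>Bnd 2 \<^bold>\<Down> Bnd 0\<^bold>\<rangle> \<^bold>\<supset> Bnd (Suc 0) \<^bold>\<equiv> Bnd 0)"
  have iff: "S ||- app2 ?p m v \<longleftrightarrow> (\<forall>S' w. S \<sqsubseteq> S' \<longrightarrow> S' ||- \<^bold>\<turnstile> \<^bold>\<langle>m \<^bold>\<Down> w\<^bold>\<rangle> \<longrightarrow> S' ||- v \<^bold>\<equiv> w)"
    if "typed m Ti" "typed v Ti" for S m v using that by (auto simp: forcing)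
  have "S ||- app2 ?p m v"
  proof (rule eval_induct[OF _ assms(1)])
    show "pred2 ?p" by (simp add: pred2_def)
    show "S ||- app2 ?p (abs_tm r) (abs_tm r)" if "typed r Tii" for S r
      using that by (subst iff) (auto intro: eval_abs_inv)
    fix S m n r v
    assume n: "typed n Ti" and mr: "S ||- \<^bold>\<turnstile> \<^bold>\<langle>m \<^bold>\<Down> abs_tm r\<^bold>\<rangle>" and IHm: "S ||- app2 ?p m (abs_tm r)"
      and rv: "S ||- \<^bold>\<turnstile> \<^bold>\<langle>(r \<cdot> n) \<^bold>\<Down> v\<^bold>\<rangle>" and IHr: "S ||- app2 ?p (r \<cdot> n) v"
    have ty: "typed m Ti" "typed (abs_tm r) Ti" "typed (r \<cdot> n) Ti" "typed v Ti"
      using ent_ty_atom(1)[OF mr] ent_ty_atom(1)[OF rv] by auto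
    note IHm = IHm[unfolded iff[OF ty(1,2)], rule_format]
    note IHr = IHr[unfolded iff[OF ty(3,4)], rule_format]
    have "S' ||- v \<^bold>\<equiv> w" if S': "S \<sqsubseteq> S'" and w: "S' ||- \<^bold>\<turnstile> \<^bold>\<langle>app_tm m n \<^bold>\<Down> w\<^bold>\<rangle>" for S' w
      using w
    proof (rule eval_app_inv)
      fix S2 r' assume S2: "S' \<sqsubseteq> S2"
        and mr': "S2 ||- \<^bold>\<turnstile> \<^bold>\<langle>m \<^bold>\<Down> abs_tm r'\<^bold>\<rangle>" and rw: "S2 ||- \<^bold>\<turnstile> \<^bold>\<langle>(r' \<cdot> n) \<^bold>\<Down> w\<^bold>\<rangle>"
      have "S \<sqsubseteq> S2" using S' S2 by auto
      from equiv_sym[OF equiv_abs_inst[OF IHm[OF this mr'] n]]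
      have "S2 ||- \<^bold>\<turnstile> \<^bold>\<langle>(r \<cdot> n) \<^bold>\<Down> w\<^bold>\<rangle>" by (rule prov_rewrite) (use rw in auto)
      then show "S2 ||- v \<^bold>\<equiv> w" by (rule IHr[OF \<open>S \<sqsubseteq> S2\<close>])
    qed
    then show "S ||- app2 ?p (app_tm m n) v" by (subst iff) (use ty n in auto)
  qed
  then show ?thesis using iff ent_ty_atom(1)[OF assms(1)] assms(2) by blast
qed

text \<open>The two clauses overlap on an application only if its function is an abstraction, and
  abstractions do not reduce.\<close>

lemma red_det:
  assumes "S ||- \<^bold>\<turnstile> \<^bold>\<langle>m \<^bold>\<leadsto> v\<^bold>\<rangle>" "S ||- \<^bold>\<turnstile> \<^bold>\<langle>m \<^bold>\<leadsto> w\<^bold>\<rangle>"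
  shows "S ||- v \<^bold>\<equiv> w"
proof -
  let ?p = "All Ti (\<^bold>\<turnstile> \<^bold>\<langle>Bnd 2 \<^bold>\<leadsto> Bnd 0\<^bold>\<rangle> \<^bold>\<supset> Bnd (Suc 0) \<^bold>\<equiv> Bnd 0)"
  have iff: "S ||- app2 ?p m v \<longleftrightarrow> (\<forall>S' w. S \<sqsubseteq> S' \<longrightarrow> S' ||- \<^bold>\<turnstile> \<^bold>\<langle>m \<^bold>\<leadsto> w\<^bold>\<rangle> \<longrightarrow> S' ||- v \<^bold>\<equiv> w)"
    if "typed m Ti" "typed v Ti" for S m v using that by (auto simp: forcing)
  have "S ||- app2 ?p m v"
  proof (rule red_induct[OF _ assms(1)])
    show "pred2 ?p" by (simp add: pred2_def)
    fix S r n assume r: "typed r Tii" and n: "typed n Ti"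
    have "S' ||- (r \<cdot> n) \<^bold>\<equiv> w" if w: "S' ||- \<^bold>\<turnstile> \<^bold>\<langle>app_tm (abs_tm r) n \<^bold>\<leadsto> w\<^bold>\<rangle>" for S' w
      using w
    proof (rule red_app_inv)
      show "S2 ||- (r \<cdot> n) \<^bold>\<equiv> w" if "S2 ||- abs_tm r \<^bold>\<equiv> abs_tm r'" "S2 ||- w \<^bold>\<equiv> (r' \<cdot> n)" for S2 r'
        by (rule equiv_trans[OF equiv_abs_inst[OF that(1) n] equiv_sym[OF that(2)]])
      show "S2 ||- (r \<cdot> n) \<^bold>\<equiv> w" if "S2 ||- \<^bold>\<turnstile> \<^bold>\<langle>abs_tm r \<^bold>\<leadsto> m'\<^bold>\<rangle>" for S2 m'
        by (rule red_abs_inv[OF that]) (use r n ent_ty_atom(2)[OF w] in auto)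
    qed
    then show "S ||- app2 ?p (app_tm (abs_tm r) n) (r \<cdot> n)" by (subst iff) (use r n in auto)
  next
    fix S m m' n
    assume n: "typed n Ti" and mm: "S ||- \<^bold>\<turnstile> \<^bold>\<langle>m \<^bold>\<leadsto> m'\<^bold>\<rangle>" and IH: "S ||- app2 ?p m m'"
    have ty: "typed m Ti" "typed m' Ti" using ent_ty_atom(2)[OF mm] by auto
    note IH = IH[unfolded iff[OF ty], rule_format]
    have "S' ||- app_tm m' n \<^bold>\<equiv> w" if S': "S \<sqsubseteq> S'" and w: "S' ||- \<^bold>\<turnstile> \<^bold>\<langle>app_tm m n \<^bold>\<leadsto> w\<^bold>\<rangle>" for S' w
      using w
    proof (rule red_app_inv)
      fix S2 r assume S2: "S' \<sqsubseteq> S2" and "S2 ||- m \<^bold>\<equiv> abs_tm r"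
      from this(2) have "S2 ||- \<^bold>\<turnstile> \<^bold>\<langle>abs_tm r \<^bold>\<leadsto> m'\<^bold>\<rangle>"
        by (rule prov_rewrite) (use mm S' S2 in \<open>auto intro: ent_mono\<close>)
      then show "S2 ||- app_tm m' n \<^bold>\<equiv> w"
        by (rule red_abs_inv) (use ty n ent_ty_atom(2)[OF w] in auto)
    next
      fix S2 m2 assume S2: "S' \<sqsubseteq> S2" and w2: "S2 ||- w \<^bold>\<equiv> app_tm m2 n" and m2: "S2 ||- \<^bold>\<turnstile> \<^bold>\<langle>m \<^bold>\<leadsto> m2\<^bold>\<rangle>"
      have "S2 ||- m' \<^bold>\<equiv> m2" by (rule IH[OF _ m2]) (use S' S2 in auto)
      from equiv_trans[OF equiv_app[OF this n] equiv_sym[OF w2]] show "S2 ||- app_tm m' n \<^bold>\<equiv> w" .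
    qed
    then show "S ||- app2 ?p (app_tm m n) (app_tm m' n)" by (subst iff) (use ty n in auto)
  qed
  then show ?thesis using iff ent_ty_atom(2)[OF assms(1)] assms(2) by blast
qed

section \<open>Equivalence of evaluation and reduction\<close>

lemma reds_trans:
  assumes "S ||- \<^bold>\<turnstile> \<^bold>\<langle>l \<^bold>\<leadsto>\<^sup>* m\<^bold>\<rangle>" "S ||- \<^bold>\<turnstile> \<^bold>\<langle>m \<^bold>\<leadsto>\<^sup>* n\<^bold>\<rangle>"
  shows "S ||- \<^bold>\<turnstile> \<^bold>\<langle>l \<^bold>\<leadsto>\<^sup>* n\<^bold>\<rangle>"
proof -
  let ?p = "All Ti (\<^bold>\<turnstile> \<^bold>\<langle>Bnd (Suc 0) \<^bold>\<leadsto>\<^sup>* Bnd 0\<^bold>\<rangle> \<^bold>\<supset> \<^bold>\<turnstile> \<^bold>\<langle>Bnd 2 \<^bold>\<leadsto>\<^sup>* Bnd 0\<^bold>\<rangle>)"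
  have iff: "S ||- app2 ?p m v \<longleftrightarrow>
      (\<forall>S' w. S \<sqsubseteq> S' \<longrightarrow> S' ||- \<^bold>\<turnstile> \<^bold>\<langle>v \<^bold>\<leadsto>\<^sup>* w\<^bold>\<rangle> \<longrightarrow> S' ||- \<^bold>\<turnstile> \<^bold>\<langle>m \<^bold>\<leadsto>\<^sup>* w\<^bold>\<rangle>)"
    if "typed m Ti" "typed v Ti" for S m v using that by (auto simp: forcing)
  have "S ||- app2 ?p l m"
  proof (rule reds_induct[OF _ assms(1)])
    show "pred2 ?p" by (simp add: pred2_def)
    show "S ||- app2 ?p m m" if "typed m Ti" for S m using that by (subst iff) auto
    fix S m m' n assume h: "S ||- \<^bold>\<turnstile> \<^bold>\<langle>m \<^bold>\<leadsto> m'\<^bold>\<rangle>" "S ||- \<^bold>\<turnstile> \<^bold>\<langle>m' \<^bold>\<leadsto>\<^sup>* n\<^bold>\<rangle>" "S ||- app2 ?p m' n"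
    then show "S ||- app2 ?p m n"
      using ent_ty_atom(2)[OF h(1)] ent_ty_atom(3)[OF h(2)] iff
      by (auto intro: reds_step ent_mono[OF h(1)])
  qed
  then show ?thesis using iff ent_ty_atom(3)[OF assms(1)] assms(2) by blast
qed

lemma reds_app:
  assumes "S ||- \<^bold>\<turnstile> \<^bold>\<langle>m \<^bold>\<leadsto>\<^sup>* m'\<^bold>\<rangle>" "typed n Ti"
  shows "S ||- \<^bold>\<turnstile> \<^bold>\<langle>app_tm m n \<^bold>\<leadsto>\<^sup>* app_tm m' n\<^bold>\<rangle>"
proof -
  let ?p = "All Ti (\<^bold>\<turnstile> \<^bold>\<langle>app_tm (Bnd 2) (Bnd 0) \<^bold>\<leadsto>\<^sup>* app_tm (Bnd (Suc 0)) (Bnd 0)\<^bold>\<rangle>)"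
  have iff: "S ||- app2 ?p m v \<longleftrightarrow> (\<forall>n. typed n Ti \<longrightarrow> S ||- \<^bold>\<turnstile> \<^bold>\<langle>app_tm m n \<^bold>\<leadsto>\<^sup>* app_tm v n\<^bold>\<rangle>)"
    if "typed m Ti" "typed v Ti" for S m v using that by (auto simp: forcing)
  have "S ||- app2 ?p m m'"
  proof (rule reds_induct[OF _ assms(1)])
    show "pred2 ?p" by (simp add: pred2_def)
    show "S ||- app2 ?p m m" if "typed m Ti" for S m
      using that by (subst iff) (auto intro: reds_refl)
    fix S m m' n assume h: "S ||- \<^bold>\<turnstile> \<^bold>\<langle>m \<^bold>\<leadsto> m'\<^bold>\<rangle>" "S ||- \<^bold>\<turnstile> \<^bold>\<langle>m' \<^bold>\<leadsto>\<^sup>* n\<^bold>\<rangle>" "S ||- app2 ?p m' n"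
    then show "S ||- app2 ?p m n"
      using ent_ty_atom(2)[OF h(1)] ent_ty_atom(3)[OF h(2)] iff
      by (auto intro: reds_step red_app)
  qed
  then show ?thesis using iff ent_ty_atom(3)[OF assms(1)] assms(2) by blast
qed

lemma eval_reds:
  assumes "S ||- \<^bold>\<turnstile> \<^bold>\<langle>m \<^bold>\<Down> v\<^bold>\<rangle>"
  shows "S ||- \<^bold>\<turnstile> \<^bold>\<langle>m \<^bold>\<leadsto>\<^sup>* v\<^bold>\<rangle>"
proof -
  let ?p = "\<^bold>\<turnstile> \<^bold>\<langle>Bnd (Suc 0) \<^bold>\<leadsto>\<^sup>* Bnd 0\<^bold>\<rangle>"
  have eq: "app2 ?p m v = \<^bold>\<turnstile> \<^bold>\<langle>m \<^bold>\<leadsto>\<^sup>* v\<^bold>\<rangle>" if "typed m Ti" for m v using that by simp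
  have "S ||- app2 ?p m v"
  proof (rule eval_induct[OF _ assms(1)])
    show "pred2 ?p" by (simp add: pred2_def)
    show "S ||- app2 ?p (abs_tm r) (abs_tm r)" if "typed r Tii" for S r
      using that by (auto intro: reds_refl)
    fix S m n r v
    assume n: "typed n Ti" and mr: "S ||- \<^bold>\<turnstile> \<^bold>\<langle>m \<^bold>\<Down> abs_tm r\<^bold>\<rangle>" and IHm: "S ||- app2 ?p m (abs_tm r)"
      and rv: "S ||- \<^bold>\<turnstile> \<^bold>\<langle>(r \<cdot> n) \<^bold>\<Down> v\<^bold>\<rangle>" and IHr: "S ||- app2 ?p (r \<cdot> n) v"
    have ty: "typed m Ti" "typed r Tii" "typed v Ti"
      using ent_ty_atom(1)[OF mr] ent_ty_atom(1)[OF rv] by auto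
    have "S ||- \<^bold>\<turnstile> \<^bold>\<langle>app_tm m n \<^bold>\<leadsto>\<^sup>* app_tm (abs_tm r) n\<^bold>\<rangle>"
      by (rule reds_app[OF _ n]) (use IHm eq ty in simp)
    moreover have "S ||- \<^bold>\<turnstile> \<^bold>\<langle>app_tm (abs_tm r) n \<^bold>\<leadsto>\<^sup>* v\<^bold>\<rangle>"
      by (rule reds_step[OF red_beta[OF ty(2) n]]) (use IHr ty n in simp)
    ultimately have "S ||- \<^bold>\<turnstile> \<^bold>\<langle>app_tm m n \<^bold>\<leadsto>\<^sup>* v\<^bold>\<rangle>" by (rule reds_trans)
    then show "S ||- app2 ?p (app_tm m n) v" using ty n by simp
  qed
  then show ?thesis using ent_ty_atom(1)[OF assms] by simp
qed

text \<open>Evaluation is closed under expansion: a beta step is undone by the clause for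
  application, an abstraction evaluating to itself, and a step in the function by the induction
  hypothesis.\<close>

lemma red_eval:
  assumes "S ||- \<^bold>\<turnstile> \<^bold>\<langle>m \<^bold>\<leadsto> n\<^bold>\<rangle>" "S ||- \<^bold>\<turnstile> \<^bold>\<langle>n \<^bold>\<Down> v\<^bold>\<rangle>"
  shows "S ||- \<^bold>\<turnstile> \<^bold>\<langle>m \<^bold>\<Down> v\<^bold>\<rangle>"
proof -
  let ?p = "All Ti (\<^bold>\<turnstile> \<^bold>\<langle>Bnd (Suc 0) \<^bold>\<Down> Bnd 0\<^bold>\<rangle> \<^bold>\<supset> \<^bold>\<turnstile> \<^bold>\<langle>Bnd 2 \<^bold>\<Down> Bnd 0\<^bold>\<rangle>)"
  have iff: "S ||- app2 ?p m n \<longleftrightarrow>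
      (\<forall>S' v. S \<sqsubseteq> S' \<longrightarrow> S' ||- \<^bold>\<turnstile> \<^bold>\<langle>n \<^bold>\<Down> v\<^bold>\<rangle> \<longrightarrow> S' ||- \<^bold>\<turnstile> \<^bold>\<langle>m \<^bold>\<Down> v\<^bold>\<rangle>)"
    if "typed m Ti" "typed n Ti" for S m n using that by (auto simp: forcing)
  have "S ||- app2 ?p m n"
  proof (rule red_induct[OF _ assms(1)])
    show "pred2 ?p" by (simp add: pred2_def)
    show "S ||- app2 ?p (app_tm (abs_tm r) n) (r \<cdot> n)"
      if "typed r Tii" "typed n Ti" for S r n
      using that by (subst iff) (auto intro: eval_app eval_abs)
    fix S m m' n
    assume n: "typed n Ti" and mm: "S ||- \<^bold>\<turnstile> \<^bold>\<langle>m \<^bold>\<leadsto> m'\<^bold>\<rangle>" and IH: "S ||- app2 ?p m m'"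
    have ty: "typed m Ti" "typed m' Ti" using ent_ty_atom(2)[OF mm] by auto
    note IH = IH[unfolded iff[OF ty], rule_format]
    have "S' ||- \<^bold>\<turnstile> \<^bold>\<langle>app_tm m n \<^bold>\<Down> v\<^bold>\<rangle>" if S': "S \<sqsubseteq> S'" and "S' ||- \<^bold>\<turnstile> \<^bold>\<langle>app_tm m' n \<^bold>\<Down> v\<^bold>\<rangle>" for S' v
      using that(2)
    proof (rule eval_app_inv)
      fix S2 r assume S2: "S' \<sqsubseteq> S2" and r: "S2 ||- \<^bold>\<turnstile> \<^bold>\<langle>m' \<^bold>\<Down> abs_tm r\<^bold>\<rangle>" "S2 ||- \<^bold>\<turnstile> \<^bold>\<langle>(r \<cdot> n) \<^bold>\<Down> v\<^bold>\<rangle>"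
      have "S2 ||- \<^bold>\<turnstile> \<^bold>\<langle>m \<^bold>\<Down> abs_tm r\<^bold>\<rangle>" by (rule IH[OF _ r(1)]) (use S' S2 in auto)
      then show "S2 ||- \<^bold>\<turnstile> \<^bold>\<langle>app_tm m n \<^bold>\<Down> v\<^bold>\<rangle>" by (rule eval_app[OF _ r(2) n])
    qed
    then show "S ||- app2 ?p (app_tm m n) (app_tm m' n)" by (subst iff) (use ty n in auto)
  qed
  then show ?thesis using iff ent_ty_atom(2)[OF assms(1)] assms(2) by blast
qed

lemma reds_eval:
  assumes "S ||- \<^bold>\<turnstile> \<^bold>\<langle>m \<^bold>\<leadsto>\<^sup>* n\<^bold>\<rangle>" "S ||- \<^bold>\<turnstile> \<^bold>\<langle>n \<^bold>\<Down> v\<^bold>\<rangle>"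
  shows "S ||- \<^bold>\<turnstile> \<^bold>\<langle>m \<^bold>\<Down> v\<^bold>\<rangle>"
proof -
  let ?p = "All Ti (\<^bold>\<turnstile> \<^bold>\<langle>Bnd (Suc 0) \<^bold>\<Down> Bnd 0\<^bold>\<rangle> \<^bold>\<supset> \<^bold>\<turnstile> \<^bold>\<langle>Bnd 2 \<^bold>\<Down> Bnd 0\<^bold>\<rangle>)"
  have iff: "S ||- app2 ?p m n \<longleftrightarrow>
      (\<forall>S' v. S \<sqsubseteq> S' \<longrightarrow> S' ||- \<^bold>\<turnstile> \<^bold>\<langle>n \<^bold>\<Down> v\<^bold>\<rangle> \<longrightarrow> S' ||- \<^bold>\<turnstile> \<^bold>\<langle>m \<^bold>\<Down> v\<^bold>\<rangle>)"
    if "typed m Ti" "typed n Ti" for S m n using that by (auto simp: forcing)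
  have "S ||- app2 ?p m n"
  proof (rule reds_induct[OF _ assms(1)])
    show "pred2 ?p" by (simp add: pred2_def)
    show "S ||- app2 ?p m m" if "typed m Ti" for S m using that by (subst iff) auto
    fix S m m' n assume h: "S ||- \<^bold>\<turnstile> \<^bold>\<langle>m \<^bold>\<leadsto> m'\<^bold>\<rangle>" "S ||- \<^bold>\<turnstile> \<^bold>\<langle>m' \<^bold>\<leadsto>\<^sup>* n\<^bold>\<rangle>" "S ||- app2 ?p m' n"
    then show "S ||- app2 ?p m n"
      using ent_ty_atom(2)[OF h(1)] ent_ty_atom(3)[OF h(2)] iff
      by (auto intro: red_eval[OF ent_mono[OF h(1)]])
  qed
  then show ?thesis using iff ent_ty_atom(3)[OF assms(1)] assms(2) by blast
qed

section \<open>Subject reduction\<close>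

lemma red_typeof:
  assumes "S ||- \<^bold>\<turnstile> \<^bold>\<langle>m \<^bold>\<leadsto> n\<^bold>\<rangle>" "S ||- \<^bold>\<turnstile> \<^bold>\<langle>typeof_tm m t\<^bold>\<rangle>"
  shows "S ||- \<^bold>\<turnstile> \<^bold>\<langle>typeof_tm n t\<^bold>\<rangle>"
proof -
  let ?p = "All Ti (\<^bold>\<turnstile> \<^bold>\<langle>typeof_tm (Bnd 2) (Bnd 0)\<^bold>\<rangle> \<^bold>\<supset> \<^bold>\<turnstile> \<^bold>\<langle>typeof_tm (Bnd (Suc 0)) (Bnd 0)\<^bold>\<rangle>)"
  have iff: "S ||- app2 ?p m n \<longleftrightarrow>
      (\<forall>S' t. S \<sqsubseteq> S' \<longrightarrow> S' ||- \<^bold>\<turnstile> \<^bold>\<langle>typeof_tm m t\<^bold>\<rangle> \<longrightarrow> S' ||- \<^bold>\<turnstile> \<^bold>\<langle>typeof_tm n t\<^bold>\<rangle>)"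
    if "typed m Ti" "typed n Ti" for S m n using that by (auto simp: forcing)
  have "S ||- app2 ?p m n"
  proof (rule red_induct[OF _ assms(1)])
    show "pred2 ?p" by (simp add: pred2_def)
    fix S r n assume r: "typed r Tii" and n: "typed n Ti"
    have "S' ||- \<^bold>\<turnstile> \<^bold>\<langle>typeof_tm (r \<cdot> n) t\<^bold>\<rangle>" if "S' ||- \<^bold>\<turnstile> \<^bold>\<langle>typeof_tm (app_tm (abs_tm r) n) t\<^bold>\<rangle>" for S' t
      using that
    proof (rule typeof_app_inv)
      fix S2 u assume f: "S2 ||- \<^bold>\<turnstile> \<^bold>\<langle>typeof_tm (abs_tm r) (arr_tm u t)\<^bold>\<rangle>" and a: "S2 ||- \<^bold>\<turnstile> \<^bold>\<langle>typeof_tm n u\<^bold>\<rangle>"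
      \<comment> \<open>\<open>typeof_abs_inv\<close> is taken at the actual argument
        \<open>n\<close>, so the hypothesis left to be cut is the typing \<open>a\<close>.\<close>
      from f n show "S2 ||- \<^bold>\<turnstile> \<^bold>\<langle>typeof_tm (r \<cdot> n) t\<^bold>\<rangle>"
        by (rule typeof_abs_inv) (erule (1) prov_cut, rule ent_mono[OF a])
    qed
    then show "S ||- app2 ?p (app_tm (abs_tm r) n) (r \<cdot> n)" by (subst iff) (use r n in auto)
  next
    fix S m m' n
    assume n: "typed n Ti" and mm: "S ||- \<^bold>\<turnstile> \<^bold>\<langle>m \<^bold>\<leadsto> m'\<^bold>\<rangle>" and IH: "S ||- app2 ?p m m'"
    have ty: "typed m Ti" "typed m' Ti" using ent_ty_atom(2)[OF mm] by auto
    note IH = IH[unfolded iff[OF ty], rule_format]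
    have "S' ||- \<^bold>\<turnstile> \<^bold>\<langle>typeof_tm (app_tm m' n) t\<^bold>\<rangle>"
      if S': "S \<sqsubseteq> S'" and "S' ||- \<^bold>\<turnstile> \<^bold>\<langle>typeof_tm (app_tm m n) t\<^bold>\<rangle>" for S' t
      using that(2)
    proof (rule typeof_app_inv)
      fix S2 u assume S2: "S' \<sqsubseteq> S2" and f: "S2 ||- \<^bold>\<turnstile> \<^bold>\<langle>typeof_tm m (arr_tm u t)\<^bold>\<rangle>"
        and a: "S2 ||- \<^bold>\<turnstile> \<^bold>\<langle>typeof_tm n u\<^bold>\<rangle>"
      have "S2 ||- \<^bold>\<turnstile> \<^bold>\<langle>typeof_tm m' (arr_tm u t)\<^bold>\<rangle>" by (rule IH[OF _ f]) (use S' S2 in auto)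
      then show "S2 ||- \<^bold>\<turnstile> \<^bold>\<langle>typeof_tm (app_tm m' n) t\<^bold>\<rangle>" using a by (rule typeof_app)
    qed
    then show "S ||- app2 ?p (app_tm m n) (app_tm m' n)" by (subst iff) (use ty n in auto)
  qed
  then show ?thesis using iff ent_ty_atom(2)[OF assms(1)] assms(2) by blast
qed

lemma reds_typeof:
  assumes "S ||- \<^bold>\<turnstile> \<^bold>\<langle>m \<^bold>\<leadsto>\<^sup>* n\<^bold>\<rangle>" "S ||- \<^bold>\<turnstile> \<^bold>\<langle>typeof_tm m t\<^bold>\<rangle>"
  shows "S ||- \<^bold>\<turnstile> \<^bold>\<langle>typeof_tm n t\<^bold>\<rangle>"
proof -
  let ?p = "All Ti (\<^bold>\<turnstile> \<^bold>\<langle>typeof_tm (Bnd 2) (Bnd 0)\<^bold>\<rangle> \<^bold>\<supset> \<^bold>\<turnstile> \<^bold>\<langle>typeof_tm (Bnd (Suc 0)) (Bnd 0)\<^bold>\<rangle>)"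
  have iff: "S ||- app2 ?p m n \<longleftrightarrow>
      (\<forall>S' t. S \<sqsubseteq> S' \<longrightarrow> S' ||- \<^bold>\<turnstile> \<^bold>\<langle>typeof_tm m t\<^bold>\<rangle> \<longrightarrow> S' ||- \<^bold>\<turnstile> \<^bold>\<langle>typeof_tm n t\<^bold>\<rangle>)"
    if "typed m Ti" "typed n Ti" for S m n using that by (auto simp: forcing)
  have "S ||- app2 ?p m n"
  proof (rule reds_induct[OF _ assms(1)])
    show "pred2 ?p" by (simp add: pred2_def)
    show "S ||- app2 ?p m m" if "typed m Ti" for S m using that by (subst iff) auto
    fix S m m' n assume h: "S ||- \<^bold>\<turnstile> \<^bold>\<langle>m \<^bold>\<leadsto> m'\<^bold>\<rangle>" "S ||- \<^bold>\<turnstile> \<^bold>\<langle>m' \<^bold>\<leadsto>\<^sup>* n\<^bold>\<rangle>" "S ||- app2 ?p m' n"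
    then show "S ||- app2 ?p m n"
      using ent_ty_atom(2)[OF h(1)] ent_ty_atom(3)[OF h(2)] iff
      by (auto intro: red_typeof[OF ent_mono[OF h(1)]])
  qed
  then show ?thesis using iff ent_ty_atom(3)[OF assms(1)] assms(2) by blast
qed

theorem theorem8p1:
  shows "let m = (0, Ti); m1 = (1, Ti); m2 = (2, Ti); n = (3, Ti); t = (4, Ti);
      r = (0, Ti \<rightarrow>\<^sub>t Ti); r1 = (1, Ti \<rightarrow>\<^sub>t Ti); r2 = (2, Ti \<rightarrow>\<^sub>t Ti) in
    \<comment> \<open>determinacy\<close>
    derivable D_all (all_fm m (all_fm m1 (all_fm m2
      (\<^bold>\<turnstile> \<^bold>\<langle>Free m \<^bold>\<Down> Free m1\<^bold>\<rangle> \<^bold>\<supset> \<^bold>\<turnstile> \<^bold>\<langle>Free m \<^bold>\<Down> Free m2\<^bold>\<rangle> \<^bold>\<supset> Free m1 \<^bold>\<equiv> Free m2)))) \<and>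
    derivable D_all (all_fm m (all_fm m1 (all_fm m2
      (\<^bold>\<turnstile> \<^bold>\<langle>Free m \<^bold>\<leadsto> Free m1\<^bold>\<rangle> \<^bold>\<supset> \<^bold>\<turnstile> \<^bold>\<langle>Free m \<^bold>\<leadsto> Free m2\<^bold>\<rangle> \<^bold>\<supset> Free m1 \<^bold>\<equiv> Free m2)))) \<and>
    derivable D_all (all_fm m (all_fm r1 (all_fm r2
      (\<^bold>\<turnstile> \<^bold>\<langle>Free m \<^bold>\<leadsto>\<^sup>* abs_tm (Free r1)\<^bold>\<rangle> \<^bold>\<supset> \<^bold>\<turnstile> \<^bold>\<langle>Free m \<^bold>\<leadsto>\<^sup>* abs_tm (Free r2)\<^bold>\<rangle> \<^bold>\<supset>
       abs_tm (Free r1) \<^bold>\<equiv> abs_tm (Free r2))))) \<and>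
    \<comment> \<open>equivalence\<close>
    derivable D_all (all_fm m (all_fm r
      (\<^bold>\<turnstile> \<^bold>\<langle>Free m \<^bold>\<Down> abs_tm (Free r)\<^bold>\<rangle> \<^bold>\<supset> \<^bold>\<turnstile> \<^bold>\<langle>Free m \<^bold>\<leadsto>\<^sup>* abs_tm (Free r)\<^bold>\<rangle>))) \<and>
    derivable D_all (all_fm m (all_fm r
      (\<^bold>\<turnstile> \<^bold>\<langle>Free m \<^bold>\<leadsto>\<^sup>* abs_tm (Free r)\<^bold>\<rangle> \<^bold>\<supset> \<^bold>\<turnstile> \<^bold>\<langle>Free m \<^bold>\<Down> abs_tm (Free r)\<^bold>\<rangle>))) \<and>
    \<comment> \<open>subject reduction\<close>
    (\<forall>R \<in> {\<lambda>M N. M \<^bold>\<Down> N, \<lambda>M N. M \<^bold>\<leadsto> N, \<lambda>M N. M \<^bold>\<leadsto>\<^sup>* N}.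
      derivable D_all (all_fm m (all_fm n
        (\<^bold>\<turnstile> \<^bold>\<langle>R (Free m) (Free n)\<^bold>\<rangle> \<^bold>\<supset>
         all_fm t (\<^bold>\<turnstile> \<^bold>\<langle>typeof_tm (Free m) (Free t)\<^bold>\<rangle> \<^bold>\<supset> \<^bold>\<turnstile> \<^bold>\<langle>typeof_tm (Free n) (Free t)\<^bold>\<rangle>)))))"
proof -
  note s = all_fm_def lam_def forcing
  \<comment> \<open>An abstraction evaluates to itself, so by expansion a reduction to it becomes an
    evaluation.\<close>
  have reds_abs: "S ||- \<^bold>\<turnstile> \<^bold>\<langle>m \<^bold>\<Down> abs_tm r\<^bold>\<rangle>" if "S ||- \<^bold>\<turnstile> \<^bold>\<langle>m \<^bold>\<leadsto>\<^sup>* abs_tm r\<^bold>\<rangle>" for S m r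
    using ent_ty_atom(3)[OF that] by (auto intro: reds_eval[OF that eval_abs])
  show ?thesis
    unfolding Let_def
    apply (intro conjI ballI derivable_ent)
    subgoal by (auto simp: s intro: eval_det ent_mono)
    subgoal by (auto simp: s intro: red_det ent_mono)
    subgoal by (auto simp: s intro: eval_det reds_abs ent_mono)
    subgoal by (auto simp: s intro: eval_reds)
    subgoal by (auto simp: s intro: reds_abs)
    \<comment> \<open>The typing hypothesis lives in a larger \<open>S'\<close> than the reduction,
      which \<open>ent_mono\<close> brings along.\<close>
    subgoal by (auto simp: s intro: red_typeof[OF ent_mono] reds_typeof[OF ent_mono]
          reds_typeof[OF eval_reds[OF ent_mono]])
    done
qed

end
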